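(* Let $n,r,k,j$ be integers with $n\ge 5r+18$, $r+1\ge k\ge 7$ and $j\ge 6$, and let $U$ be a graph on $k$ vertices with $j$ edges which contains $K_3\cup P_3$ as a subgraph, but contains neither a cycle on $4$ vertices nor $Z_4$ as a subgraph. Then $$\sigma\big(K_{r+1}-U,\,n\big)=\begin{cases}(r-1)(2n-r)-3(n-r)-1, & \text{if } n-r \text{ is odd},\\ (r-1)(2n-r)-3(n-r), & \text{if } n-r \text{ is even}.\end{cases}$$
   Context: A sequence $\pi=(d_1,\dots,d_n)$ of non-increasing nonnegative integers is graphic if it is the degree sequence of a simple graph on $n$ vertices (a realization of $\pi$); write $\sigma(\pi)=d_1+\dots+d_n$. For a graph $H$, $\pi$ is potentially $H$-graphic if some realization of $\pi$ contains $H$ as a (not necessarily induced) subgraph. $\sigma(H,n)$ denotes the smallest even integer $l$ such that every $n$-term graphic sequence $\pi$ with $\sigma(\pi)\ge l$ is potentially $H$-graphic. For a graph $H$ that is a subgraph of $K_m$, $K_m-H$ is the graph obtained from $K_m$ by deleting the edges of $H$. $K_3$ is the triangle, $P_3$ denotes the path with $3$ edges (on $4$ vertices), and $K_3\cup P_3$ is their disjoint union. $Z_4$ denotes $K_4-P_2$, where $P_2$ is the path with $2$ edges, i.e. $Z_4$ is a triangle with one pendant edge attached. *)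

theory Defs
  imports Main
begin

definition simple_graph :: "nat set \<Rightarrow> nat set set \<Rightarrow> bool" where
  "simple_graph V E \<longleftrightarrow> finite V \<and> (\<forall>e\<in>E. \<exists>u v. u \<noteq> v \<and> u \<in> V \<and> v \<in> V \<and> e = {u, v})"

definition contains_subgraph :: "nat set \<times> nat set set \<Rightarrow> nat set \<times> nat set set \<Rightarrow> bool" where
  "contains_subgraph G H \<longleftrightarrow>
     (\<exists>f. inj_on f (fst H) \<and> f ` fst H \<subseteq> fst G \<and>
          (\<forall>u v. {u, v} \<in> snd H \<longrightarrow> {f u, f v} \<in> snd G))"

definition degree :: "nat set set \<Rightarrow> nat \<Rightarrow> nat" where
  "degree E v = card {u. {v, u} \<in> E}"

definition realization :: "nat \<Rightarrow> nat list \<Rightarrow> nat set set \<Rightarrow> bool" where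
  "realization n pi E \<longleftrightarrow> length pi = n \<and> simple_graph {0..<n} E \<and> (\<forall>i<n. degree E i = pi ! i)"

definition graphic :: "nat \<Rightarrow> nat list \<Rightarrow> bool" where
  "graphic n pi \<longleftrightarrow> length pi = n \<and> sorted (rev pi) \<and> (\<exists>E. realization n pi E)"

definition potentially_graphic :: "nat set \<times> nat set set \<Rightarrow> nat \<Rightarrow> nat list \<Rightarrow> bool" where
  "potentially_graphic H n pi \<longleftrightarrow>
     (\<exists>E. realization n pi E \<and> contains_subgraph ({0..<n}, E) H)"

definition sigma :: "nat set \<times> nat set set \<Rightarrow> nat \<Rightarrow> nat" where
  "sigma H n = (LEAST l. even l \<and>
      (\<forall>pi. graphic n pi \<and> sum_list pi \<ge> l \<longrightarrow> potentially_graphic H n pi))"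

definition complete_minus :: "nat \<Rightarrow> nat set set \<Rightarrow> nat set \<times> nat set set" where
  "complete_minus m EH = ({0..<m}, {{u, v} | u v. u < m \<and> v < m \<and> u \<noteq> v} - EH)"

definition K3_union_P3 :: "nat set \<times> nat set set" where
  "K3_union_P3 = ({0..<7}, {{0,1},{1,2},{0,2},{3,4},{4,5},{5,6}})"

definition C4 :: "nat set \<times> nat set set" where
  "C4 = ({0..<4}, {{0,1},{1,2},{2,3},{3,0}})"

text \<open>Z4 = K4 - P2: a triangle with a pendant edge.\<close>
definition Z4 :: "nat set \<times> nat set set" where
  "Z4 = ({0..<4}, {{0,1},{1,2},{0,2},{2,3}})"

end

theory Submission
  imports Defs
begin

text \<open>
  Lower bound: join \<open>K\<^sub>r\<^sub>-\<^sub>3\<close> completely to a perfect matching, or to a matching plus a path with two edges.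
  Every realization of the resulting degree sequence has this shape, and four vertices of
  \<open>K\<^sub>r\<^sub>+\<^sub>1 - U\<close> outside the hub would force \<open>C\<^sub>4\<close> or \<open>Z\<^sub>4\<close> in \<open>U\<close>.

  Upper bound: it suffices to find \<open>r + 1\<close> vertices on which the complement of some realization embeds into
  \<open>K\<^sub>3 \<union> P\<^sub>3\<close>, by induction on \<open>r\<close>. Let \<open>S\<close> be the \<open>r + 1\<close> vertices of largest degree, \<open>D\<close> the maximum
  and \<open>m\<close> the minimum degree in \<open>S\<close>. If at most \<open>D + 1\<close> vertices have degree at least \<open>m\<close>, lay off a vertex
  of degree \<open>D\<close> in the manner of Havel and Hakimi: \<open>S\<close> minus that vertex stays on top, and the threshold drops
  by exactly \<open>2 (n - 1)\<close>. Otherwise take a realization with as many edges inside \<open>S\<close> as possible. If a pair of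
  \<open>S\<close> is missing while both its vertices have neighbours outside \<open>S\<close>, edge exchanges show that these
  neighbourhoods are so dense that either they contain \<open>K\<^sub>r\<^sub>+\<^sub>1\<close> or the degree sum is too small. Hence every missing pair
  contains a vertex with all its neighbours in \<open>S\<close>; such vertices have degree at least \<open>r - 2\<close> and there
  are few of them, so that few pairs are missing and they can be rearranged to fit into \<open>K\<^sub>3 \<union> P\<^sub>3\<close>.
\<close>

text \<open>The room in \<open>K3_union_P3\<close>: a vertex of the top set with all its neighbours
  inside misses exactly \<open>r - d\<close> partners there, and the degree sum leaves at most three
  vertices of degree below \<open>r\<close>, or at most five with at most two of degree
  \<open>r - 2\<close>. The obstacle is a vertex with outer neighbours, which may miss many partners
  at once. If two of these are adjacent, it has only one outer neighbour; then the degrees of the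
  missing graph are known up to one unit that can be moved to any low vertex, and parity leaves
  three patterns to draw inside \<open>K3_union_P3\<close>. The condition
  \<open>5 * r + 18 <= n\<close> is consumed by the dense case: the degree sum there is at most
  \<open>9 * (r * r) - 8 * r - 3\<close>, while the threshold at \<open>n = 5 * r + 18\<close> is
  \<open>9 * (r * r) + 15 * r - 91\<close>. The induction starts at \<open>r = 3\<close>, where the
  threshold is \<open>n + 2\<close>: a star with three leaves or a path with three edges suffices,
  as their complements on four vertices are a triangle and a path.\<close>

section \<open>Edge sets, neighbourhoods and degree counts\<close>

definition realizes :: "nat set \<Rightarrow> (nat \<Rightarrow> nat) \<Rightarrow> nat set set \<Rightarrow> bool" where
  "realizes V d E \<longleftrightarrow> simple_graph V E \<and> (\<forall>z\<in>V. degree E z = d z)"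

definition nb :: "nat set set \<Rightarrow> nat \<Rightarrow> nat set" where
  "nb E v = {u. {v, u} \<in> E}"

definition inner_edges :: "nat set \<Rightarrow> nat set set \<Rightarrow> nat" where
  "inner_edges S E = card {e \<in> E. e \<subseteq> S}"

definition co_graph :: "nat set \<Rightarrow> nat set set \<Rightarrow> nat set set" where
  "co_graph S E = {e. e \<subseteq> S \<and> card e = 2 \<and> e \<notin> E}"

text \<open>The complement of the graph on \<open>S\<close> embeds into \<open>K\<^sub>3 \<union> P\<^sub>3\<close>. Isolated vertices of the complement may be
  sent anywhere in \<open>nat\<close>, so that the notion makes sense for every size of \<open>S\<close>.\<close>

definition fits :: "nat set \<Rightarrow> nat set set \<Rightarrow> bool" where
  "fits S E \<longleftrightarrow> (\<exists>f::nat \<Rightarrow> nat. inj_on f S \<and>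
     (\<forall>x\<in>S. \<forall>y\<in>S. x \<noteq> y \<longrightarrow> {x, y} \<notin> E \<longrightarrow> {f x, f y} \<in> snd K3_union_P3))"

lemma nb_iff [simp]: "u \<in> nb E v \<longleftrightarrow> {v, u} \<in> E"
  by (simp add: nb_def)

lemma in_co_graph: "{x, y} \<in> co_graph S E \<longleftrightarrow> x \<in> S \<and> y \<in> S \<and> x \<noteq> y \<and> {x, y} \<notin> E"
  by (auto simp: co_graph_def card_insert_if)

lemma degree_nb: "degree E v = card (nb E v)"
  by (simp add: degree_def nb_def)

lemma simple_graph_edgeD:
  assumes "simple_graph V E" "{x, y} \<in> E"
  shows "x \<in> V" "y \<in> V" "x \<noteq> y"
proof -
  obtain u v where "u \<noteq> v" "u \<in> V" "v \<in> V" "{x, y} = {u, v}"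
    using assms unfolding simple_graph_def by blast
  then show "x \<in> V" "y \<in> V" "x \<noteq> y" by (auto simp: doubleton_eq_iff)
qed

lemma simple_graph_iff: "simple_graph V E \<longleftrightarrow> finite V \<and> (\<forall>e\<in>E. e \<subseteq> V \<and> card e = 2)"
proof -
  have "(\<exists>u v. u \<noteq> v \<and> u \<in> V \<and> v \<in> V \<and> e = {u, v}) \<longleftrightarrow> e \<subseteq> V \<and> card e = 2" for e
    unfolding card_2_iff by (metis insert_subset empty_subsetI)
  then show ?thesis by (simp add: simple_graph_def)
qed

lemma simple_graph_co_graph: "finite S \<Longrightarrow> simple_graph S (co_graph S E)"
  by (simp add: simple_graph_iff co_graph_def)

lemma simple_graph_no_loop: "simple_graph V E \<Longrightarrow> {x} \<notin> E"
  using simple_graph_edgeD(3)[of V E x x] by auto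

lemma simple_graph_finite_V: "simple_graph V E \<Longrightarrow> finite V"
  by (simp add: simple_graph_def)

lemma simple_graph_finite: "simple_graph V E \<Longrightarrow> finite E"
  by (rule finite_subset[of _ "Pow V"]) (auto simp: simple_graph_def)

lemma nb_subset:
  assumes "simple_graph V E"
  shows "nb E v \<subseteq> V - {v}"
proof
  fix u assume "u \<in> nb E v"
  then have "{v, u} \<in> E" by simp
  from simple_graph_edgeD[OF assms this] show "u \<in> V - {v}" by simp
qed

lemma finite_nb: "simple_graph V E \<Longrightarrow> finite (nb E v)"
  using finite_subset[OF nb_subset] simple_graph_finite_V by blast

text \<open>Written as a sum over edges, the degree condition for an exchange becomes an identity
  between sums over the removed and the added edges.\<close>

lemma degree_eq_sum:
  assumes "simple_graph V E"
  shows "degree E z = (\<Sum>e\<in>E. of_bool (z \<in> e))"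
proof -
  have "bij_betw (\<lambda>u. {z, u}) (nb E z) {e \<in> E. z \<in> e}"
  proof (rule bij_betwI')
    show "({z, x} = {z, y}) = (x = y)" for x y by (auto simp: doubleton_eq_iff)
    show "\<And>x. x \<in> nb E z \<Longrightarrow> {z, x} \<in> {e \<in> E. z \<in> e}" by simp
  next
    fix e assume "e \<in> {e \<in> E. z \<in> e}"
    then obtain u v where "u \<noteq> v" "e = {u, v}" "z \<in> e" "e \<in> E"
      using assms unfolding simple_graph_def by blast
    then have "v \<in> nb E z \<and> e = {z, v} \<or> u \<in> nb E z \<and> e = {z, u}" by (auto simp: insert_commute)
    then show "\<exists>x\<in>nb E z. e = {z, x}" by blast
  qed
  then have "degree E z = card {e \<in> E. z \<in> e}"
    unfolding degree_nb by (rule bij_betw_same_card)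
  also have "\<dots> = (\<Sum>e\<in>E. of_bool (z \<in> e))"
    using simple_graph_finite[OF assms] by (simp add: sum_of_bool_eq Int_def)
  finally show ?thesis .
qed

lemma doubleton_in_star: "{a, b} \<in> (\<lambda>y. {c, y}) ` X \<longleftrightarrow> a = c \<and> b \<in> X \<or> b = c \<and> a \<in> X"
  by (simp only: image_iff doubleton_eq_iff) blast

lemma handshake:
  assumes "simple_graph V E"
  shows "(\<Sum>z\<in>V. degree E z) = 2 * card E"
proof -
  have "(\<Sum>z\<in>V. degree E z) = (\<Sum>e\<in>E. \<Sum>z\<in>V. of_bool (z \<in> e))"
    by (subst sum.swap) (simp add: degree_eq_sum[OF assms])
  also have "\<dots> = (\<Sum>e\<in>E. 2)"
  proof (rule sum.cong[OF refl])
    fix e assume "e \<in> E"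
    then obtain u v where uv: "u \<noteq> v" "u \<in> V" "v \<in> V" "e = {u, v}"
      using assms unfolding simple_graph_def by blast
    have "(\<Sum>z\<in>V. of_bool (z \<in> e)) = (\<Sum>z\<in>{u, v}. of_bool (z \<in> e) :: nat)"
      using uv simple_graph_finite_V[OF assms] by (intro sum.mono_neutral_right) auto
    also have "\<dots> = 2" using uv by simp
    finally show "(\<Sum>z\<in>V. of_bool (z \<in> e)) = (2::nat)" .
  qed
  finally show ?thesis by simp
qed

section \<open>Exchanges of edges that preserve all degrees\<close>

lemma realizes_exchange:
  assumes re: "realizes V d E" and RE: "R \<subseteq> E" and disj: "A \<inter> (E - R) = {}"
    and A: "\<And>e. e \<in> A \<Longrightarrow> e \<subseteq> V \<and> card e = 2"
    and bal: "\<And>z. z \<in> V \<Longrightarrow> (\<Sum>e\<in>R. of_bool (z \<in> e)) = (\<Sum>e\<in>A. of_bool (z \<in> e) :: nat)"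
  shows "realizes V d (E - R \<union> A)"
proof -
  have sg: "simple_graph V E" using re by (simp add: realizes_def)
  have sg': "simple_graph V (E - R \<union> A)"
    using sg A unfolding simple_graph_iff by blast
  have fE: "finite E" and fA: "finite A"
    using simple_graph_finite[OF sg] simple_graph_finite[OF sg'] by auto
  have "degree (E - R \<union> A) z = degree E z" if "z \<in> V" for z
  proof -
    have "degree (E - R \<union> A) z = (\<Sum>e\<in>E-R. of_bool (z \<in> e)) + (\<Sum>e\<in>A. of_bool (z \<in> e))"
      unfolding degree_eq_sum[OF sg'] using fE fA disj by (intro sum.union_disjoint) auto
    also have "\<dots> = (\<Sum>e\<in>E-R. of_bool (z \<in> e)) + (\<Sum>e\<in>R. of_bool (z \<in> e))"
      using bal[OF that] by simp
    also have "\<dots> = degree E z"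
      unfolding degree_eq_sum[OF sg] using fE RE
      by (metis (no_types, lifting) sum.subset_diff)
    finally show ?thesis .
  qed
  then show ?thesis using re sg' by (simp add: realizes_def)
qed

lemma sum_doubleton: "a \<noteq> b \<Longrightarrow> sum f {a, b} = f a + f b"
  by simp

lemma sum_tripleton: "a \<noteq> b \<Longrightarrow> a \<noteq> c \<Longrightarrow> b \<noteq> c \<Longrightarrow> sum f {a, b, c} = f a + (f b + f c)"
  by simp

lemma of_bool_mem_doubleton:
  "a \<noteq> b \<Longrightarrow> of_bool (z \<in> {a, b}) = of_bool (z = a) + (of_bool (z = b) :: nat)"
  by auto

lemma realizes_switch:
  assumes re: "realizes V d E" and e1: "{u, x} \<in> E" and e2: "{v, y} \<in> E"
    and n1: "{u, v} \<notin> E" "u \<noteq> v" and n2: "{x, y} \<notin> E" "x \<noteq> y"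
  shows "realizes V d (E - {{u, x}, {v, y}} \<union> {{u, v}, {x, y}})"
proof (rule realizes_exchange[OF re])
  have sg: "simple_graph V E" using re by (simp add: realizes_def)
  note D = simple_graph_edgeD[OF sg e1] simple_graph_edgeD[OF sg e2]
  show "{{u, x}, {v, y}} \<subseteq> E" using e1 e2 by simp
  show "{{u, v}, {x, y}} \<inter> (E - {{u, x}, {v, y}}) = {}" using n1 n2 by auto
  show "e \<subseteq> V \<and> card e = 2" if "e \<in> {{u, v}, {x, y}}" for e
    using that D n1 n2 by auto
  have ne: "u \<noteq> y" "v \<noteq> x" using e1 e2 n1 n2 by (auto simp: insert_commute)
  have d1: "{u, x} \<noteq> {v, y}" and d2: "{u, v} \<noteq> {x, y}"
    using n1 n2 D ne by (auto simp: doubleton_eq_iff)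
  show "(\<Sum>e\<in>{{u, x}, {v, y}}. of_bool (z \<in> e)) = (\<Sum>e\<in>{{u, v}, {x, y}}. of_bool (z \<in> e) :: nat)" for z
    unfolding sum_doubleton[OF d1] sum_doubleton[OF d2]
    of_bool_mem_doubleton[OF D(3)] of_bool_mem_doubleton[OF D(6)]
    of_bool_mem_doubleton[OF n1(2)] of_bool_mem_doubleton[OF n2(2)] by simp
qed

text \<open>The six pairs alternate along the closed walk \<open>u x w p y v u\<close>. Some of its
  vertices may coincide, as with \<open>x = y\<close> in \<open>far_neighbours\<close>; the
  inequalities keep the pairs distinct.\<close>

lemma realizes_switch3:
  assumes re: "realizes V d E" and e1: "{u, x} \<in> E" and e2: "{v, y} \<in> E" and e3: "{w, p} \<in> E"
    and n1: "{u, v} \<notin> E" "u \<noteq> v" and n2: "{x, w} \<notin> E" "x \<noteq> w" and n3: "{y, p} \<notin> E" "y \<noteq> p"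
    and ne: "u \<noteq> y" "w \<noteq> u" "w \<noteq> v" "w \<noteq> y" "v \<noteq> x"
  shows "realizes V d (E - {{u, x}, {v, y}, {w, p}} \<union> {{u, v}, {x, w}, {y, p}})"
proof (rule realizes_exchange[OF re])
  have sg: "simple_graph V E" using re by (simp add: realizes_def)
  note D = simple_graph_edgeD[OF sg e1] simple_graph_edgeD[OF sg e2] simple_graph_edgeD[OF sg e3]
  show "{{u, x}, {v, y}, {w, p}} \<subseteq> E" using e1 e2 e3 by simp
  show "{{u, v}, {x, w}, {y, p}} \<inter> (E - {{u, x}, {v, y}, {w, p}}) = {}" using n1 n2 n3 by auto
  show "e \<subseteq> V \<and> card e = 2" if "e \<in> {{u, v}, {x, w}, {y, p}}" for e
    using that D n1 n2 n3 by auto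
  have px: "p \<noteq> x" using e3 n2 by (auto simp: insert_commute)
  have d: "{u, x} \<noteq> {v, y}" "{u, x} \<noteq> {w, p}" "{v, y} \<noteq> {w, p}"
    "{u, v} \<noteq> {x, w}" "{u, v} \<noteq> {y, p}" "{x, w} \<noteq> {y, p}"
    using n1 n2 n3 D ne px by (auto simp: doubleton_eq_iff)
  show "(\<Sum>e\<in>{{u, x}, {v, y}, {w, p}}. of_bool (z \<in> e))
      = (\<Sum>e\<in>{{u, v}, {x, w}, {y, p}}. of_bool (z \<in> e) :: nat)" for z
    unfolding sum_tripleton[OF d(1-3)] sum_tripleton[OF d(4-6)]
    of_bool_mem_doubleton[OF D(3)] of_bool_mem_doubleton[OF D(6)] of_bool_mem_doubleton[OF D(9)]
    of_bool_mem_doubleton[OF n1(2)] of_bool_mem_doubleton[OF n2(2)] of_bool_mem_doubleton[OF n3(2)] by simp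
qed

lemma sum_card_nb_swap:
  assumes "finite X" "finite Y"
  shows "(\<Sum>x\<in>X. card (nb E x \<inter> Y)) = (\<Sum>y\<in>Y. card (nb E y \<inter> X))"
proof -
  have c: "card (nb E x \<inter> Z) = (\<Sum>y\<in>Z. of_bool ({x, y} \<in> E))" if "finite Z" for x Z
  proof -
    have "nb E x \<inter> Z = {y \<in> Z. {x, y} \<in> E}" by auto
    then show ?thesis using that by (simp add: sum_of_bool_eq Int_def)
  qed
  have "(\<Sum>x\<in>X. card (nb E x \<inter> Y)) = (\<Sum>y\<in>Y. \<Sum>x\<in>X. of_bool ({x, y} \<in> E))"
    by (simp add: c[OF assms(2)] sum.swap[of _ Y])
  also have "\<dots> = (\<Sum>y\<in>Y. card (nb E y \<inter> X))"
    by (simp add: c[OF assms(1)] insert_commute)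
  finally show ?thesis .
qed

lemma realizesD:
  assumes "realizes V d E"
  shows "simple_graph V E" "finite V" "\<And>z. z \<in> V \<Longrightarrow> card (nb E z) = d z" "\<And>z. finite (nb E z)"
    "\<And>z. nb E z \<subseteq> V - {z}"
proof -
  show sg: "simple_graph V E" using assms by (simp add: realizes_def)
  show "finite V" "\<And>z. finite (nb E z)" "\<And>z. nb E z \<subseteq> V - {z}"
    using sg simple_graph_finite_V finite_nb nb_subset by blast+
  show "\<And>z. z \<in> V \<Longrightarrow> card (nb E z) = d z"
    using assms by (simp add: realizes_def degree_nb)
qed

text \<open>Exchanging the private neighbours of \<open>t\<close> with as many private neighbours of \<open>s\<close> makes \<open>s\<close>
  adjacent to everything \<open>t\<close> was adjacent to.\<close>

lemma fits_replace:
  assumes re: "realizes V d E" and TV: "T \<subseteq> V" and fit: "fits T E"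
    and t: "t \<in> T" and s: "s \<in> V" "s \<notin> T" and ds: "d t \<le> d s"
  shows "\<exists>E'. realizes V d E' \<and> fits (insert s (T - {t})) E'"
proof -
  note rD = realizesD[OF re]
  define P where "P = nb E t - insert s (nb E s)"
  define Q0 where "Q0 = nb E s - insert t (nb E t)"
  have tV: "t \<in> V" "s \<noteq> t" using t s TV by auto
  have fin: "finite P" "finite Q0" unfolding P_def Q0_def using rD(4) by auto
  have st: "t \<in> nb E s \<longleftrightarrow> s \<in> nb E t" by (simp add: insert_commute)
  \<comment> \<open>The edge \<open>st\<close>, if present, counts in both degrees and the common
    neighbours cancel, so \<open>d t <= d s\<close> compares the private parts.\<close>
  have "card P \<le> card Q0"
  proof -
    let ?I = "nb E s \<inter> nb E t"
    have a: "nb E t - {s} = P \<union> ?I" "nb E s - {t} = Q0 \<union> ?I"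
      unfolding P_def Q0_def using rD(5)[of t] rD(5)[of s] by auto
    have b: "card (nb E t - {s}) = card P + card ?I" "card (nb E s - {t}) = card Q0 + card ?I"
      unfolding a using fin rD(4) by (auto intro!: card_Un_disjoint simp: P_def Q0_def)
    have "card (nb E t - {s}) \<le> card (nb E s - {t})"
      using rD(3)[OF tV(1)] rD(3)[OF s(1)] ds st rD(4) by (auto simp: card_Diff_singleton_if diff_le_mono)
    then show ?thesis using b by simp
  qed
  then obtain Q where Q: "Q \<subseteq> Q0" "card Q = card P"
    using obtain_subset_with_card_n by metis
  have finQ: "finite Q" using Q fin finite_subset by blast
  define R where "R = (\<lambda>y. {t, y}) ` P \<union> (\<lambda>z. {s, z}) ` Q"
  define A where "A = (\<lambda>y. {s, y}) ` P \<union> (\<lambda>z. {t, z}) ` Q"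
  have PV: "P \<subseteq> V" "s \<notin> P" "t \<notin> P" and QV: "Q \<subseteq> V" "s \<notin> Q" "t \<notin> Q"
    using rD(5)[of t] rD(5)[of s] simple_graph_no_loop[OF rD(1)] Q unfolding P_def Q0_def by auto
  have inj: "inj_on (\<lambda>y. {a, y}) X" for a and X :: "nat set"
    by (auto simp: inj_on_def doubleton_eq_iff)
  have sums: "(\<Sum>e\<in>(\<lambda>y. {a, y}) ` X \<union> (\<lambda>z. {b, z}) ` Y. of_bool (z \<in> e))
      = of_bool (z = a) * card X + of_bool (z \<in> X) + of_bool (z = b) * card Y + (of_bool (z \<in> Y)::nat)"
    if "finite X" "finite Y" "a \<notin> X" "b \<notin> X" "a \<notin> Y" "b \<notin> Y" "a \<noteq> b" for a b z :: nat and X Y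
  proof -
    have one: "(\<Sum>e\<in>(\<lambda>y. {a, y}) ` X. of_bool (z \<in> e)) = of_bool (z = a) * card X + (of_bool (z \<in> X)::nat)"
      if "finite X" "a \<notin> X" for a :: nat and X
    proof -
      have "(\<Sum>e\<in>(\<lambda>y. {a, y}) ` X. of_bool (z \<in> e)) = (\<Sum>y\<in>X. of_bool (z \<in> {a, y}) :: nat)"
        unfolding sum.reindex[OF inj] comp_def ..
      also have "\<dots> = (\<Sum>y\<in>X. of_bool (z = a) + of_bool (z = y))"
        using that by (intro sum.cong) auto
      also have "\<dots> = of_bool (z = a) * card X + of_bool (z \<in> X)"
        using that by (simp add: sum.distrib of_bool_def sum.delta)
      finally show ?thesis .
    qed
    have "(\<lambda>y. {a, y}) ` X \<inter> (\<lambda>z. {b, z}) ` Y = {}"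
      using that by (auto simp: doubleton_eq_iff)
    then have "(\<Sum>e\<in>(\<lambda>y. {a, y}) ` X \<union> (\<lambda>z. {b, z}) ` Y. of_bool (z \<in> e))
      = (\<Sum>e\<in>(\<lambda>y. {a, y}) ` X. of_bool (z \<in> e)) + (\<Sum>e\<in>(\<lambda>z. {b, z}) ` Y. of_bool (z \<in> e) :: nat)"
      using that by (intro sum.union_disjoint) simp_all
    then show ?thesis unfolding one[OF that(1,3)] one[OF that(2,6)] by simp
  qed
  have re': "realizes V d (E - R \<union> A)"
  proof (rule realizes_exchange[OF re])
    show "R \<subseteq> E" using Q unfolding R_def P_def Q0_def by auto
    show "A \<inter> (E - R) = {}" using Q unfolding A_def P_def Q0_def by auto
    show "e \<subseteq> V \<and> card e = 2" if "e \<in> A" for e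
      using that PV QV tV s unfolding A_def by (auto simp: card_insert_if)
    show "(\<Sum>e\<in>R. of_bool (z \<in> e)) = (\<Sum>e\<in>A. of_bool (z \<in> e) :: nat)" for z
      unfolding R_def A_def sums[OF fin(1) finQ PV(3,2) QV(3,2) tV(2)[symmetric]]
        sums[OF fin(1) finQ PV(2,3) QV(2,3) tV(2)] using Q(2) by simp
  qed
  obtain f where f: "inj_on f T"
    "\<And>x y. x \<in> T \<Longrightarrow> y \<in> T \<Longrightarrow> x \<noteq> y \<Longrightarrow> {x, y} \<notin> E \<Longrightarrow> {f x, f y} \<in> snd K3_union_P3"
    using fit unfolding fits_def by blast
  \<comment> \<open>\<open>s\<close> takes over the place of \<open>t\<close>: a pair at
    \<open>s\<close> that is missing afterwards was already missing at \<open>t\<close>.\<close>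
  define g where "g = f(s := f t)"
  have "inj_on g (insert s (T - {t}))"
    using f(1) s t unfolding g_def by (auto simp: inj_on_def)
  moreover have keep: "{x, y} \<in> E - R \<union> A" if "{x, y} \<in> E" "x \<in> T - {t}" "y \<in> T - {t}" for x y
  proof -
    have "{x, y} \<notin> R" using that s unfolding R_def Un_iff doubleton_in_star by blast
    then show ?thesis using that by simp
  qed
  moreover have new: "{s, y} \<in> E - R \<union> A" if "{t, y} \<in> E" "y \<in> T - {t}" for y
  proof (cases "{s, y} \<in> E")
    case True
    have "y \<noteq> s" "y \<noteq> t" "y \<notin> Q" using that s Q(1) unfolding Q0_def by auto
    then have "{s, y} \<notin> R" using tV QV unfolding R_def Un_iff doubleton_in_star by blast
    then show ?thesis using True by simp
  next
    case False
    then have "y \<in> P" using that s unfolding P_def by auto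
    then show ?thesis unfolding A_def Un_iff doubleton_in_star by simp
  qed
  moreover have "{g x, g y} \<in> snd K3_union_P3"
    if h: "x \<in> insert s (T - {t})" "y \<in> insert s (T - {t})" "x \<noteq> y" "{x, y} \<notin> E - R \<union> A" for x y
  proof -
    consider "x = s" "y \<in> T - {t}" | "y = s" "x \<in> T - {t}" | "x \<in> T - {t}" "y \<in> T - {t}"
      using h by auto
    then show ?thesis
    proof cases
      case 1
      then have "{t, y} \<notin> E" using new h 1 by auto
      then show ?thesis using 1 f(2)[of t y] t s by (auto simp: g_def)
    next
      case 2
      then have "{t, x} \<notin> E" using new[of x] h 2 by (auto simp: insert_commute)
      then show ?thesis using 2 f(2)[of t x] t s by (auto simp: g_def insert_commute)
    next
      case 3
      then have "{x, y} \<notin> E" using keep h 3 by auto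
      then show ?thesis using 3 f(2)[of x y] h s by (auto simp: g_def)
    qed
  qed
  ultimately have "fits (insert s (T - {t})) (E - R \<union> A)" unfolding fits_def by blast
  then show ?thesis using re' by blast
qed

text \<open>Induction on \<open>card (T - S)\<close>: a vertex of \<open>T - S\<close> gives its
  place to one of \<open>S - T\<close>, whose degree is at least as large.\<close>

lemma fits_move_to_top:
  assumes "realizes V d E" "T \<subseteq> V" "fits T E" "S \<subseteq> V" "card T = card S"
    and top: "\<And>s w. s \<in> S \<Longrightarrow> w \<in> V - S \<Longrightarrow> d w \<le> d s"
  shows "\<exists>E'. realizes V d E' \<and> fits S E'"
  using assms(1-5)
proof (induction "card (T - S)" arbitrary: T E)
  case 0
  have fV: "finite V" using realizesD(2)[OF 0(2)] .
  have "T \<subseteq> S" using 0 fV by (simp add: finite_subset)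
  then have "T = S" using 0 fV by (meson card_subset_eq finite_subset)
  then show ?case using 0 by blast
next
  case (Suc k)
  have fV: "finite V" using realizesD(2)[OF Suc(3)] .
  have fT: "finite T" and fS: "finite S" using Suc fV finite_subset by blast+
  from Suc(2) obtain t where t: "t \<in> T" "t \<notin> S"
    by (metis DiffE card.empty equals0I nat.distinct(1))
  have "card (S - T) = card (T - S)"
    using Suc.prems(5) fT fS by (metis card_Diff_subset_Int card_eq_0_iff finite_Int Int_commute)
  then obtain s where s: "s \<in> S" "s \<notin> T" using Suc(2)
    by (metis DiffE card.empty equals0I nat.distinct(1))
  obtain E' where E': "realizes V d E'" "fits (insert s (T - {t})) E'"
    using fits_replace[OF Suc.prems(1-3) t(1)] s t top Suc.prems by blast
  have "insert s (T - {t}) - S = (T - S) - {t}" using s by auto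
  then have "k = card (insert s (T - {t}) - S)"
    using Suc(2) t fT by simp
  moreover have "card (insert s (T - {t})) = card S"
    using s t fT Suc.prems(5) by (simp add: card_gt_0_iff card.insert_remove)
      (metis Suc_pred card_gt_0_iff empty_iff)
  ultimately show ?case
    using Suc(1)[of "insert s (T - {t})" E'] E' s t Suc.prems by blast
qed

subsection \<open>Embedding sparse graphs into a triangle plus a path\<close>

definition tri_path :: "nat \<Rightarrow> nat \<Rightarrow> nat \<Rightarrow> nat \<Rightarrow> nat \<Rightarrow> nat \<Rightarrow> nat \<Rightarrow> nat set set" where
  "tri_path a b c p q s t = {{a, b}, {b, c}, {a, c}, {p, q}, {q, s}, {s, t}}"

lemma fitsI:
  assumes dist: "distinct [a, b, c, p, q, s, t]"
    and sub: "\<And>x y. {x, y} \<in> co_graph S E \<Longrightarrow> {x, y} \<in> tri_path a b c p q s t"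
  shows "fits S E"
proof -
  \<comment> \<open>The seven names take the values 0 to 6; the default \<open>7 + x\<close> keeps
    all other vertices apart from them and from each other.\<close>
  define f where "f = (\<lambda>x. 7 + x)(a := 0, b := 1, c := 2, p := 3, q := 4, s := 5, t := (6::nat))"
  have "inj_on f S" unfolding f_def by (intro inj_on_fun_updI) (auto split: if_splits)
  moreover have v: "f a = 0" "f b = 1" "f c = 2" "f p = 3" "f q = 4" "f s = 5" "f t = 6"
    using dist by (auto simp: f_def)
  have "{f x, f y} \<in> snd K3_union_P3" if "x \<in> S" "y \<in> S" "x \<noteq> y" "{x, y} \<notin> E" for x y
  proof -
    have "{x, y} \<in> tri_path a b c p q s t" using sub that by (simp add: in_co_graph)
    then have "{x, y} = {a, b} \<or> {x, y} = {b, c} \<or> {x, y} = {a, c} \<or> {x, y} = {p, q} \<or>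
      {x, y} = {q, s} \<or> {x, y} = {s, t}" by (simp add: tri_path_def)
    then have "f ` {x, y} \<in> {f ` {a, b}, f ` {b, c}, f ` {a, c}, f ` {p, q}, f ` {q, s}, f ` {s, t}}"
      by (elim disjE) simp_all
    then show ?thesis by (simp add: v K3_union_P3_def)
  qed
  ultimately show ?thesis unfolding fits_def by blast
qed

definition supp :: "nat set set \<Rightarrow> nat set" where
  "supp M = {x. nb M x \<noteq> {}}"

definition matching_on :: "nat set set \<Rightarrow> nat set \<Rightarrow> bool" where
  "matching_on M Y \<longleftrightarrow> (\<forall>x\<in>Y. \<exists>y\<in>Y. nb M x = {y})"

lemma supp_subset:
  assumes "simple_graph X M"
  shows "supp M \<subseteq> X"
proof
  fix x assume "x \<in> supp M"
  then obtain y where "y \<in> nb M x" unfolding supp_def by blast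
  then have "{x, y} \<in> M" by simp
  from simple_graph_edgeD(1)[OF assms this] show "x \<in> X" .
qed

lemma finite_supp: "simple_graph X M \<Longrightarrow> finite (supp M)"
  by (rule finite_subset[OF supp_subset simple_graph_finite_V])

lemma edge_in_supp: "{x, y} \<in> M \<Longrightarrow> x \<in> supp M \<and> y \<in> supp M"
proof -
  assume "{x, y} \<in> M"
  then have "y \<in> nb M x" "x \<in> nb M y" by (auto simp: insert_commute)
  then show ?thesis unfolding supp_def by blast
qed

lemma matching_on_supp_diff:
  assumes sg: "simple_graph X M" and cl: "\<And>x. x \<in> D \<Longrightarrow> nb M x \<subseteq> D"
    and le: "\<And>x. x \<notin> D \<Longrightarrow> card (nb M x) \<le> 1"
  shows "matching_on M (supp M - D)"
  unfolding matching_on_def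
proof
  fix x assume x: "x \<in> supp M - D"
  then have "card (nb M x) \<noteq> 0" using finite_nb[OF sg] by (simp add: supp_def)
  then have "card (nb M x) = 1" using le x by force
  then obtain y where y: "nb M x = {y}" by (rule card_1_singletonE)
  then have e: "{x, y} \<in> M" unfolding nb_iff[symmetric] by simp
  then have "y \<in> supp M" using edge_in_supp by blast
  moreover have "x \<in> nb M y" using e by (simp add: insert_commute)
  then have "y \<notin> D" using cl[of y] x by blast
  ultimately show "\<exists>y\<in>supp M - D. nb M x = {y}" using y by blast
qed

lemma matching_on_pick:
  assumes sg: "simple_graph X M" and m: "matching_on M Y" and Y: "finite Y" and F: "finite F" "F \<inter> Y = {}"
  obtains a b where "a \<noteq> b" "a \<notin> F" "b \<notin> F" "matching_on M (Y - {a, b})"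
    "card (Y - {a, b}) \<le> card Y - 2"
    "\<And>x y. x \<in> Y \<Longrightarrow> {x, y} \<in> M \<Longrightarrow> {x, y} = {a, b} \<or> x \<in> Y - {a, b}"
proof (cases "Y = {}")
  case True
  obtain a where a: "a \<notin> F" using F ex_new_if_finite[OF infinite_UNIV_nat] by blast
  obtain b where b: "b \<notin> insert a F" using F ex_new_if_finite[OF infinite_UNIV_nat, of "insert a F"] by blast
  show ?thesis by (rule that[of a b]) (use a b True in \<open>auto simp: matching_on_def\<close>)
next
  case False
  then obtain a where a: "a \<in> Y" by blast
  then obtain b where b: "b \<in> Y" "nb M a = {b}" using m unfolding matching_on_def by blast
  have ab: "{a, b} \<in> M" unfolding nb_iff[symmetric] b by simp
  from simple_graph_edgeD(3)[OF sg this] have ne: "a \<noteq> b" .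
  have "a \<in> nb M b" using ab by (simp add: insert_commute)
  then have ba: "nb M b = {a}" using m b(1) unfolding matching_on_def by fastforce
  have out: "y \<notin> {a, b}" if "x \<in> Y - {a, b}" "{x, y} \<in> M" for x y
  proof
    assume "y \<in> {a, b}"
    then have "x \<in> nb M a \<or> x \<in> nb M b" using that by (auto simp: insert_commute)
    then show False using b ba that by auto
  qed
  show ?thesis
  proof (rule that[of a b])
    show "a \<noteq> b" "a \<notin> F" "b \<notin> F" using ne a b F by auto
    show "matching_on M (Y - {a, b})"
      unfolding matching_on_def
    proof
      fix x assume x: "x \<in> Y - {a, b}"
      then obtain y where y: "y \<in> Y" "nb M x = {y}" using m unfolding matching_on_def by blast
      then have "{x, y} \<in> M" unfolding nb_iff[symmetric] by simp
      then show "\<exists>y\<in>Y - {a, b}. nb M x = {y}" using y out x by blast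
    qed
    show "card (Y - {a, b}) \<le> card Y - 2" using a b ne Y by (simp add: card_Diff_subset)
    show "{x, y} = {a, b} \<or> x \<in> Y - {a, b}" if "x \<in> Y" "{x, y} \<in> M" for x y
    proof -
      have "y \<in> nb M x" using that by simp
      then show ?thesis using b ba that by auto
    qed
  qed
qed

lemma matching_on_small_empty:
  assumes "simple_graph X M" "matching_on M Y" "finite Y" "card Y \<le> 1"
  shows "Y = {}"
proof (rule ccontr)
  assume "Y \<noteq> {}"
  then obtain a where a: "a \<in> Y" by blast
  then obtain b where b: "b \<in> Y" "nb M a = {b}" using assms(2) unfolding matching_on_def by blast
  have "{a, b} \<in> M" unfolding nb_iff[symmetric] b by simp
  from simple_graph_edgeD(3)[OF assms(1) this] have "a \<noteq> b" .
  then show False using a b assms(3,4) by (metis card_le_Suc0_iff_eq One_nat_def)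
qed

context
  fixes S :: "nat set" and E M :: "nat set set"
  assumes finS: "finite S" and M_def: "M = co_graph S E"
begin

lemma sgM: "simple_graph S M"
  using finS M_def simple_graph_co_graph by simp

text \<open>The path of \<open>tri_path\<close> has room for two disjoint edges, its first and its
  last. The allowance is 5 and not 4 because a single vertex left over cannot be matched.\<close>

lemma fits_triangle_matching:
  assumes abc: "distinct [a, b, c]" and cl: "\<And>x. x \<in> {a, b, c} \<Longrightarrow> nb M x \<subseteq> {a, b, c}"
    and le: "\<And>x. x \<notin> {a, b, c} \<Longrightarrow> card (nb M x) \<le> 1" and cd: "card (supp M - {a, b, c}) \<le> 5"
  shows "fits S E"
proof -
  note fs = finite_supp[OF sgM]
  have m0: "matching_on M (supp M - {a, b, c})" using matching_on_supp_diff[OF sgM cl le] by blast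
  obtain p q where pq: "p \<noteq> q" "p \<notin> {a, b, c}" "q \<notin> {a, b, c}" "matching_on M (supp M - {a, b, c} - {p, q})"
    "card (supp M - {a, b, c} - {p, q}) \<le> card (supp M - {a, b, c}) - 2"
    "\<And>x y. x \<in> supp M - {a, b, c} \<Longrightarrow> {x, y} \<in> M \<Longrightarrow> {x, y} = {p, q} \<or> x \<in> supp M - {a, b, c} - {p, q}"
    by (rule matching_on_pick[OF sgM m0, of "{a, b, c}"]) (simp add: fs, simp, blast, rule that)
  obtain s t where st: "s \<noteq> t" "s \<notin> {a, b, c, p, q}" "t \<notin> {a, b, c, p, q}"
    "matching_on M (supp M - {a, b, c} - {p, q} - {s, t})"
    "card (supp M - {a, b, c} - {p, q} - {s, t}) \<le> card (supp M - {a, b, c} - {p, q}) - 2"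
    "\<And>x y. x \<in> supp M - {a, b, c} - {p, q} \<Longrightarrow> {x, y} \<in> M \<Longrightarrow> {x, y} = {s, t} \<or>
      x \<in> supp M - {a, b, c} - {p, q} - {s, t}"
    by (rule matching_on_pick[OF sgM pq(4), of "{a, b, c, p, q}"]) (simp add: fs, simp, blast, rule that)
  have e: "supp M - {a, b, c} - {p, q} - {s, t} = {}"
    by (rule matching_on_small_empty[OF sgM st(4)]) (use fs pq(5) st(5) cd in auto)
  show ?thesis
  proof (rule fitsI[of a b c p q s t])
    show "distinct [a, b, c, p, q, s, t]" using abc pq st by auto
    fix x y assume "{x, y} \<in> co_graph S E"
    then have xy: "{x, y} \<in> M" by (simp add: M_def)
    show "{x, y} \<in> tri_path a b c p q s t"
    proof (cases "x \<in> {a, b, c}")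
      case True
      then have "y \<in> {a, b, c}" using cl[OF True] xy by auto
      moreover note simple_graph_edgeD(3)[OF sgM xy]
      ultimately show ?thesis using True unfolding tri_path_def by (auto simp: doubleton_eq_iff)
    next
      case False
      then have "x \<in> supp M - {a, b, c}" using edge_in_supp[OF xy] by blast
      from pq(6)[OF this xy] have "{x, y} = {p, q} \<or> {x, y} = {s, t}"
        using st(6)[OF _ xy] unfolding e by auto
      then show ?thesis unfolding tri_path_def by (elim disjE) simp_all
    qed
  qed
qed

lemma fits_path_matching:
  assumes abc: "distinct [a, b, c, e]" and cl: "\<And>x. x \<in> {a, b, c, e} \<Longrightarrow> nb M x \<subseteq> {a, b, c, e}"
    and pth: "{a, c} \<notin> M" "{b, e} \<notin> M" "{a, e} \<notin> M"
    and le: "\<And>x. x \<notin> {a, b, c, e} \<Longrightarrow> card (nb M x) \<le> 1" and cd: "card (supp M - {a, b, c, e}) \<le> 3"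
  shows "fits S E"
proof -
  note fs = finite_supp[OF sgM]
  let ?Y = "supp M - {a, b, c, e}"
  have m0: "matching_on M ?Y" using matching_on_supp_diff[OF sgM cl le] by blast
  obtain p q where pq: "p \<noteq> q" "p \<notin> {a, b, c, e}" "q \<notin> {a, b, c, e}" "matching_on M (?Y - {p, q})"
    "card (?Y - {p, q}) \<le> card ?Y - 2"
    "\<And>x y. x \<in> ?Y \<Longrightarrow> {x, y} \<in> M \<Longrightarrow> {x, y} = {p, q} \<or> x \<in> ?Y - {p, q}"
    by (rule matching_on_pick[OF sgM m0, of "{a, b, c, e}"]) (simp add: fs, simp, blast, rule that)
  have em: "?Y - {p, q} = {}"
    by (rule matching_on_small_empty[OF sgM pq(4)]) (use fs pq(5) cd in auto)
  obtain z where z: "z \<notin> {a, b, c, e, p, q}"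
    using ex_new_if_finite[OF infinite_UNIV_nat, of "{a, b, c, e, p, q}"] by blast
  show ?thesis
  proof (rule fitsI[of p q z a b c e])
    show "distinct [p, q, z, a, b, c, e]" using abc pq z by auto
    fix x y assume "{x, y} \<in> co_graph S E"
    then have xy: "{x, y} \<in> M" by (simp add: M_def)
    show "{x, y} \<in> tri_path p q z a b c e"
    proof (cases "x \<in> {a, b, c, e}")
      case True
      then have "y \<in> {a, b, c, e}" using cl[OF True] xy by auto
      moreover note simple_graph_edgeD(3)[OF sgM xy]
      moreover have "{c, a} \<notin> M" "{e, b} \<notin> M" "{e, a} \<notin> M" using pth by (simp_all add: insert_commute)
      ultimately show ?thesis using True pth xy unfolding tri_path_def
        by (auto simp: doubleton_eq_iff)
    next
      case False
      then have "x \<in> ?Y" using edge_in_supp[OF xy] by blast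
      from pq(6)[OF this xy] have "{x, y} = {p, q}" unfolding em by simp
      then show ?thesis unfolding tri_path_def by simp
    qed
  qed
qed

text \<open>With at most two vertices \<open>p\<close>, \<open>q\<close> of degree 2, all components
  are single edges or short paths. An isolated edge or a path centred at \<open>p\<close> goes to
  the triangle, a path through adjacent \<open>p\<close>, \<open>q\<close> to the path. Two paths
  centred at \<open>p\<close> and \<open>q\<close> use six vertices, and a seventh could not be
  matched.\<close>

lemma fits_sparse:
  assumes cd: "card (supp M) \<le> 7" and le2: "\<And>x. card (nb M x) \<le> 2"
    and k2: "card {x. card (nb M x) = 2} \<le> 2"
  shows "fits S E"
proof -
  note fs = finite_supp[OF sgM]
  note fn = finite_nb[OF sgM]
  let ?T = "{x. card (nb M x) = 2}"
  have Tsub: "?T \<subseteq> supp M" by (auto simp: supp_def)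
  then have fT: "finite ?T" using fs finite_subset by blast
  note nl = simple_graph_edgeD(3)[OF sgM]
  have le1: "card (nb M x) \<le> 1" if "x \<notin> ?T" for x using le2[of x] that by auto
  have one: "nb M x = {y}" if "x \<notin> ?T" "{x, y} \<in> M" for x y
  proof -
    have "y \<in> nb M x" using that by simp
    then show ?thesis using le1[OF that(1)] fn by (metis One_nat_def card_le_Suc0_iff_eq empty_iff insertI1 subsetI subset_singletonD set_eq_subset singletonD)
  qed
  have two: "\<exists>a b. a \<noteq> b \<and> nb M p = {a, b} \<and> {a, p} \<in> M \<and> {b, p} \<in> M \<and> p \<noteq> a \<and> p \<noteq> b" if h: "p \<in> ?T" for p
  proof -
    obtain a b where ab: "nb M p = {a, b}" "a \<noteq> b" using h by (auto simp: card_2_iff)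
    then have "{p, a} \<in> M" "{p, b} \<in> M" unfolding nb_iff[symmetric] by simp_all
    then show ?thesis using ab nl[of p a] nl[of p b] by (auto simp: insert_commute)
  qed
  consider "card ?T = 0" | "card ?T = 1" | "card ?T = 2" using k2 by linarith
  then show ?thesis
  proof cases
    case 1
    then have T: "?T = {}" using fT by simp
    have m0: "matching_on M (supp M)"
      using matching_on_supp_diff[OF sgM, of "{}"] le1 T by auto
    obtain a b where ab: "a \<noteq> b" "a \<notin> {}" "b \<notin> {}" "matching_on M (supp M - {a, b})"
      "card (supp M - {a, b}) \<le> card (supp M) - 2"
      "\<And>x y. x \<in> supp M \<Longrightarrow> {x, y} \<in> M \<Longrightarrow> {x, y} = {a, b} \<or> x \<in> supp M - {a, b}"
      by (rule matching_on_pick[OF sgM m0, of "{}"]) (simp add: fs, simp, blast, rule that)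
    \<comment> \<open>A vertex isolated in \<open>M\<close> completes the chosen edge to a closed
      triple.\<close>
    obtain c where c: "c \<notin> supp M \<union> {a, b}"
      using ex_new_if_finite[OF infinite_UNIV_nat, of "supp M \<union> {a, b}"] fs by blast
    have nb0: "nb M c = {}" using c by (auto simp: supp_def)
    have cl: "nb M x \<subseteq> {a, b, c}" if "x \<in> {a, b, c}" for x
    proof
      fix y assume "y \<in> nb M x"
      then have xy: "{x, y} \<in> M" by simp
      have "x \<noteq> c" using nb0 \<open>y \<in> nb M x\<close> by blast
      then show "y \<in> {a, b, c}" using ab(6)[of x y] xy edge_in_supp[OF xy] that by (auto simp: doubleton_eq_iff)
    qed
    show ?thesis
    proof (rule fits_triangle_matching[of a b c])
      show "card (supp M - {a, b, c}) \<le> 5"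
        using ab(5) cd card_mono[of "supp M - {a, b}" "supp M - {a, b, c}"] fs by fastforce
      show "distinct [a, b, c]" using ab c by auto
    qed (use cl le1 T in auto)
  next
    case 2
    then obtain p where T: "?T = {p}" by (auto simp: card_1_singleton_iff)
    then have "p \<in> ?T" by blast
    then obtain a b where ab: "a \<noteq> b" "nb M p = {a, b}" "{a, p} \<in> M" "{b, p} \<in> M" "p \<noteq> a" "p \<noteq> b"
      using two by blast
    have "nb M a = {p}" "nb M b = {p}" using one[of a p] one[of b p] ab T by auto
    then have cl: "\<And>x. x \<in> {p, a, b} \<Longrightarrow> nb M x \<subseteq> {p, a, b}" using ab by auto
    have sub: "{p, a, b} \<subseteq> supp M" using edge_in_supp[OF ab(3)] edge_in_supp[OF ab(4)] by blast
    show ?thesis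
    proof (rule fits_triangle_matching[of p a b])
      show "card (supp M - {p, a, b}) \<le> 5"
        using card_Diff_subset[OF _ sub] cd ab by simp
    qed (use cl ab le1 T in auto)
  next
    case 3
    then obtain p q where T: "?T = {p, q}" "p \<noteq> q" by (auto simp: card_2_iff)
    have "p \<in> ?T" "q \<in> ?T" using T by blast+
    from two[OF this(1)] two[OF this(2)] obtain a b c e where
      p: "a \<noteq> b" "nb M p = {a, b}" "{a, p} \<in> M" "{b, p} \<in> M" "p \<noteq> a" "p \<noteq> b" and
      q: "c \<noteq> e" "nb M q = {c, e}" "{c, q} \<in> M" "{e, q} \<in> M" "q \<noteq> c" "q \<noteq> e" by blast
    show ?thesis
    proof (cases "{p, q} \<in> M")
      case True
      then have "q \<in> nb M p" "p \<in> nb M q" by (simp_all add: insert_commute)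
      have "\<exists>a'. nb M p = {q, a'} \<and> a' \<noteq> q \<and> a' \<noteq> p \<and> {a', p} \<in> M"
        using p \<open>q \<in> nb M p\<close> by auto
      moreover have "\<exists>c'. nb M q = {p, c'} \<and> c' \<noteq> p \<and> c' \<noteq> q \<and> {c', q} \<in> M"
        using q \<open>p \<in> nb M q\<close> by auto
      ultimately obtain a' c' where a': "nb M p = {q, a'}" "a' \<noteq> q" "a' \<noteq> p" "{a', p} \<in> M"
         and c': "nb M q = {p, c'}" "c' \<noteq> p" "c' \<noteq> q" "{c', q} \<in> M" by blast
      have na: "nb M a' = {p}" "nb M c' = {q}" using one[of a' p] one[of c' q] a' c' T by auto
      then have ne: "a' \<noteq> c'" using T by auto
      have sub: "{a', p, q, c'} \<subseteq> supp M" using edge_in_supp[OF a'(4)] edge_in_supp[OF c'(4)] by blast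
      show ?thesis
      proof (rule fits_path_matching[of a' p q c'])
        show "card (supp M - {a', p, q, c'}) \<le> 3"
          using card_Diff_subset[OF _ sub] cd a' c' ne T by simp
        show "{a', q} \<notin> M" "{p, c'} \<notin> M" "{a', c'} \<notin> M"
          unfolding nb_iff[symmetric] using na a' c' ne T by auto
      qed (use na a' c' ne T le1 in auto)
    next
      case False
      have "q \<notin> nb M p" "p \<notin> nb M q" using False by (simp_all add: insert_commute)
      then have nab: "a \<noteq> q" "b \<noteq> q" "c \<noteq> p" "e \<noteq> p" using p(2) q(2) by auto
      have na: "nb M a = {p}" "nb M b = {p}" "nb M c = {q}" "nb M e = {q}"
        using one[OF _ p(3)] one[OF _ p(4)] one[OF _ q(3)] one[OF _ q(4)] nab p(5,6) q(5,6) unfolding T by simp_all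
      \<comment> \<open>A common partner of \<open>p\<close> and \<open>q\<close> would be a third
        vertex of degree 2.\<close>
      have d: "distinct [p, a, b, c, q, e]"
        using na p q T nab by (auto simp del: nb_iff)
      have sub: "{p, a, b, c, q, e} \<subseteq> supp M"
        using edge_in_supp[OF p(3)] edge_in_supp[OF p(4)] edge_in_supp[OF q(3)] edge_in_supp[OF q(4)] by blast
      let ?D = "{p, a, b, c, q, e}"
      have "card ?D = 6" using d by simp
      then have "card (supp M - ?D) \<le> 1" using card_Diff_subset[OF _ sub] cd by simp
      moreover have cl: "\<And>x. x \<in> ?D \<Longrightarrow> nb M x \<subseteq> ?D" using na p q by auto
      moreover have "matching_on M (supp M - ?D)"
        by (rule matching_on_supp_diff[OF sgM cl le1]) (use T in auto)
      ultimately have em: "supp M - ?D = {}" using matching_on_small_empty[OF sgM] fs by blast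
      obtain z where z: "z \<notin> ?D" using ex_new_if_finite[OF infinite_UNIV_nat, of ?D] by blast
      show ?thesis
      proof (rule fitsI[of a p b c q e z])
        show "distinct [a, p, b, c, q, e, z]" using d z by auto
        fix x y assume "{x, y} \<in> co_graph S E"
        then have xy: "{x, y} \<in> M" by (simp add: M_def)
        then have "x \<in> ?D" using em edge_in_supp[OF xy] by blast
        moreover have "y \<in> nb M x" using xy by simp
        ultimately have "x = p \<and> (y = a \<or> y = b) \<or> x = a \<and> y = p \<or> x = b \<and> y = p \<or>
          x = q \<and> (y = c \<or> y = e) \<or> x = c \<and> y = q \<or> x = e \<and> y = q"
          using na p(2) q(2) by (auto simp del: nb_iff)
        then show "{x, y} \<in> tri_path a p b c q e z"
          unfolding tri_path_def by (elim disjE conjE) (simp_all add: doubleton_eq_iff)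
      qed
    qed
  qed
qed

lemma fits_three:
  assumes "card (supp M) \<le> 3"
  shows "fits S E"
proof -
  note fs = finite_supp[OF sgM]
  obtain D where D: "supp M \<subseteq> D" "card D = 3"
  proof -
    obtain D where "supp M \<subseteq> D" "card D = 3" "finite D"
      using assms fs infinite_UNIV_nat
      by (metis infinite_arbitrarily_large finite_subset exists_subset_between subset_UNIV
          finite_Un card_mono sup_ge1 sup_ge2)
    then show ?thesis using that by blast
  qed
  then obtain a b c where abc: "D = {a, b, c}" "distinct [a, b, c]"
    by (auto simp: card_3_iff)
  show ?thesis
  proof (rule fits_triangle_matching[OF abc(2)])
    show "nb M x \<subseteq> {a, b, c}" for x
      using D(1) edge_in_supp[of x _ M] unfolding abc(1) nb_iff[symmetric] by blast
    show "card (nb M x) \<le> 1" if "x \<notin> {a, b, c}" for x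
      using that D(1) unfolding abc(1) supp_def by (metis (mono_tags, lifting) card.empty mem_Collect_eq subsetD zero_le)
    show "card (supp M - {a, b, c}) \<le> 5" using D(1) abc(1) by (simp add: Diff_eq_empty_iff[THEN iffD2])
  qed
qed

end

subsection \<open>Laying off a vertex of maximum degree\<close>

lemma top_set_exists:
  fixes d :: "nat \<Rightarrow> nat"
  assumes "finite V" "k \<le> card V"
  shows "\<exists>S\<subseteq>V. card S = k \<and> (\<forall>s\<in>S. \<forall>w\<in>V - S. d w \<le> d s)"
  using assms(2)
proof (induction k)
  case 0
  then show ?case by (intro exI[of _ "{}"]) simp
next
  case (Suc k)
  then obtain S where S: "S \<subseteq> V" "card S = k" "\<And>s w. s \<in> S \<Longrightarrow> w \<in> V - S \<Longrightarrow> d w \<le> d s"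
    by auto
  have fS: "finite S" using S assms finite_subset by blast
  have "V - S \<noteq> {}" using S Suc.prems by auto
  then have "Max (d ` (V - S)) \<in> d ` (V - S)" using assms(1) by (intro Max_in) auto
  then obtain m where m: "m \<in> V - S" "d m = Max (d ` (V - S))" by auto
  then have mx: "\<And>w. w \<in> V - S \<Longrightarrow> d w \<le> d m" using assms(1) by simp
  show ?case
  proof (intro exI[of _ "insert m S"] conjI ballI)
    show "insert m S \<subseteq> V" using S m by auto
    show "card (insert m S) = Suc k" using m fS S by simp
    show "d w \<le> d s" if "s \<in> insert m S" "w \<in> V - insert m S" for s w
      using that S(3)[of s w] mx by auto
  qed
qed

text \<open>Only \<open>Q\<close> has to be absorbed by the neighbourhood of \<open>v\<close>, whose
  other members stay arbitrary; hence \<open>card Q <= d v\<close> is enough. Each switch brings in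
  one vertex of \<open>Q\<close> at the expense of a neighbour outside \<open>Q\<close>.\<close>

lemma havel_hakimi:
  assumes "realizes V d E" and v: "v \<in> V" and Q: "Q \<subseteq> V - {v}" "card Q \<le> d v"
    and top: "\<And>q w. q \<in> Q \<Longrightarrow> w \<in> V - Q \<Longrightarrow> w \<noteq> v \<Longrightarrow> d w \<le> d q"
  shows "\<exists>E'. realizes V d E' \<and> Q \<subseteq> nb E' v"
  using assms(1)
proof (induction "card (Q - nb E v)" arbitrary: E)
  case 0
  have "finite Q" using Q realizesD(2)[OF 0(2)] finite_subset by blast
  then have "Q \<subseteq> nb E v" using 0(1) by simp
  then show ?case using 0 by blast
next
  case (Suc k)
  note rD = realizesD[OF Suc(3)]
  have fQ: "finite Q" using Q rD(2) finite_subset by blast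
  from Suc(2) obtain q where q: "q \<in> Q" "q \<notin> nb E v"
    by (metis DiffE card.empty equals0I nat.distinct(1))
  have "\<not> nb E v \<subseteq> Q - {q}"
  proof
    assume "nb E v \<subseteq> Q - {q}"
    then have "card (nb E v) \<le> card (Q - {q})" using fQ by (intro card_mono) auto
    moreover have "card (Q - {q}) < card Q" using q fQ by (intro psubset_card_mono) auto
    ultimately show False using rD(3)[OF v] Q by simp
  qed
  then obtain w where w: "w \<in> nb E v" "w \<notin> Q" using q by blast
  have wV: "w \<in> V" "w \<noteq> v" and qV: "q \<in> V" "q \<noteq> v" using w rD(5)[of v] q Q by blast+
  have qw: "q \<noteq> w" using q w by blast
  have dq: "d w \<le> d q" using top[of q w] q w wV by blast
  have vw: "v \<in> nb E w" and vq: "v \<notin> nb E q" using w(1) q(2) by (simp_all add: insert_commute)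
  \<comment> \<open>\<open>v\<close> is a neighbour of \<open>w\<close> but not of \<open>q\<close>.
    If \<open>w\<close> covered all neighbours of \<open>q\<close>, its degree would be larger; an
    edge \<open>qw\<close> counts on both sides.\<close>
  have "\<not> nb E q \<subseteq> insert w (nb E w)"
  proof
    assume sub: "nb E q \<subseteq> insert w (nb E w)"
    show False
    proof (cases "w \<in> nb E q")
      case True
      then have "q \<in> nb E w" by (simp add: insert_commute)
      have "insert v (insert q (nb E q - {w})) \<subseteq> nb E w"
        using sub vw \<open>q \<in> nb E w\<close> by blast
      moreover have "card (insert v (insert q (nb E q - {w}))) = card (nb E q) + 1"
      proof -
        have "q \<notin> nb E q" using rD(5)[of q] by blast
        moreover have "card (nb E q) > 0" using True rD(4) card_gt_0_iff by blast
        ultimately show ?thesis using True vq qV rD(4)[of q] by (simp del: nb_iff)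
      qed
      ultimately have "card (nb E q) + 1 \<le> card (nb E w)" using rD(4) card_mono by metis
      then show False using dq rD(3) wV qV by simp
    next
      case False
      then have "insert v (nb E q) \<subseteq> nb E w" using sub vw by blast
      then have "card (insert v (nb E q)) \<le> card (nb E w)" using rD(4) card_mono by metis
      then show False using vq dq rD(3) wV qV rD(4)[of q] by (simp del: nb_iff)
    qed
  qed
  then obtain z where z: "z \<in> nb E q" "z \<noteq> w" "z \<notin> nb E w" by blast
  define E' where "E' = E - {{v, w}, {q, z}} \<union> {{v, q}, {w, z}}"
  have re': "realizes V d E'"
    unfolding E'_def by (rule realizes_switch[OF Suc(3)]) (use w z q qV in auto)
  have zv: "z \<noteq> v" using z vq by blast
  have "Q - nb E' v = Q - nb E v - {q}"
    unfolding E'_def using w qV wV zv by (auto simp: doubleton_eq_iff)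
  then have "k = card (Q - nb E' v)" using Suc(2) q fQ by simp
  then show ?case using Suc(1)[OF _ re'] by blast
qed

lemma realizes_delete:
  assumes re: "realizes V d E" and v: "v \<in> V"
  shows "realizes (V - {v}) (\<lambda>z. d z - of_bool (z \<in> nb E v)) {e \<in> E. v \<notin> e}"
proof -
  note rD = realizesD[OF re]
  have "simple_graph (V - {v}) {e \<in> E. v \<notin> e}" using rD(1) unfolding simple_graph_iff by blast
  moreover have "degree {e \<in> E. v \<notin> e} z = d z - of_bool (z \<in> nb E v)" if "z \<in> V - {v}" for z
  proof -
    have eq: "nb {e \<in> E. v \<notin> e} z = nb E z - {v}" using that by auto
    show ?thesis unfolding degree_nb eq
      using rD(3)[of z] rD(4)[of z] that by (auto simp: card_Diff_singleton_if insert_commute)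
  qed
  ultimately show ?thesis unfolding realizes_def by blast
qed

text \<open>The converse of \<open>realizes_delete\<close>. Positivity on \<open>N\<close> is needed
  since the subtraction is truncated.\<close>

lemma realizes_add_vertex:
  assumes re: "realizes (V - {v}) (\<lambda>z. d z - of_bool (z \<in> N)) E" and v: "v \<in> V"
    and N: "N \<subseteq> V - {v}" "card N = d v" and pos: "\<And>z. z \<in> N \<Longrightarrow> 0 < d z"
  shows "realizes V d (E \<union> (\<lambda>z. {v, z}) ` N)"
proof -
  note rD = realizesD[OF re]
  have fV: "finite V" using rD(2) by simp
  have 1: "simple_graph V (E \<union> (\<lambda>z. {v, z}) ` N)"
    unfolding simple_graph_iff
  proof (intro conjI ballI fV)
    fix e assume e: "e \<in> E \<union> (\<lambda>z. {v, z}) ` N"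
    have "e \<subseteq> V \<and> card e = 2"
    proof (cases "e \<in> E")
      case True
      then show ?thesis using rD(1) unfolding simple_graph_iff by blast
    next
      case False
      with e obtain z where z: "z \<in> N" "e = {v, z}" by auto
      then have "z \<in> V" "z \<noteq> v" using N by auto
      then show ?thesis using v by (simp add: z)
    qed
    then show "e \<subseteq> V" "card e = 2" by simp_all
  qed
  have "degree (E \<union> (\<lambda>z. {v, z}) ` N) z = d z" if z: "z \<in> V" for z
  proof (cases "z = v")
    case True
    have "nb (E \<union> (\<lambda>z. {v, z}) ` N) v = N"
    proof (rule set_eqI)
      fix y
      have "{v, y} \<notin> E" using simple_graph_edgeD(1)[OF rD(1), of v y] by blast
      then show "y \<in> nb (E \<union> (\<lambda>z. {v, z}) ` N) v \<longleftrightarrow> y \<in> N"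
        using N unfolding nb_iff Un_iff doubleton_in_star by blast
    qed
    then show ?thesis using True N by (simp add: degree_nb)
  next
    case False
    have eq: "nb (E \<union> (\<lambda>z. {v, z}) ` N) z = nb E z \<union> (if z \<in> N then {v} else {})"
      unfolding set_eq_iff nb_iff Un_iff doubleton_in_star using False by auto
    have "v \<notin> nb E z" using rD(5)[of z] by blast
    then show ?thesis unfolding degree_nb eq
      using rD(3)[of z] rD(4)[of z] False z pos[of z] by (simp del: nb_iff)
  qed
  then show ?thesis using 1 unfolding realizes_def by blast
qed

lemma sum_delete:
  assumes re: "realizes V d E" and v: "v \<in> V"
  shows "(\<Sum>z\<in>V - {v}. int (d z - of_bool (z \<in> nb E v))) = (\<Sum>z\<in>V. int (d z)) - 2 * int (d v)"
proof -
  note rD = realizesD[OF re]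
  have pos: "0 < d z" if "z \<in> nb E v" for z
  proof -
    have "v \<in> nb E z" using that by (simp add: insert_commute)
    moreover have "z \<in> V" using that rD(5)[of v] by blast
    ultimately show ?thesis using rD(3)[of z] rD(4)[of z] card_gt_0_iff by force
  qed
  have "(\<Sum>z\<in>V - {v}. int (d z - of_bool (z \<in> nb E v))) = (\<Sum>z\<in>V - {v}. int (d z) - of_bool (z \<in> nb E v))"
    using pos by (intro sum.cong) (auto simp: Suc_leI of_nat_diff simp del: nb_iff)
  also have "\<dots> = (\<Sum>z\<in>V - {v}. int (d z)) - (\<Sum>z\<in>V - {v}. of_bool (z \<in> nb E v))"
    by (rule sum_subtractf)
  also have "(\<Sum>z\<in>V - {v}. of_bool (z \<in> nb E v)) = int (card (nb E v))"
  proof -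
    have "(V - {v}) \<inter> nb E v = nb E v" using rD(5)[of v] by blast
    then show ?thesis using rD(2) by (simp add: sum_of_bool_eq del: nb_iff)
  qed
  also have "(\<Sum>z\<in>V - {v}. int (d z)) = (\<Sum>z\<in>V. int (d z)) - int (d v)"
    using rD(2) v by (simp add: sum_diff1)
  finally show ?thesis using rD(3)[OF v] by simp
qed

lemma realizes_pos:
  assumes "realizes V d E" "{x, y} \<in> E"
  shows "0 < d x"
proof -
  note rD = realizesD[OF assms(1)]
  have "x \<in> V" using simple_graph_edgeD(1)[OF rD(1) assms(2)] .
  moreover have "y \<in> nb E x" using assms(2) by simp
  ultimately show ?thesis using rD(3)[of x] rD(4)[of x] card_gt_0_iff by force
qed

subsection \<open>The base case\<close>

text \<open>Every missing pair lies among the three leaves, hence in the triangle.\<close>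

lemma fits_star:
  assumes "{z, a} \<in> E" "{z, b} \<in> E" "{z, c} \<in> E" "distinct [z, a, b, c]"
  shows "fits {z, a, b, c} E"
proof (rule fits_three)
  let ?M = "co_graph {z, a, b, c} E"
  show "?M = ?M" ..
  have sub: "supp ?M \<subseteq> {a, b, c}"
  proof
    fix x assume "x \<in> supp ?M"
    then obtain y where "{x, y} \<in> ?M" unfolding supp_def by auto
    then show "x \<in> {a, b, c}" using assms by (auto simp: in_co_graph)
  qed
  show "card (supp ?M) \<le> 3" using card_mono[OF _ sub] assms by simp
qed simp

lemma fits_P3:
  assumes "{a, b} \<in> E" "{b, c} \<in> E" "{c, e} \<in> E" "distinct [a, b, c, e]"
  shows "fits {a, b, c, e} E"
proof -
  obtain X where X: "finite X" "card X = 3" "X \<inter> {a, b, c, e} = {}"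
    using infinite_arbitrarily_large[of "UNIV - {a, b, c, e}" 3] by (auto simp: infinite_UNIV_nat)
  then obtain p q s where pqs: "X = {p, q, s}" "distinct [p, q, s]" by (auto simp: card_3_iff)
  show ?thesis
  proof (rule fitsI[of p q s c a e b])
    show "distinct [p, q, s, c, a, e, b]" using assms X pqs by auto
    fix x y assume "{x, y} \<in> co_graph {a, b, c, e} E"
    then have "x \<in> {a, b, c, e}" "y \<in> {a, b, c, e}" "x \<noteq> y" "{x, y} \<notin> E" by (auto simp: in_co_graph)
    moreover have "{b, a} \<in> E" "{c, b} \<in> E" "{e, c} \<in> E" using assms by (simp_all add: insert_commute)
    ultimately show "{x, y} \<in> tri_path p q s c a e b" using assms(1-3) unfolding tri_path_def
      by (auto simp: doubleton_eq_iff)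
  qed
qed

text \<open>The top set is not mentioned: the induction hypothesis may return any \<open>T\<close>,
  and \<open>fits_move_to_top\<close> carries it to the top afterwards.\<close>

definition placeable :: "nat set \<Rightarrow> (nat \<Rightarrow> nat) \<Rightarrow> nat \<Rightarrow> bool" where
  "placeable V d k \<longleftrightarrow> (\<exists>E T. realizes V d E \<and> T \<subseteq> V \<and> card T = k \<and> fits T E)"

lemma placeable_P3:
  assumes "realizes V d E" "{a, b} \<in> E" "{b, c} \<in> E" "{c, e} \<in> E" "distinct [a, b, c, e]"
  shows "placeable V d 4"
proof -
  note sg = realizesD(1)[OF assms(1)]
  have "{a, b, c, e} \<subseteq> V"
    using simple_graph_edgeD[OF sg assms(2)] simple_graph_edgeD[OF sg assms(4)] by blast
  moreover have "card {a, b, c, e} = 4" using assms(5) by simp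
  ultimately show ?thesis unfolding placeable_def using assms(1) fits_P3[OF assms(2-5)] by blast
qed

lemma card_2_other: "card X = 2 \<Longrightarrow> q \<in> X \<Longrightarrow> \<exists>a. X = {q, a} \<and> a \<noteq> q"
  unfolding card_2_iff by (metis insertE insert_commute singletonD)

text \<open>A vertex of degree 3 gives a star. Otherwise the sum forces two vertices of degree 2,
  which lie on a path with three edges after at most one switch.\<close>

lemma placeable_base:
  assumes re: "realizes V d E" and n: "5 \<le> card V" and sum: "card V + 2 \<le> (\<Sum>z\<in>V. d z)"
  shows "placeable V d 4"
proof (cases "\<exists>z\<in>V. 3 \<le> d z")
  case True
  note rD = realizesD[OF re]
  from True obtain z where z: "z \<in> V" "3 \<le> card (nb E z)" using rD(3) by force
  then obtain X where X: "X \<subseteq> nb E z" "card X = 3" using obtain_subset_with_card_n by metis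
  then obtain a b c where abc: "X = {a, b, c}" "distinct [a, b, c]" by (auto simp: card_3_iff)
  then have e: "{z, a} \<in> E" "{z, b} \<in> E" "{z, c} \<in> E" using X by auto
  have d4: "distinct [z, a, b, c]" using abc simple_graph_edgeD(3)[OF rD(1) e(1)]
      simple_graph_edgeD(3)[OF rD(1) e(2)] simple_graph_edgeD(3)[OF rD(1) e(3)] by auto
  have "{z, a, b, c} \<subseteq> V" using X abc rD(5)[of z] z by blast
  moreover have "card {z, a, b, c} = 4" using d4 by simp
  ultimately show ?thesis unfolding placeable_def using re fits_star[OF e d4] by blast
next
  case False
  note rD = realizesD[OF re]
  have le2: "d z \<le> 2" if "z \<in> V" for z using False that by fastforce
  define D where "D = {z \<in> V. d z = 2}"
  have fD: "finite D" unfolding D_def using rD(2) by simp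
  have "(\<Sum>z\<in>V. d z) \<le> (\<Sum>z\<in>V. 1 + of_bool (z \<in> D))"
  proof (rule sum_mono)
    fix z assume "z \<in> V"
    then show "d z \<le> 1 + of_bool (z \<in> D)" using le2[of z] by (auto simp: D_def)
  qed
  also have "\<dots> = card V + card D"
  proof -
    have "V \<inter> D = D" unfolding D_def by blast
    then show ?thesis using rD(2) unfolding sum.distrib by (simp add: sum_of_bool_eq)
  qed
  finally have "2 \<le> card D" using sum by linarith
  then obtain X where X: "X \<subseteq> D" "card X = 2" using obtain_subset_with_card_n by metis
  then obtain p q where pq: "X = {p, q}" "p \<noteq> q" by (auto simp: card_2_iff)
  then have pV: "p \<in> V" "q \<in> V" "card (nb E p) = 2" "card (nb E q) = 2"
    using X rD(3) by (auto simp: D_def)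
  have loop: "x \<notin> nb E x" for x using rD(5)[of x] by blast
  show ?thesis
  proof (cases "q \<in> nb E p")
    case True
    then have qp: "p \<in> nb E q" by (simp add: insert_commute)
    obtain a where a: "nb E p = {q, a}" "a \<noteq> q" using card_2_other[OF pV(3) True] by blast
    obtain b where b: "nb E q = {p, b}" "b \<noteq> p" using card_2_other[OF pV(4) qp] by blast
    have ap: "a \<noteq> p" "b \<noteq> q" using a b loop[of p] loop[of q] by auto
    have ed: "{p, a} \<in> E" "{q, b} \<in> E" "{p, q} \<in> E" unfolding nb_iff[symmetric] a(1) b(1) by simp_all
    show ?thesis
    proof (cases "a = b")
      case False
      show ?thesis
        by (rule placeable_P3[OF re, of a p q b]) (use ed a b ap False pq in \<open>auto simp: insert_commute\<close>)
    next
      case True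
      have aV: "a \<in> V" using a rD(5)[of p] by blast
      have nba: "{p, q} \<subseteq> nb E a" using ed True by (simp add: insert_commute)
      have na: "nb E a = {p, q}"
      proof -
        have "card (nb E a) \<le> 2" using le2[OF aV] rD(3)[OF aV] by simp
        then show ?thesis using nba pq rD(4)[of a] by (metis card_2_iff card_seteq)
      qed
      \<comment> \<open>The triangle \<open>p q a\<close> is a whole component with degree sum 6,
        below \<open>card V + 2\<close>, so there is an edge elsewhere; switching it with
        \<open>pq\<close> opens the triangle into a path.\<close>
      have "\<exists>g\<in>V - {p, q, a}. d g \<noteq> 0"
      proof (rule ccontr)
        assume "\<not> ?thesis"
        then have z: "(\<Sum>z\<in>V - {p, q, a}. d z) = 0" by simp
        have "(\<Sum>z\<in>V. d z) = (\<Sum>z\<in>V - {p, q, a}. d z) + (\<Sum>z\<in>{p, q, a}. d z)"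
          using pV aV rD(2) by (intro sum.subset_diff) auto
        also have "\<dots> \<le> 6" using z pq a ap le2[of p] le2[of q] le2[OF aV] pV by simp
        finally show False using sum n by linarith
      qed
      then obtain g where g: "g \<in> V" "g \<notin> {p, q, a}" "nb E g \<noteq> {}" using rD(3) by force
      then obtain h where h: "h \<in> nb E g" by blast
      have hg: "g \<in> nb E h" using h by (simp add: insert_commute)
      have hn: "h \<notin> {p, q, a}"
      proof
        assume "h \<in> {p, q, a}"
        then have "nb E h \<subseteq> {p, q, a}" using a(1) b(1) na True by (auto simp del: nb_iff)
        then show False using hg g by blast
      qed
      have gh: "{g, h} \<in> E" "g \<noteq> h" using h loop[of g] by auto
      have ng: "g \<notin> nb E p" "h \<notin> nb E q" using a(1) b(1) g hn True by (auto simp del: nb_iff)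
      define E' where "E' = E - {{p, q}, {g, h}} \<union> {{p, g}, {q, h}}"
      have re': "realizes V d E'" unfolding E'_def
        by (rule realizes_switch[OF re]) (use ed gh ng g hn in auto)
      have "{g, p} \<in> E'" "{p, a} \<in> E'" "{a, q} \<in> E'"
        unfolding E'_def using ed True g hn ap a by (auto simp: doubleton_eq_iff insert_commute)
      then show ?thesis
        by (rule placeable_P3[OF re']) (use g ap a pq in auto)
    qed
  next
    case False
    then have qp: "p \<notin> nb E q" by (simp add: insert_commute)
    show ?thesis
    proof (cases "nb E p \<inter> nb E q = {}")
      case False
      then obtain c where c: "c \<in> nb E p" "c \<in> nb E q" by blast
      then obtain x where x: "nb E p = {c, x}" "x \<noteq> c" using card_2_other[OF pV(3)] by blast
      have "{x, p} \<in> E" using x by (metis insertCI insert_commute nb_iff)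
      moreover have "{p, c} \<in> E" "{c, q} \<in> E" using c by (simp_all add: insert_commute)
      moreover have "distinct [x, p, c, q]"
        using x c pq loop[of p] loop[of q] \<open>q \<notin> nb E p\<close> by (auto simp del: nb_iff)
      ultimately show ?thesis by (rule placeable_P3[OF re])
    next
      case True
      obtain a b where ab: "nb E p = {a, b}" "a \<noteq> b" using pV(3) by (auto simp: card_2_iff)
      obtain c e where ce: "nb E q = {c, e}" "c \<noteq> e" using pV(4) by (auto simp: card_2_iff)
      have ne: "a \<noteq> c" "b \<noteq> e" "a \<noteq> e" "b \<noteq> c" using True ab ce by auto
      have ne2: "a \<noteq> p" "b \<noteq> p" "c \<noteq> q" "e \<noteq> q" "a \<noteq> q" "b \<noteq> q" "c \<noteq> p" "e \<noteq> p"
        using loop[of p] loop[of q] ab ce \<open>q \<notin> nb E p\<close> qp by (auto simp del: nb_iff)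
      have ed: "{p, a} \<in> E" "{p, b} \<in> E" "{q, c} \<in> E" "{q, e} \<in> E"
        unfolding nb_iff[symmetric] ab(1) ce(1) by simp_all
      show ?thesis
      proof (cases "{a, c} \<in> E")
        case True
        show ?thesis
          by (rule placeable_P3[OF re, of p a c q]) (use ed True ne ne2 pq in \<open>auto simp: insert_commute\<close>)
      next
        case False
        \<comment> \<open>The switch joins the disjoint paths \<open>a p b\<close> and
          \<open>c q e\<close> to the path \<open>b p q e\<close>.\<close>
        define E' where "E' = E - {{p, a}, {q, c}} \<union> {{p, q}, {a, c}}"
        have re': "realizes V d E'" unfolding E'_def
          by (rule realizes_switch[OF re]) (use ed False \<open>q \<notin> nb E p\<close> pq ne in auto)
        have "{b, p} \<in> E'" "{p, q} \<in> E'" "{q, e} \<in> E'"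
          unfolding E'_def using ed ne ne2 ab ce pq by (auto simp: doubleton_eq_iff insert_commute)
        then show ?thesis
          by (rule placeable_P3[OF re']) (use ne ne2 pq in auto)
      qed
    qed
  qed
qed

subsection \<open>Missing pairs in a realization with many edges inside the top set\<close>

locale missing_pair =
  fixes V S :: "nat set" and d :: "nat \<Rightarrow> nat" and E :: "nat set set" and u v :: nat
  assumes re: "realizes V d E" and SV: "S \<subseteq> V"
    and maxE: "\<And>E'. realizes V d E' \<Longrightarrow> inner_edges S E' \<le> inner_edges S E"
    and uS: "u \<in> S" and vS: "v \<in> S" and uv: "u \<noteq> v" and nuv: "{u, v} \<notin> E"
begin

lemmas rD = realizesD[OF re]

text \<open>The form in which maximality is used: an exchange that inserts \<open>uv\<close> and
  otherwise touches only pairs leaving \<open>S\<close> would add one inner edge.\<close>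

lemma no_gain:
  assumes "realizes V d (E - R \<union> insert {u, v} A)" "\<And>e. e \<in> R \<Longrightarrow> \<not> e \<subseteq> S" "\<And>e. e \<in> A \<Longrightarrow> \<not> e \<subseteq> S"
  shows False
proof -
  have "{e \<in> E - R \<union> insert {u, v} A. e \<subseteq> S} = insert {u, v} {e \<in> E. e \<subseteq> S}"
    using assms(2,3) uS vS by blast
  moreover have "finite {e \<in> E. e \<subseteq> S}" using simple_graph_finite[OF rD(1)] by simp
  moreover have "{u, v} \<notin> {e \<in> E. e \<subseteq> S}" using nuv by simp
  ultimately have "inner_edges S (E - R \<union> insert {u, v} A) = Suc (inner_edges S E)"
    unfolding inner_edges_def by simp
  then show False using maxE[OF assms(1)] by simp
qed

lemma outer_adjacent:
  assumes x: "x \<in> nb E u - S" and y: "y \<in> nb E v - S" and ne: "x \<noteq> y"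
  shows "{x, y} \<in> E"
proof (rule ccontr)
  assume "{x, y} \<notin> E"
  then have "realizes V d (E - {{u, x}, {v, y}} \<union> {{u, v}, {x, y}})"
    using realizes_switch[OF re, of u x v y] x y ne uv nuv by simp
  then show False by (rule no_gain) (use x y in auto)
qed

text \<open>If \<open>p\<close> in \<open>nb E w\<close> were neither \<open>y\<close> nor a
  neighbour of \<open>y\<close>, exchanging \<open>ux\<close>, \<open>vy\<close>, \<open>wp\<close>
  for \<open>uv\<close>, \<open>xw\<close>, \<open>yp\<close> would gain the inner edge
  \<open>uv\<close>. The inequality is strict because \<open>v\<close> is adjacent to
  \<open>y\<close> but not to \<open>w\<close>: otherwise \<open>w\<close> would be an outer
  neighbour of \<open>v\<close> and hence joined to \<open>x\<close>.\<close>

lemma far_neighbours: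
  assumes x: "x \<in> nb E u - S" and y: "y \<in> nb E v - S"
    and w: "w \<in> V - S" "w \<noteq> x" "{x, w} \<notin> E"
  shows "nb E w \<subseteq> insert y (nb E y)" and "d w < d y"
proof -
  have wy: "w \<noteq> y" using outer_adjacent[OF x y] w by auto
  have wv: "v \<notin> nb E w"
  proof
    assume "v \<in> nb E w"
    then have "w \<in> nb E v - S" using w by (simp add: insert_commute)
    then show False using outer_adjacent[OF x] w by auto
  qed
  show sub: "nb E w \<subseteq> insert y (nb E y)"
  proof
    fix p assume p: "p \<in> nb E w"
    show "p \<in> insert y (nb E y)"
    proof (rule ccontr)
      assume np: "p \<notin> insert y (nb E y)"
      have "realizes V d (E - {{u, x}, {v, y}, {w, p}} \<union> {{u, v}, {x, w}, {y, p}})"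
        by (rule realizes_switch3[OF re]) (use x y w p np uv nuv wy uS vS in auto)
      then show False by (rule no_gain) (use x y w in auto)
    qed
  qed
  have yV: "y \<in> V" using y rD(5)[of v] by blast
  have vy: "v \<in> nb E y" using y by (simp add: insert_commute)
  have "card (nb E w) < card (nb E y)"
  proof (cases "y \<in> nb E w")
    case True
    then have "w \<in> nb E y" by (simp add: insert_commute)
    then have "insert v (insert w (nb E w - {y})) \<subseteq> nb E y" using sub vy by blast
    then have "card (insert v (insert w (nb E w - {y}))) \<le> card (nb E y)" using rD(4) card_mono by metis
    moreover have "card (insert v (insert w (nb E w - {y}))) = card (nb E w) + 1"
    proof -
      have "w \<notin> nb E w" using rD(5)[of w] by blast
      moreover have "w \<noteq> v" using w vS by blast
      moreover have "card (nb E w) > 0" using True rD(4)[of w] card_gt_0_iff by blast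
      ultimately show ?thesis using True wv rD(4)[of w] by (simp del: nb_iff)
    qed
    ultimately show ?thesis by simp
  next
    case False
    then have "insert v (nb E w) \<subseteq> nb E y" using sub vy by blast
    then have "card (insert v (nb E w)) \<le> card (nb E y)" using rD(4) card_mono by metis
    then show ?thesis using wv rD(4)[of w] by (simp del: nb_iff)
  qed
  then show "d w < d y" using rD(3)[OF yV] rD(3)[of w] w by simp
qed

lemma swapped: "missing_pair V S d E v u"
  using re SV maxE uS vS uv nuv by unfold_locales (auto simp: insert_commute)

text \<open>Non-adjacent pairs \<open>x, x'\<close> on one side and \<open>y, y'\<close> on the
  other would give both \<open>d x' < d y'\<close> and \<open>d y' < d x'\<close> by
  \<open>far_neighbours\<close>.\<close>

lemma outer_clique:
  "(\<forall>x\<in>nb E u - S. \<forall>x'\<in>nb E u - S. x \<noteq> x' \<longrightarrow> {x, x'} \<in> E) \<or>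
   (\<forall>y\<in>nb E v - S. \<forall>y'\<in>nb E v - S. y \<noteq> y' \<longrightarrow> {y, y'} \<in> E)"
proof (rule ccontr)
  assume "\<not> ?thesis"
  then obtain x x' y y' where x: "x \<in> nb E u - S" "x' \<in> nb E u - S" "x \<noteq> x'" "{x, x'} \<notin> E"
    and y: "y \<in> nb E v - S" "y' \<in> nb E v - S" "y \<noteq> y'" "{y, y'} \<notin> E" by blast
  have V: "x' \<in> V - S" "y' \<in> V - S" using x y rD(5)[of u] rD(5)[of v] by blast+
  have "d x' < d y'" using far_neighbours(2)[OF x(1) y(2) V(1)] x by auto
  moreover have "d y' < d x'"
    using missing_pair.far_neighbours(2)[OF swapped y(1) x(2) V(2)] y by auto
  ultimately show False by simp
qed

lemma card_outer:
  assumes "card S = r + 1"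
  shows "d u \<le> card (nb E u - S) + (r - 1)"
proof -
  have fS: "finite S" using SV rD(2) finite_subset by blast
  have "nb E u \<inter> S \<subseteq> S - {u, v}" using nuv rD(5)[of u] by auto
  then have "card (nb E u \<inter> S) \<le> card (S - {u, v})" using fS by (intro card_mono) auto
  also have "\<dots> = r - 1" using fS uS vS uv assms by (simp add: card_Diff_subset)
  finally have "card (nb E u \<inter> S) \<le> r - 1" .
  moreover have "card (nb E u) = card (nb E u \<inter> S) + card (nb E u - S)"
    using rD(4)[of u] by (metis card_Int_Diff)
  ultimately show ?thesis using rD(3)[of u] uS SV by auto
qed

text \<open>At most \<open>r - 1\<close> neighbours of \<open>u\<close> lie in \<open>S\<close>, as
  \<open>u\<close> and \<open>v\<close> are excluded. So at least \<open>r\<close> lie outside, and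
  \<open>r\<close> of them form a complete graph with \<open>u\<close>.\<close>

lemma placeable_if_clique:
  assumes cl: "\<forall>x\<in>nb E u - S. \<forall>x'\<in>nb E u - S. x \<noteq> x' \<longrightarrow> {x, x'} \<in> E"
    and S: "card S = r + 1" and du: "2 * r - 1 \<le> d u" and r: "1 \<le> r"
  shows "placeable V d (r + 1)"
proof -
  have "r \<le> card (nb E u - S)" using card_outer[OF S] du r by simp
  then obtain X where X: "X \<subseteq> nb E u - S" "card X = r" using obtain_subset_with_card_n by metis
  have fX: "finite X" using X rD(4)[of u] finite_subset by blast
  have uX: "u \<notin> X" using X uS by blast
  have "fits (insert u X) E" unfolding fits_def
  proof (intro exI[of _ id] conjI ballI impI)
    fix x y assume "x \<in> insert u X" "y \<in> insert u X" "x \<noteq> y" "{x, y} \<notin> E"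
    then have False using X cl by (auto simp: insert_commute)
    then show "{id x, id y} \<in> snd K3_union_P3" ..
  qed simp
  moreover have "insert u X \<subseteq> V" using X rD(5)[of u] uS SV by blast
  moreover have "card (insert u X) = r + 1" using X fX uX by simp
  ultimately show ?thesis unfolding placeable_def using re by blast
qed

text \<open>The vertices outside \<open>S\<close> that are not joined to all of the private neighbours of \<open>u\<close> (or of \<open>v\<close>)
  send edges only to the small set \<open>CA \<inter> CB\<close>; this bounds the degree sum.\<close>

lemma degree_sum_bound:
  fixes r dm e :: int
  assumes S: "int (card S) = r + 1"
    and ne: "nb E u - S \<noteq> {}" "nb E v - S \<noteq> {}"
    and dS: "\<And>s. s \<in> S \<Longrightarrow> dm \<le> int (d s)" and dO: "\<And>w. w \<in> V - S \<Longrightarrow> int (d w) \<le> dm"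
    and dD: "\<And>z. z \<in> V \<Longrightarrow> int (d z) \<le> dm + e"
    and W: "dm + e + 1 - r \<le> int (card {w \<in> V - S. int (d w) = dm})"
    and r: "1 \<le> r" "1 \<le> dm"
  shows "\<exists>co cs. 0 \<le> co \<and> 0 \<le> cs \<and> dm + e + 1 - r \<le> co \<and> co + cs \<le> dm + 1 \<and> dm + e + 1 - r \<le> dm \<and>
    (\<Sum>z\<in>V. int (d z)) \<le> (r + 1) * (dm + e) + (dm + r - 1) * co + (e + r - 1) * cs
      + 2 * (dm - 1) * (dm + 1 - co - cs)"
proof -
  \<comment> \<open>\<open>CA\<close> and \<open>CB\<close> are the common closed neighbourhoods of
    \<open>A\<close> and \<open>B\<close>. The sum is split over \<open>S\<close>,
    \<open>C - S\<close>, \<open>L\<close> and \<open>Z\<close>; the witnesses \<open>co\<close> and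
    \<open>cs\<close> count \<open>C\<close> outside and inside \<open>S\<close>.\<close>
  define A where "A = nb E u - S"
  define B where "B = nb E v - S"
  define CA where "CA = {w \<in> V. \<forall>x\<in>A. w = x \<or> {x, w} \<in> E}"
  define CB where "CB = {w \<in> V. \<forall>y\<in>B. w = y \<or> {y, w} \<in> E}"
  define C where "C = CA \<inter> CB"
  define L where "L = (CA \<union> CB) - C - S"
  define Z where "Z = V - S - CA - CB"
  define W where "W = {w \<in> V - S. int (d w) = dm}"
  interpret sw: missing_pair V S d E v u by (rule swapped)
  have fV: "finite V" using rD(2) .
  have fS: "finite S" using SV fV finite_subset by blast
  have AV: "A \<subseteq> V - S" and BV: "B \<subseteq> V - S" using rD(5)[of u] rD(5)[of v] unfolding A_def B_def by blast+
  have AB: "A \<subseteq> CB" "B \<subseteq> CA"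
  proof -
    have adj: "a = b \<or> {a, b} \<in> E" if "a \<in> A" "b \<in> B" for a b
      using outer_adjacent[of a b] that unfolding A_def B_def by blast
    show "A \<subseteq> CB"
    proof
      fix a assume a: "a \<in> A"
      have "a = b \<or> {b, a} \<in> E" if "b \<in> B" for b using adj[OF a that] by (simp add: insert_commute)
      then show "a \<in> CB" using a AV unfolding CB_def by blast
    qed
    show "B \<subseteq> CA"
    proof
      fix b assume b: "b \<in> B"
      have "b = a \<or> {a, b} \<in> E" if "a \<in> A" for a using adj[OF that b] by auto
      then show "b \<in> CA" using b BV unfolding CA_def by blast
    qed
  qed
  \<comment> \<open>Some \<open>x\<close> in \<open>A\<close> is not joined to \<open>w\<close>, so
    by \<open>far_neighbours\<close> every neighbour of \<open>w\<close> lies in the closed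
    neighbourhood of each \<open>y\<close> in \<open>B\<close>, and \<open>d w\<close> is below an
    outer degree.\<close>
  have nCA: "nb E w \<subseteq> CB" "int (d w) < dm" if w: "w \<in> V - S" "w \<notin> CA" for w
  proof -
    obtain x where x: "x \<in> nb E u - S" "w \<noteq> x" "{x, w} \<notin> E" using w unfolding CA_def A_def by blast
    have "p \<in> CB" if p: "p \<in> nb E w" for p
    proof -
      have "p \<in> V" using p rD(5)[of w] by blast
      moreover have "p = y \<or> {y, p} \<in> E" if "y \<in> B" for y
        using far_neighbours(1)[OF x(1), of y w] that w x p unfolding B_def by auto
      ultimately show ?thesis unfolding CB_def by blast
    qed
    then show "nb E w \<subseteq> CB" by blast
    obtain y where y: "y \<in> nb E v - S" using ne by blast
    have "y \<in> V - S" using y BV unfolding B_def by blast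
    then show "int (d w) < dm" using far_neighbours(2)[OF x(1) y w(1) x(2,3)] dO[of y] by linarith
  qed
  have nCB: "nb E w \<subseteq> CA" "int (d w) < dm" if w: "w \<in> V - S" "w \<notin> CB" for w
  proof -
    obtain x where x: "x \<in> nb E v - S" "w \<noteq> x" "{x, w} \<notin> E" using w unfolding CB_def B_def by blast
    have "p \<in> CA" if p: "p \<in> nb E w" for p
    proof -
      have "p \<in> V" using p rD(5)[of w] by blast
      moreover have "p = y \<or> {y, p} \<in> E" if "y \<in> A" for y
        using sw.far_neighbours(1)[OF x(1), of y w] that w x p unfolding A_def by auto
      ultimately show ?thesis unfolding CA_def by blast
    qed
    then show "nb E w \<subseteq> CA" by blast
    obtain y where y: "y \<in> nb E u - S" using ne by blast
    have "y \<in> V - S" using y AV unfolding A_def by blast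
    then show "int (d w) < dm" using sw.far_neighbours(2)[OF x(1) y w(1) x(2,3)] dO[of y] by linarith
  qed
  have WC: "W \<subseteq> C - S"
  proof
    fix w assume "w \<in> W"
    then have w: "w \<in> V - S" "int (d w) = dm" unfolding W_def by auto
    then show "w \<in> C - S" using nCA(2)[of w] nCB(2)[of w] unfolding C_def by auto
  qed
  have fC: "finite CA" "finite CB" "finite C" "finite L" "finite Z" "finite A"
    using fV AV finite_subset[of A V] unfolding CA_def CB_def C_def L_def Z_def by auto
  have cCA: "int (card CA) \<le> dm + 1"
  proof -
    obtain x where x: "x \<in> A" using ne unfolding A_def by blast
    have "CA \<subseteq> insert x (nb E x)" using x unfolding CA_def by auto
    then have "card CA \<le> card (insert x (nb E x))" using rD(4) by (intro card_mono) auto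
    also have "\<dots> \<le> card (nb E x) + 1" using card_insert_le_m1[of "card (nb E x) + 1" "nb E x" x] by simp
    also have "card (nb E x) = d x" using rD(3)[of x] x AV by blast
    finally show ?thesis using dO[of x] x AV by force
  qed
  have cCB: "int (card CB) \<le> dm + 1"
  proof -
    obtain x where x: "x \<in> B" using ne unfolding B_def by blast
    have "CB \<subseteq> insert x (nb E x)" using x unfolding CB_def by auto
    then have "card CB \<le> card (insert x (nb E x))" using rD(4) by (intro card_mono) auto
    also have "\<dots> \<le> card (nb E x) + 1" using card_insert_le_m1[of "card (nb E x) + 1" "nb E x" x] by simp
    also have "card (nb E x) = d x" using rD(3)[of x] x BV by blast
    finally show ?thesis using dO[of x] x BV by force
  qed
  have uV: "u \<in> V" using uS SV by blast
  have uCA: "u \<in> CA" unfolding CA_def A_def using uV by (auto simp: insert_commute)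
  \<comment> \<open>\<open>u\<close> is in \<open>CA\<close> but not in \<open>W\<close>. Saving
    this one vertex turns the lower bound on \<open>card W\<close> into
    \<open>e <= r - 1\<close>.\<close>
  have Wdm: "int (card W) \<le> dm"
  proof -
    have "W \<subseteq> CA - {u}" using WC uS unfolding C_def by blast
    then have "card W \<le> card (CA - {u})" using fC by (intro card_mono) auto
    also have "\<dots> = card CA - 1" using uCA fC by simp
    finally show ?thesis using cCA r by linarith
  qed
  define co where "co = int (card (C - S))"
  define cs where "cs = int (card (C \<inter> S))"
  have cc: "int (card C) = co + cs"
    unfolding co_def cs_def using fC(3) card_Int_Diff[of C S] by linarith
  have coW: "dm + e + 1 - r \<le> co"
  proof -
    have "card W \<le> card (C - S)" using WC fC by (intro card_mono) auto
    then show ?thesis using W unfolding co_def W_def by linarith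
  qed
  have ccle: "co + cs \<le> dm + 1"
  proof -
    have "card C \<le> card CA" using fC unfolding C_def by (intro card_mono) auto
    then show ?thesis using cc cCA by linarith
  qed
  have aA: "dm - r + 1 \<le> int (card A)"
  proof -
    have "card S = nat r + 1" using S r by linarith
    from card_outer[OF this] show ?thesis using dS[OF uS] r unfolding A_def by linarith
  qed
  \<comment> \<open>\<open>A\<close> lies in \<open>CB\<close> and so avoids \<open>Z\<close>, and
    \<open>c\<close> is joined to all of \<open>A\<close>. If \<open>c\<close> itself belongs to
    \<open>A\<close>, the vertex \<open>u\<close> makes up for it.\<close>
  have cZ: "int (card (nb E c \<inter> Z)) \<le> int (d c) - (dm - r + 1)" if c: "c \<in> C" for c
  proof -
    have cV: "c \<in> V" using c unfolding C_def CA_def by blast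
    have cA: "x \<in> nb E c" if "x \<in> A" "x \<noteq> c" for x
      using c that unfolding C_def CA_def by (auto simp: insert_commute)
    have "\<exists>Y\<subseteq>nb E c - Z. card Y = card A"
    proof (cases "c \<in> A")
      case True
      then have uc: "u \<in> nb E c" unfolding A_def by (simp add: insert_commute)
      have "insert u (A - {c}) \<subseteq> nb E c - Z" using uc cA uS AB unfolding Z_def by auto
      moreover have "card (insert u (A - {c})) = card A"
      proof -
        have "u \<notin> A" using uS AV by blast
        moreover have "card A > 0" using True fC card_gt_0_iff by blast
        ultimately show ?thesis using True fC by simp
      qed
      ultimately show ?thesis by blast
    next
      case False
      have "x \<in> nb E c - Z" if x: "x \<in> A" for x
        using cA[OF x] False x AB unfolding Z_def by blast
      then have "A \<subseteq> nb E c - Z" by blast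
      then show ?thesis by blast
    qed
    then obtain Y where "Y \<subseteq> nb E c - Z" "card Y = card A" by blast
    then have "card A \<le> card (nb E c - Z)" using rD(4)[of c] by (metis card_mono finite_Diff)
    moreover have "card (nb E c) = card (nb E c \<inter> Z) + card (nb E c - Z)"
      using rD(4)[of c] by (rule card_Int_Diff)
    ultimately show ?thesis using rD(3)[OF cV] aA by linarith
  qed
  \<comment> \<open>Vertices of \<open>Z\<close> fall under both \<open>nCA\<close> and
    \<open>nCB\<close>, so all their edges end in \<open>C\<close> and can be counted from
    there.\<close>
  have sumZ: "(\<Sum>z\<in>Z. int (d z)) \<le> (r - 1) * co + (e + r - 1) * cs"
  proof -
    have nbZ: "nb E z \<inter> C = nb E z" if "z \<in> Z" for z
      using nCA(1)[of z] nCB(1)[of z] that unfolding Z_def C_def by blast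
    have "(\<Sum>z\<in>Z. d z) = (\<Sum>z\<in>Z. card (nb E z \<inter> C))"
    proof (rule sum.cong[OF refl])
      fix z assume z: "z \<in> Z"
      then have "z \<in> V" unfolding Z_def by blast
      then show "d z = card (nb E z \<inter> C)" using nbZ[OF z] rD(3)[of z] by simp
    qed
    also have "\<dots> = (\<Sum>c\<in>C. card (nb E c \<inter> Z))" by (rule sum_card_nb_swap[OF fC(5,3)])
    finally have "(\<Sum>z\<in>Z. d z) = (\<Sum>c\<in>C. card (nb E c \<inter> Z))" .
    then have "(\<Sum>z\<in>Z. int (d z)) = (\<Sum>c\<in>C. int (card (nb E c \<inter> Z)))"
      unfolding of_nat_sum[symmetric] by simp
    also have "\<dots> = (\<Sum>c\<in>C - S. int (card (nb E c \<inter> Z))) + (\<Sum>c\<in>C \<inter> S. int (card (nb E c \<inter> Z)))"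
      using sum.Int_Diff[OF fC(3), of _ S] by (simp add: add.commute)
    also have "(\<Sum>c\<in>C - S. int (card (nb E c \<inter> Z))) \<le> (\<Sum>c\<in>C - S. r - 1)"
    proof (rule sum_mono)
      fix c assume c: "c \<in> C - S"
      then have "c \<in> V - S" unfolding C_def CA_def by blast
      then show "int (card (nb E c \<inter> Z)) \<le> r - 1" using cZ[of c] c dO[of c] by force
    qed
    also have "(\<Sum>c\<in>C \<inter> S. int (card (nb E c \<inter> Z))) \<le> (\<Sum>c\<in>C \<inter> S. e + r - 1)"
    proof (rule sum_mono)
      fix c assume c: "c \<in> C \<inter> S"
      then have "c \<in> V" unfolding C_def CA_def by blast
      then show "int (card (nb E c \<inter> Z)) \<le> e + r - 1" using cZ[of c] c dD[of c] by force
    qed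
    finally show ?thesis unfolding co_def cs_def by (simp add: mult.commute)
  qed
  have sumS: "(\<Sum>z\<in>S. int (d z)) \<le> (r + 1) * (dm + e)"
  proof -
    have "(\<Sum>z\<in>S. int (d z)) \<le> (\<Sum>z\<in>S. dm + e)" using dD SV by (intro sum_mono) auto
    then show ?thesis using S by simp
  qed
  have sumC: "(\<Sum>z\<in>C - S. int (d z)) \<le> dm * co"
  proof -
    have "(\<Sum>z\<in>C - S. int (d z)) \<le> (\<Sum>z\<in>C - S. dm)"
      using dO unfolding C_def CA_def by (intro sum_mono) auto
    then show ?thesis unfolding co_def by (simp add: mult.commute)
  qed
  have sumL: "(\<Sum>z\<in>L. int (d z)) \<le> (dm - 1) * (2 * (dm + 1 - co - cs))"
  proof -
    have "int (d z) \<le> dm - 1" if "z \<in> L" for z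
    proof -
      have "z \<in> V - S" using that unfolding L_def CA_def CB_def by blast
      moreover have "z \<notin> CA \<or> z \<notin> CB" using that unfolding L_def C_def by blast
      ultimately show ?thesis using nCA(2)[of z] nCB(2)[of z] by force
    qed
    then have "(\<Sum>z\<in>L. int (d z)) \<le> (\<Sum>z\<in>L. dm - 1)" by (intro sum_mono) auto
    also have "\<dots> = (dm - 1) * int (card L)" by simp
    also have "\<dots> \<le> (dm - 1) * (2 * (dm + 1 - co - cs))"
    proof (rule mult_left_mono)
      have "L \<subseteq> (CA - C) \<union> (CB - C)" unfolding L_def by blast
      then have "card L \<le> card ((CA - C) \<union> (CB - C))" using fC by (intro card_mono) auto
      also have "\<dots> \<le> card (CA - C) + card (CB - C)" by (rule card_Un_le)
      finally have "card L \<le> card (CA - C) + card (CB - C)" .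
      then have "int (card L) \<le> int (card (CA - C)) + int (card (CB - C))" by linarith
      moreover have "int (card (CA - C)) = int (card CA) - int (card C)"
        "int (card (CB - C)) = int (card CB) - int (card C)"
      proof -
        have "C \<subseteq> CA" "C \<subseteq> CB" unfolding C_def by blast+
        then show "int (card (CA - C)) = int (card CA) - int (card C)"
          "int (card (CB - C)) = int (card CB) - int (card C)"
          using fC by (simp_all add: card_Diff_subset card_mono of_nat_diff)
      qed
      ultimately have "int (card L) \<le> (int (card CA) - (co + cs)) + (int (card CB) - (co + cs))"
        unfolding cc by simp
      then show "int (card L) \<le> 2 * (dm + 1 - co - cs)" using cCA cCB by (simp add: algebra_simps)
      show "0 \<le> dm - 1" using r by simp
    qed
    finally show ?thesis .
  qed
  have "V = S \<union> (C - S) \<union> L \<union> Z" using SV unfolding L_def Z_def C_def CA_def CB_def by blast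
  moreover have "S \<inter> (C - S) = {}" "(S \<union> (C - S)) \<inter> L = {}" "(S \<union> (C - S) \<union> L) \<inter> Z = {}"
    unfolding L_def Z_def C_def by blast+
  ultimately have "(\<Sum>z\<in>V. int (d z)) = (\<Sum>z\<in>S. int (d z)) + (\<Sum>z\<in>C - S. int (d z)) + (\<Sum>z\<in>L. int (d z)) + (\<Sum>z\<in>Z. int (d z))"
    using fC fS by (simp add: sum.union_disjoint del: Un_Diff_cancel Un_Diff_cancel2)
  also have "\<dots> \<le> (r + 1) * (dm + e) + (dm + r - 1) * co + (e + r - 1) * cs + 2 * (dm - 1) * (dm + 1 - co - cs)"
    using sumS sumC sumL sumZ by (simp add: algebra_simps)
  finally have "(\<Sum>z\<in>V. int (d z)) \<le> (r + 1) * (dm + e) + (dm + r - 1) * co + (e + r - 1) * cs + 2 * (dm - 1) * (dm + 1 - co - cs)" .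
  moreover have "0 \<le> co" "0 \<le> cs" unfolding co_def cs_def by simp_all
  moreover have "dm + e + 1 - r \<le> dm" using W Wdm unfolding W_def by linarith
  ultimately show ?thesis using coW ccle by blast
qed

end

text \<open>Here \<open>dm\<close> is the least degree in the top set, \<open>dm + e\<close> the
  largest degree and \<open>s\<close> the degree sum. The coefficient 5 in \<open>5 * r + 18\<close>
  makes the quadratic terms of the two bounds on \<open>s\<close> agree in the worst case, so that
  the linear terms decide.\<close>

lemma flat_count_absurd:
  fixes r n dm e co cs s :: int
  assumes r: "4 \<le> r" and n: "5 * r + 18 \<le> n" and dm: "r - 2 \<le> dm" "dm \<le> 2 * r - 2" and e: "0 \<le> e"
    and s: "2 * n * r - 5 * n - r * r + 4 * r - 1 \<le> s"
    and c: "0 \<le> co" "0 \<le> cs" "dm + e + 1 - r \<le> co" "co + cs \<le> dm + 1" "dm + e + 1 - r \<le> dm"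
    and ub: "s \<le> (r + 1) * (dm + e) + (dm + r - 1) * co + (e + r - 1) * cs
      + 2 * (dm - 1) * (dm + 1 - co - cs)"
  shows False
proof -
  have "(2 * r - 5) * (5 * r + 18) \<le> (2 * r - 5) * n" using r n by (intro mult_left_mono) auto
  then have lb: "9 * (r * r) + 15 * r - 91 \<le> s" using s by (simp add: algebra_simps)
  have er: "e \<le> r - 1" using c by simp
  have r2: "4 * r \<le> r * r" using r by (intro mult_right_mono) auto
  have ub': "s \<le> (r + 1) * (dm + e) + (r + 1 - dm) * co + (e + r + 1 - 2 * dm) * cs + 2 * (dm - 1) * (dm + 1)"
    using ub by (simp add: algebra_simps)
  show False
  \<comment> \<open>The coefficient of \<open>co\<close> is \<open>r + 1 - dm\<close>; its sign
    tells which bound on \<open>co\<close> is the worst case.\<close>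
  proof (cases "r + 1 \<le> dm")
    case True
    have "(r + 1 - dm) * co \<le> (r + 1 - dm) * (dm + e + 1 - r)"
      using True c by (intro mult_left_mono_neg) auto
    moreover have "(e + r + 1 - 2 * dm) * cs \<le> 0"
      using True er c by (intro mult_nonpos_nonneg) auto
    ultimately have u1: "s \<le> (r + 1) * (dm + e) + (r + 1 - dm) * (dm + e + 1 - r) + 2 * (dm - 1) * (dm + 1)"
      using ub' by linarith
    \<comment> \<open>\<open>t\<close> and \<open>f\<close> measure the distance from the worst
      point \<open>dm = 2 * r - 2\<close>, \<open>e = r - 1\<close>, where the estimate is
      \<open>9 * (r * r) - 8 * r - 3\<close>.\<close>
    define t where "t = 2 * r - 2 - dm"
    define f where "f = r - 1 - e"
    have tf: "0 \<le> t" "0 \<le> f" "t \<le> r - 3" "f \<le> r - 1" using dm er e True unfolding t_def f_def by auto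
    have dmt: "dm = 2 * r - 2 - t" "e = r - 1 - f" unfolding t_def f_def by auto
    have "(r + 1) * (dm + e) + (r + 1 - dm) * (dm + e + 1 - r) + 2 * (dm - 1) * (dm + 1)
       = 9 * (r * r) - 8 * r - 3 - 4 * f + t * t - t * (6 * r - 2) - t * f"
      unfolding dmt by (simp add: algebra_simps)
    moreover have "t * t \<le> t * (6 * r - 2)" using tf r by (intro mult_left_mono) auto
    moreover have "0 \<le> t * f" using tf by simp
    ultimately have "s \<le> 9 * (r * r) - 8 * r - 3" using u1 tf by linarith
    then show False using lb r by linarith
  next
    case False
    \<comment> \<open>Now \<open>co\<close> is as large as possible, which leaves \<open>cs\<close>
      with the coefficient \<open>e - dm\<close>, at most 1.\<close>
    have "(r + 1 - dm) * co \<le> (r + 1 - dm) * (dm + 1 - cs)"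
      using False c by (intro mult_left_mono) auto
    then have "s \<le> (r + 1) * (dm + e) + (r + 1 - dm) * (dm + 1 - cs) + (e + r + 1 - 2 * dm) * cs + 2 * (dm - 1) * (dm + 1)"
      using ub' by linarith
    also have "\<dots> = (r + 1) * (dm + e) + (dm + r - 1) * (dm + 1) + (e - dm) * cs"
      by (simp add: algebra_simps)
    also have "(e - dm) * cs \<le> 1 * cs" using er dm c by (intro mult_right_mono) auto
    also have "1 * cs \<le> dm + 1" using c dm er e by linarith
    also have "(r + 1) * (dm + e) \<le> (r + 1) * (2 * r - 1)" using False er r by (intro mult_left_mono) auto
    also have "(dm + r - 1) * (dm + 1) \<le> (2 * r - 1) * (r + 1)" using False dm r by (intro mult_mono) auto
    finally have "s \<le> (r + 1) * (2 * r - 1) + (2 * r - 1) * (r + 1) + (r + 1)" using False by linarith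
    then have "s \<le> 4 * (r * r) + 3 * r - 1" by (simp add: algebra_simps)
    then show False using lb r r2 by linarith
  qed
qed

subsection \<open>Clearing the top set\<close>

text \<open>\<open>K\<close> is demanded of every maximal realization, not of one, because
  \<open>star\<close> passes to another maximal realization and applies it there.\<close>

locale cleared_top =
  fixes V S :: "nat set" and d :: "nat \<Rightarrow> nat" and r :: nat
  assumes SV: "S \<subseteq> V" and fV: "finite V" and cS: "card S = r + 1"
    and K: "\<And>E u v. realizes V d E \<Longrightarrow> (\<And>E'. realizes V d E' \<Longrightarrow> inner_edges S E' \<le> inner_edges S E) \<Longrightarrow>
      u \<in> S \<Longrightarrow> v \<in> S \<Longrightarrow> u \<noteq> v \<Longrightarrow> {u, v} \<notin> E \<Longrightarrow> nb E u \<subseteq> S \<or> nb E v \<subseteq> S"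
    and lo: "\<And>s. s \<in> S \<Longrightarrow> r \<le> d s + 2"
    and L: "card {s \<in> S. d s < r} \<le> 3 \<or> card {s \<in> S. d s < r} \<le> 5 \<and> card {s \<in> S. d s + 2 \<le> r} \<le> 2"
begin

definition L1 where "L1 = {s \<in> S. d s < r}"
definition L2 where "L2 = {s \<in> S. d s + 2 \<le> r}"

lemma L12: "card L1 \<le> 3 \<or> card L1 \<le> 5 \<and> card L2 \<le> 2"
  using L unfolding L1_def L2_def .

lemma finS: "finite S"
  using SV fV finite_subset by blast

lemma finL: "finite L1" "finite L2" "L2 \<subseteq> L1"
  using finS unfolding L1_def L2_def by auto

context
  fixes E M :: "nat set set"
  assumes re: "realizes V d E"
    and maxE: "\<And>E'. realizes V d E' \<Longrightarrow> inner_edges S E' \<le> inner_edges S E"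
    and M_def: "M = co_graph S E"
begin

lemmas rD = realizesD[OF re]

lemma sgM': "simple_graph S M"
  using finS M_def simple_graph_co_graph by simp

lemma M_iff: "{x, y} \<in> M \<longleftrightarrow> x \<in> S \<and> y \<in> S \<and> x \<noteq> y \<and> {x, y} \<notin> E"
  by (simp add: M_def in_co_graph)

lemma M_sym: "y \<in> nb M x \<Longrightarrow> x \<in> nb M y"
  by (simp add: insert_commute)

lemma nbM_S: "nb M x \<subseteq> S - {x}"
  by (rule nb_subset[OF sgM'])

lemma nbM_supp: "nb M x \<subseteq> supp M - {x}"
  using nbM_S[of x] M_sym unfolding supp_def by blast

lemma fin_nbM: "finite (nb M x)"
  by (rule finite_nb[OF sgM'])

lemma fsupp: "finite (supp M)" "supp M \<subseteq> S"
  using finite_supp[OF sgM'] supp_subset[OF sgM'] by blast+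

lemma nb_not_supp: "x \<notin> supp M \<Longrightarrow> nb M x = {}"
  by (simp add: supp_def)

lemma nb_ex: "x \<in> supp M \<Longrightarrow> \<exists>y. y \<in> nb M x"
  unfolding supp_def by blast

lemma in_E_if_not_nbM: "x \<in> S \<Longrightarrow> y \<in> S \<Longrightarrow> x \<noteq> y \<Longrightarrow> y \<notin> nb M x \<Longrightarrow> {x, y} \<in> E"
  by (simp add: M_iff)

text \<open>The other \<open>r\<close> vertices of \<open>S\<close> are missing partners or inner
  neighbours of \<open>x\<close>, and the inner neighbours number \<open>d x\<close> minus the outer
  ones.\<close>

lemma card_nbM:
  assumes x: "x \<in> S"
  shows "card (nb M x) + d x = r + card (nb E x - S)"
proof -
  have 1: "nb M x = S - insert x (nb E x \<inter> S)" 
    using simple_graph_no_loop[OF sgM', of x] x by (auto simp: M_iff)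
  have lp: "x \<notin> nb E x" using rD(5)[of x] by blast
  have "card (insert x (nb E x \<inter> S)) = Suc (card (nb E x \<inter> S))"
    using lp rD(4)[of x] by (simp del: nb_iff)
  moreover have "card (nb M x) = card S - card (insert x (nb E x \<inter> S))"
    unfolding 1 using x finS by (intro card_Diff_subset) auto
  moreover have "card (insert x (nb E x \<inter> S)) \<le> card S" using x finS by (intro card_mono) auto
  moreover have "card (nb E x) = card (nb E x \<inter> S) + card (nb E x - S)"
    using rD(4)[of x] by (rule card_Int_Diff)
  moreover have "card (nb E x) = d x" using rD(3)[of x] x SV by blast
  ultimately show ?thesis using cS by linarith
qed

lemma inner_card:
  assumes "x \<in> S" "nb E x \<subseteq> S"
  shows "card (nb M x) + d x = r" "card (nb M x) \<le> 2"
proof -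
  have "nb E x - S = {}" using assms by blast
  then have "card (nb E x - S) = 0" by (simp only: card.empty)
  then show 1: "card (nb M x) + d x = r" using card_nbM[OF assms(1)] by linarith
  then show "card (nb M x) \<le> 2" using lo[OF assms(1)] by linarith
qed

text \<open>The split behind the case analysis: a vertex of \<open>I\<close> has low degree and one
  or two missing partners, while \<open>K\<close> forbids missing pairs inside
  \<open>Nn\<close>.\<close>

definition I where "I = {x \<in> supp M. nb E x \<subseteq> S}"
definition Nn where "Nn = {x \<in> supp M. \<not> nb E x \<subseteq> S}"

lemma supp_eq: "supp M = I \<union> Nn" "I \<inter> Nn = {}"
  unfolding I_def Nn_def by blast+

lemma I_S: "I \<subseteq> S" "Nn \<subseteq> S" "finite I" "finite Nn"
  using fsupp unfolding I_def Nn_def by (auto intro: finite_subset)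

lemma I_card: "x \<in> I \<Longrightarrow> card (nb M x) \<le> 2"
  using inner_card(2) I_S unfolding I_def by blast

lemma I_L1: "I \<subseteq> L1"
proof
  fix x assume x: "x \<in> I"
  then have "nb M x \<noteq> {}" unfolding I_def supp_def by blast
  then have "0 < card (nb M x)" using fin_nbM[of x] by (simp add: card_gt_0_iff)
  then show "x \<in> L1" using inner_card(1)[of x] x I_S unfolding I_def L1_def by auto
qed

lemma I_L2: "x \<in> I \<Longrightarrow> card (nb M x) = 2 \<Longrightarrow> x \<in> L2"
  using inner_card(1)[of x] I_S unfolding I_def L2_def by auto

lemma nb_Nn: "v \<in> Nn \<Longrightarrow> nb M v \<subseteq> I"
proof
  fix x assume v: "v \<in> Nn" and x: "x \<in> nb M v"
  then have e: "v \<in> S" "x \<in> S" "v \<noteq> x" "{v, x} \<notin> E" using M_iff by auto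
  have "nb E v \<subseteq> S \<or> nb E x \<subseteq> S" by (rule K[OF re maxE e]) simp_all
  then have "nb E x \<subseteq> S" using v unfolding Nn_def by blast
  moreover have "x \<in> supp M" using x nbM_supp[of v] by blast
  ultimately show "x \<in> I" unfolding I_def by blast
qed

text \<open>Exchanging \<open>uu', vy\<close> for \<open>uv, u'y\<close> keeps the number of edges inside the top set, but gives
  \<open>u'\<close> an outer neighbour; the pair \<open>u'v'\<close> would then be missing between two vertices with outer neighbours.\<close>

lemma star:
  assumes u: "u \<in> I" and u': "u' \<in> I" and ne: "u \<noteq> u'" and na: "u' \<notin> nb M u"
    and v: "v \<in> Nn" "v \<in> nb M u" and v': "v' \<in> Nn" "v' \<in> nb M u'"
  shows "v' = v" and "card (nb E v - S) = 1"
proof -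
  have S: "u \<in> S" "u' \<in> S" "v \<in> S" "v' \<in> S" using u u' v v' I_S by blast+
  have uu': "{u, u'} \<in> E" using in_E_if_not_nbM[OF S(1,2) ne na] .
  have uv: "{u, v} \<notin> E" "u \<noteq> v" and u'v': "{u', v'} \<notin> E" "u' \<noteq> v'" using v v' M_iff by auto
  have inn: "nb E u \<subseteq> S" "nb E u' \<subseteq> S" using u u' unfolding I_def by blast+
  obtain y where y: "y \<in> nb E v" "y \<notin> S" using v unfolding Nn_def by blast
  have u'v: "u' \<noteq> v" using inn v unfolding Nn_def by blast
  have u'y: "{u', y} \<notin> E" "u' \<noteq> y" using inn(2) y S by auto
  define E' where "E' = E - {{u, u'}, {v, y}} \<union> {{u, v}, {u', y}}"
  have re': "realizes V d E'" unfolding E'_def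
    by (rule realizes_switch[OF re uu' _ uv u'y]) (use y in simp)
  have "{e \<in> E'. e \<subseteq> S} = insert {u, v} ({e \<in> E. e \<subseteq> S} - {{u, u'}})"
    unfolding E'_def using S y by auto
  moreover have "finite {e \<in> E. e \<subseteq> S}" using simple_graph_finite[OF rD(1)] by simp
  moreover have "{u, v} \<notin> {e \<in> E. e \<subseteq> S} - {{u, u'}}" using uv by simp
  moreover have "{u, u'} \<in> {e \<in> E. e \<subseteq> S}" using uu' S by simp
  ultimately have "inner_edges S E' = inner_edges S E"
    unfolding inner_edges_def
    by (metis (no_types, lifting) card.insert card_Suc_Diff1 finite_Diff)
  \<comment> \<open>One inner edge is lost and one gained, so the new realization is maximal too and
    \<open>K\<close> applies to it.\<close>
  then have max': "\<And>E''. realizes V d E'' \<Longrightarrow> inner_edges S E'' \<le> inner_edges S E'" using maxE by simp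
  have "{u', v'} \<noteq> {u, v}" using ne u'v by (auto simp: doubleton_eq_iff)
  moreover have "{u', v'} \<noteq> {u', y}" using S y by (auto simp: doubleton_eq_iff)
  ultimately have n': "{u', v'} \<notin> E'" unfolding E'_def using u'v' by simp
  have "y \<in> nb E' u'" unfolding E'_def by simp
  then have "\<not> nb E' u' \<subseteq> S" using y by blast
  moreover have "nb E' u' \<subseteq> S \<or> nb E' v' \<subseteq> S"
    by (rule K[OF re' max' S(2,4) u'v'(2) n']) simp_all
  ultimately have in': "nb E' v' \<subseteq> S" by blast
  \<comment> \<open>\<open>vy\<close> is the only edge leaving \<open>S\<close> that is lost. As
    \<open>v'\<close> has no outer neighbour any more, it must be \<open>v\<close>, and
    \<open>y\<close> was its only one.\<close>
  have keep: "z \<in> nb E' x" if "x \<in> S" "z \<in> nb E x" "z \<notin> S" "x \<noteq> v \<or> z \<noteq> y" for x z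
  proof -
    have "{x, z} \<noteq> {u, u'}" using that S by (auto simp: doubleton_eq_iff)
    moreover have "{x, z} \<noteq> {v, y}" using that y S by (auto simp: doubleton_eq_iff)
    ultimately show ?thesis unfolding E'_def using that by simp
  qed
  obtain z where z: "z \<in> nb E v'" "z \<notin> S" using v' unfolding Nn_def by blast
  show vv: "v' = v"
  proof (rule ccontr)
    assume "v' \<noteq> v"
    then show False using keep[OF S(4) z] in' z by blast
  qed
  have "nb E v - S = {y}"
  proof
    show "nb E v - S \<subseteq> {y}"
    proof
      fix z assume z: "z \<in> nb E v - S"
      show "z \<in> {y}"
      proof (rule ccontr)
        assume "z \<notin> {y}"
        then show False using keep[of v z] S z in' vv by blast
      qed
    qed
    show "{y} \<subseteq> nb E v - S" using y by blast
  qed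
  then show "card (nb E v - S) = 1" by simp
qed

lemma two_elements:
  assumes "a \<in> nb M x" "b \<in> nb M x" "a \<noteq> b" "x \<in> I"
  shows "nb M x = {a, b}"
proof -
  have "{a, b} \<subseteq> nb M x" using assms by blast
  moreover have "card (nb M x) \<le> card {a, b}" using I_card[OF assms(4)] assms(3) by simp
  ultimately show ?thesis using card_seteq[OF fin_nbM] by metis
qed

lemma deg2_L2:
  assumes "\<And>v. v \<in> Nn \<Longrightarrow> card (nb M v) \<le> 1"
  shows "{x. card (nb M x) = 2} \<subseteq> L2 \<inter> I"
proof
  fix x assume "x \<in> {x. card (nb M x) = 2}"
  then have x: "card (nb M x) = 2" by simp
  then have "x \<in> supp M" using nb_not_supp[of x] by fastforce
  moreover have "x \<notin> Nn" using assms[of x] x by auto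
  ultimately have "x \<in> I" using supp_eq by blast
  then show "x \<in> L2 \<inter> I" using I_L2 x by blast
qed

section \<open>Fitting the missing pairs, by the number of their vertices with outer
  neighbours\<close>

text \<open>At most 5 + 2 vertices lie in missing pairs, as many as \<open>K3_union_P3\<close> has.
  The hypothesis \<open>k2\<close> concerns only \<open>card L1 <= 3\<close>, where
  \<open>L2\<close> may have three elements.\<close>

lemma fits_if_Nn_single:
  assumes Nle: "card Nn \<le> 2" and N1: "\<And>v. v \<in> Nn \<Longrightarrow> card (nb M v) \<le> 1"
    and k2: "card L1 \<le> 3 \<Longrightarrow> card {x. card (nb M x) = 2} \<le> 2"
  shows "fits S E"
proof (rule fits_sparse[OF finS M_def])
  have cI: "card I \<le> card L1" using I_L1 finL by (intro card_mono) auto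
  have "card (supp M) \<le> card I + card Nn" unfolding supp_eq(1) by (rule card_Un_le)
  then show "card (supp M) \<le> 7" using cI Nle L12 by linarith
  show "card (nb M x) \<le> 2" for x
    using I_card[of x] N1[of x] nb_not_supp[of x] supp_eq by (cases "x \<in> supp M") auto
  show "card {x. card (nb M x) = 2} \<le> 2"
  proof (cases "card L1 \<le> 3")
    case True
    then show ?thesis by (rule k2)
  next
    case False
    then have "card L2 \<le> 2" using L12 by blast
    moreover have "card {x. card (nb M x) = 2} \<le> card L2"
      using deg2_L2[OF N1] finL by (intro card_mono) auto
    ultimately show ?thesis by linarith
  qed
qed

lemma fits_Nn_empty:
  assumes "Nn = {}"
  shows "fits S E"
proof (cases "card L1 \<le> 3")
  case True
  have "card (supp M) \<le> card L1" using I_L1 finL assms supp_eq(1) by (intro card_mono) auto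
  then show ?thesis using True by (intro fits_three[OF finS M_def]) simp
next
  case False
  show ?thesis by (rule fits_if_Nn_single) (use assms False in auto)
qed

text \<open>By \<open>star\<close>, partners in \<open>I\<close> of different vertices of
  \<open>Nn\<close> form a missing pair themselves. As a vertex of \<open>I\<close> has at most two
  partners, the missing pairs around \<open>Nn\<close> belong to a path \<open>v1 u v2\<close> or
  \<open>v1 u1 u2 v2\<close>.\<close>

lemma fits_Nn_two:
  assumes v: "v1 \<in> Nn" "v2 \<in> Nn" "v1 \<noteq> v2"
  shows "fits S E"
proof (cases "\<exists>u. v1 \<in> nb M u \<and> v2 \<in> nb M u")
  case True
  then obtain u where u: "v1 \<in> nb M u" "v2 \<in> nb M u" by blast
  have uI: "u \<in> I" using nb_Nn[OF v(1)] M_sym[OF u(1)] by blast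
  have nu: "nb M u = {v1, v2}" using two_elements[OF u v(3) uI] .
  \<comment> \<open>Applied to \<open>v1\<close> and to \<open>v2\<close>, \<open>star\<close> would
    identify the partner of a second such vertex with each of them.\<close>
  have other: False if "u' \<in> I" "u' \<noteq> u" "v' \<in> Nn" "v' \<in> nb M u'" for u' v'
  proof -
    have "u' \<noteq> v1" "u' \<noteq> v2" using v that(1) supp_eq(2) by auto
    then have "u' \<notin> nb M u" unfolding nu by simp
    then have "v' = v1" "v' = v2"
      using star(1)[OF uI that(1) that(2)[symmetric] _ v(1) u(1) that(3,4)]
        star(1)[OF uI that(1) that(2)[symmetric] _ v(2) u(2) that(3,4)] by blast+
    then show False using v(3) by simp
  qed
  have nN: "nb M v' = {u}" if v': "v' \<in> Nn" for v'
  proof -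
    have "nb M v' \<subseteq> {u}" using other nb_Nn[OF v'] M_sym v' by blast
    moreover have "nb M v' \<noteq> {}" using v' unfolding Nn_def supp_def by blast
    ultimately show ?thesis by blast
  qed
  have N: "Nn = {v1, v2}"
  proof
    show "Nn \<subseteq> {v1, v2}"
    proof
      fix v' assume "v' \<in> Nn"
      then have "u \<in> nb M v'" using nN by blast
      then show "v' \<in> {v1, v2}" using M_sym nu by blast
    qed
  qed (use v in blast)
  show ?thesis
  proof (cases "card L1 \<le> 3")
    case False
    show ?thesis by (rule fits_if_Nn_single) (use N nN False card_insert_le_m1 in \<open>auto simp: card_insert_if\<close>)
  next
    case True
    have cI: "card (I - {u}) \<le> 2"
    proof -
      have "card I \<le> card L1" using I_L1 finL by (intro card_mono) auto
      then show ?thesis using True uI I_S by simp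
    qed
    show ?thesis
    proof (rule fits_triangle_matching[OF finS M_def, of u v1 v2])
      show "distinct [u, v1, v2]" using uI v supp_eq(2) by auto
      show "nb M x \<subseteq> {u, v1, v2}" if "x \<in> {u, v1, v2}" for x
        using that nu nN[OF v(1)] nN[OF v(2)] by (auto simp del: nb_iff)
      show "card (nb M x) \<le> 1" if x: "x \<notin> {u, v1, v2}" for x
      proof (cases "x \<in> supp M")
        case True
        then have xI: "x \<in> I - {u}" using x N supp_eq by blast
        have "nb M x \<subseteq> I - {u} - {x}"
        proof
          fix y assume y: "y \<in> nb M x"
          then have "y \<in> supp M" "y \<noteq> x" using nbM_supp[of x] by blast+
          moreover have "y \<notin> Nn" using other[of x y] xI y by blast
          moreover have "y \<noteq> u" using M_sym[OF y] nu x by blast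
          ultimately show "y \<in> I - {u} - {x}" using supp_eq by blast
        qed
        then have "card (nb M x) \<le> card (I - {u} - {x})" using I_S by (intro card_mono) auto
        also have "\<dots> = card (I - {u}) - 1" using xI I_S by simp
        finally show ?thesis using cI by linarith
      qed (simp add: nb_not_supp)
      have "supp M - {u, v1, v2} \<subseteq> I - {u}" using supp_eq N by blast
      then have "card (supp M - {u, v1, v2}) \<le> card (I - {u})" using I_S by (intro card_mono) auto
      then show "card (supp M - {u, v1, v2}) \<le> 5" using cI by linarith
    qed
  qed
next
  case False
  obtain u1 where u1: "u1 \<in> nb M v1" using nb_ex v unfolding Nn_def by blast
  obtain u2 where u2: "u2 \<in> nb M v2" using nb_ex v unfolding Nn_def by blast
  have uI: "u1 \<in> I" "u2 \<in> I" using nb_Nn v u1 u2 by blast+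
  have vu: "v1 \<in> nb M u1" "v2 \<in> nb M u2" using u1 u2 M_sym by blast+
  have une: "u1 \<noteq> u2" using False vu by blast
  have uu: "u2 \<in> nb M u1"
  proof (rule ccontr)
    assume "u2 \<notin> nb M u1"
    then show False using star(1)[OF uI une _ v(1) vu(1) v(2) vu(2)] v(3) by simp
  qed
  have Iv: "u1 \<noteq> v1" "u1 \<noteq> v2" "u2 \<noteq> v1" "u2 \<noteq> v2" using uI v supp_eq(2) by auto
  have nu1: "nb M u1 = {v1, u2}" using two_elements[OF vu(1) uu Iv(3)[symmetric] uI(1)] .
  have nu2: "nb M u2 = {v2, u1}" using two_elements[OF vu(2) M_sym[OF uu] Iv(2)[symmetric] uI(2)] .
  have other: False if "u' \<in> I" "u' \<noteq> u1" "u' \<noteq> u2" "v' \<in> Nn" "v' \<in> nb M u'" for u' v'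
  proof -
    have "u' \<noteq> v1" "u' \<noteq> v2" using v that(1) supp_eq(2) by auto
    then have "u' \<notin> nb M u1" "u' \<notin> nb M u2" unfolding nu1 nu2 using that by simp_all
    then have "v' = v1" "v' = v2"
      using star(1)[OF uI(1) that(1) that(2)[symmetric] _ v(1) vu(1) that(4,5)]
        star(1)[OF uI(2) that(1) that(3)[symmetric] _ v(2) vu(2) that(4,5)] by blast+
    then show False using v(3) by simp
  qed
  have nNsub: "nb M v' \<subseteq> {u1, u2}" if v': "v' \<in> Nn" for v'
    using other nb_Nn[OF v'] M_sym v' by blast
  have N: "Nn = {v1, v2}"
  proof
    show "Nn \<subseteq> {v1, v2}"
    proof
      fix v' assume v': "v' \<in> Nn"
      then have "nb M v' \<noteq> {}" unfolding Nn_def supp_def by blast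
      then have "u1 \<in> nb M v' \<or> u2 \<in> nb M v'" using nNsub[OF v'] by blast
      then have "v' \<in> nb M u1 \<or> v' \<in> nb M u2" using M_sym by blast
      then show "v' \<in> {v1, v2}" using nu1 nu2 v' uI supp_eq(2) by blast
    qed
  qed (use v in blast)
  have "v1 \<notin> nb M u2" "v2 \<notin> nb M u1" unfolding nu1 nu2 using v(3) Iv by auto
  then have "u2 \<notin> nb M v1" "u1 \<notin> nb M v2" using M_sym by blast+
  then have sub1: "nb M v1 \<subseteq> {u1}" "nb M v2 \<subseteq> {u2}" using nNsub v by blast+
  have c1: "card (nb M v) \<le> 1" if "v \<in> Nn" for v
  proof -
    have "nb M v \<subseteq> {u1} \<or> nb M v \<subseteq> {u2}" 
      using that sub1 unfolding N by (elim insertE emptyE) (simp_all del: nb_iff)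
    then show ?thesis using card_mono[of "{u1}" "nb M v"] card_mono[of "{u2}" "nb M v"] by auto
  qed
  show ?thesis
  proof (rule fits_if_Nn_single[OF _ c1])
    show "card Nn \<le> 2" using N by (simp add: card_insert_if)
    assume L3: "card L1 \<le> 3"
    have "{x. card (nb M x) = 2} \<subseteq> {u1, u2}"
    proof
      fix x assume "x \<in> {x. card (nb M x) = 2}"
      then have x2: "card (nb M x) = 2" and xI: "x \<in> I" using deg2_L2[OF c1] by auto
      show "x \<in> {u1, u2}"
      proof (rule ccontr)
        assume x: "x \<notin> {u1, u2}"
        have "nb M x \<subseteq> I - {u1, u2, x}"
        proof
          fix y assume y: "y \<in> nb M x"
          then have "y \<in> supp M" "y \<noteq> x" using nbM_supp[of x] by blast+
          moreover have "y \<notin> Nn" using other[of x y] xI y x by blast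
          moreover have "x \<noteq> v1" "x \<noteq> v2" using xI v supp_eq(2) by blast+
          then have "y \<noteq> u1" "y \<noteq> u2" using M_sym[OF y] nu1 nu2 x by blast+
          ultimately show "y \<in> I - {u1, u2, x}" using supp_eq by blast
        qed
        then have "card (nb M x) \<le> card (I - {u1, u2, x})" using I_S by (intro card_mono) auto
        also have "\<dots> = card I - 3"
          using I_S uI xI une x by (simp add: card_Diff_subset)
        also have "card I \<le> card L1" using I_L1 finL by (intro card_mono) auto
        finally show False using L3 x2 by linarith
      qed
    qed
    then have "card {x. card (nb M x) = 2} \<le> card {u1, u2}" by (intro card_mono) auto
    also have "\<dots> \<le> 2" by (simp add: card_insert_if)
    finally show "card {x. card (nb M x) = 2} \<le> 2" .
  qed
qed

text \<open>The missing pairs may be replaced by any graph on \<open>S\<close> with the right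
  degrees. Turning the outer edge \<open>vy\<close> into \<open>zy\<close> moves one unit of missing
  degree from \<open>v\<close> to \<open>z\<close>: a vertex that gains an outer edge gives up an
  inner one. With \<open>z = v\<close> this is a mere rearrangement.\<close>

lemma rewire:
  assumes v: "v \<in> S" and y: "nb E v - S = {y}" and inn: "\<And>x. x \<in> S \<Longrightarrow> x \<noteq> v \<Longrightarrow> x \<in> L1 \<Longrightarrow> nb E x \<subseteq> S"
    and z: "z \<in> L1" and sg: "simple_graph S M'"
    and deg: "\<And>x. x \<in> S \<Longrightarrow> degree M' x + of_bool (x = v) = degree M x + of_bool (x = z)"
  shows "\<exists>E'. realizes V d E' \<and> co_graph S E' = M'"
proof -
  define P where "P = {e. e \<subseteq> S \<and> card e = 2}"
  have fP: "finite P" unfolding P_def using finS by simp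
  have MP: "M \<subseteq> P" "M' \<subseteq> P"
    using sgM' sg unfolding P_def simple_graph_iff by blast+
  define R where "R = insert {v, y} (P - M)"
  define A where "A = insert {z, y} (P - M')"
  have yS: "y \<notin> S" "y \<in> nb E v" using y by blast+
  have zS: "z \<in> S" using z unfolding L1_def by blast
  have yP: "{x, y} \<notin> P" for x using yS unfolding P_def by blast
  have PM: "P - M = {e \<in> E. e \<subseteq> S}"
    using rD(1) unfolding P_def M_def co_graph_def simple_graph_iff by blast
  have yV: "y \<in> V" using yS(2) rD(5)[of v] by blast
  define E' where "E' = E - R \<union> A"
  have re': "realizes V d E'" unfolding E'_def
  proof (rule realizes_exchange[OF re])
    show "R \<subseteq> E" unfolding R_def PM using yS by auto
    show "A \<inter> (E - R) = {}"
    proof -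
      have "{z, y} \<notin> E - R"
      proof (cases "z = v")
        case True
        then show ?thesis unfolding R_def by simp
      next
        case False
        then have "nb E z \<subseteq> S" using inn zS z by blast
        then have "y \<notin> nb E z" using yS by blast
        then show ?thesis by simp
      qed
      moreover have "e \<notin> E - R" if "e \<in> P" for e
      proof
        assume "e \<in> E - R"
        then have "e \<in> P - M" unfolding PM using that unfolding P_def by blast
        then show False using \<open>e \<in> E - R\<close> unfolding R_def by blast
      qed
      ultimately show ?thesis unfolding A_def by blast
    qed
    show "e \<subseteq> V \<and> card e = 2" if "e \<in> A" for e
    proof (cases "e = {z, y}")
      case True
      have "z \<noteq> y" using zS yS by blast
      then show ?thesis using True zS yV SV by auto
    next
      case False
      then have "e \<in> P" using that unfolding A_def by blast
      then show ?thesis using SV unfolding P_def by blast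
    qed
    fix x assume x: "x \<in> V"
    let ?s = "\<lambda>X. (\<Sum>e\<in>X. of_bool (x \<in> e)) :: nat"
    have dM: "?s M = degree M x" "?s M' = degree M' x"
      using degree_eq_sum[OF sgM'] degree_eq_sum[OF sg] by simp_all
    have sp: "?s P = ?s (P - M) + ?s M" "?s P = ?s (P - M') + ?s M'"
      using sum.subset_diff[OF MP(1) fP] sum.subset_diff[OF MP(2) fP] by blast+
    have r1: "?s R = of_bool (x \<in> {v, y}) + ?s (P - M)"
      unfolding R_def using fP yP by (intro sum.insert) auto
    have a1: "?s A = of_bool (x \<in> {z, y}) + ?s (P - M')"
      unfolding A_def using fP yP by (intro sum.insert) auto
    have vz: "v \<noteq> y" "z \<noteq> y" using v zS yS by blast+
    have "degree M' x + of_bool (x = v) = degree M x + of_bool (x = z)"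
    proof (cases "x \<in> S")
      case False
      have "nb M x = {}" "nb M' x = {}" using False simple_graph_edgeD(1)[OF sgM', of x] simple_graph_edgeD(1)[OF sg, of x]
        by auto
      then show ?thesis using False v zS by (auto simp: degree_nb)
    qed (rule deg)
    then show "?s R = ?s A"
      using sp unfolding r1 a1 dM of_bool_mem_doubleton[OF vz(1)] of_bool_mem_doubleton[OF vz(2)] by linarith
  qed
  have "co_graph S E' = M'"
  proof (rule set_eqI)
    fix e
    have "e \<in> co_graph S E' \<longleftrightarrow> e \<in> P \<and> e \<notin> E'" unfolding co_graph_def P_def by blast
    also have "\<dots> \<longleftrightarrow> e \<in> P \<and> e \<in> M'"
    proof -
      have "e \<in> E' \<longleftrightarrow> e \<notin> M'" if "e \<in> P"
      proof -
        have "e \<notin> E - R"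
        proof
          assume "e \<in> E - R"
          then have "e \<in> P - M" unfolding PM using that unfolding P_def by blast
          then show False using \<open>e \<in> E - R\<close> unfolding R_def by blast
        qed
        moreover have "e \<noteq> {z, y}" using yP that by blast
        ultimately show ?thesis unfolding E'_def A_def using that by blast
      qed
      then show ?thesis by blast
    qed
    also have "\<dots> \<longleftrightarrow> e \<in> M'" using MP by blast
    finally show "e \<in> co_graph S E' \<longleftrightarrow> e \<in> M'" .
  qed
  then show ?thesis using re' by blast
qed

text \<open>\<open>v\<close> may have three missing partners, more than any vertex of
  \<open>K3_union_P3\<close>. But the degrees in \<open>M\<close> are forced by \<open>d\<close>, so
  \<open>rewire\<close> may draw another graph with the extra unit at a convenient vertex.\<close>

lemma rewire_fits:
  assumes v: "Nn = {v}" "card (nb E v - S) = 1" "2 \<le> card (nb M v)"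
    and c4: "4 \<le> card L1" and c5: "card L1 \<le> 5" "card L2 \<le> 2"
  shows "\<exists>E'. realizes V d E' \<and> fits S E'"
proof -
  obtain y where y: "nb E v - S = {y}" using v(2) card_1_singletonE by blast
  have vS: "v \<in> S" using v I_S by blast
  have L1S: "L1 \<subseteq> S" unfolding L1_def by blast
  have L1supp: "L1 \<subseteq> supp M"
  proof
    fix x assume "x \<in> L1"
    then have "x \<in> S" "d x < r" unfolding L1_def by auto
    then have "card (nb M x) \<noteq> 0" using card_nbM[of x] by linarith
    then show "x \<in> supp M" unfolding supp_def by force
  qed
  have suppin: "nb E x \<subseteq> S" if "x \<in> supp M" "x \<noteq> v" for x
    using that v supp_eq unfolding I_def by blast
  have inn: "\<And>x. x \<in> S \<Longrightarrow> x \<noteq> v \<Longrightarrow> x \<in> L1 \<Longrightarrow> nb E x \<subseteq> S" using suppin L1supp by blast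
  \<comment> \<open>For \<open>x\<close> in \<open>S\<close> this is the deficit
    \<open>r - d x\<close>, truncated at 0. Its outer neighbour gives \<open>v\<close> one missing
    partner more.\<close>
  define w where "w x = (if x \<in> L1 then 1 + of_bool (x \<in> L2) else 0 :: nat)" for x
  have degM: "degree M x = w x + of_bool (x = v)" if x: "x \<in> S" for x
  proof (cases "x = v")
    case True
    have "card (nb M v) + d v = r + 1" using card_nbM[OF vS] v(2) by simp
    then show ?thesis using True v(3) lo[OF vS] vS unfolding degree_nb w_def L1_def L2_def by auto
  next
    case False
    show ?thesis
    proof (cases "x \<in> supp M")
      case True
      have "card (nb M x) + d x = r" using inner_card(1)[OF x suppin[OF True False]] .
      moreover have "card (nb M x) \<noteq> 0" using fin_nbM True by (simp add: supp_def)
      ultimately show ?thesis using False x lo[OF x] unfolding degree_nb w_def L1_def L2_def by auto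
    next
      case nosupp: False
      then have "x \<notin> L1" using L1supp by blast
      then show ?thesis using False nb_not_supp[OF nosupp] unfolding degree_nb w_def by simp
    qed
  qed
  \<comment> \<open>By the handshake identity for \<open>M\<close>, \<open>card L1 + card L2\<close>
    is odd, which leaves three pairs of sizes.\<close>
  have par: "card L1 + card L2 + 1 = 2 * card M"
  proof -
    have "2 * card M = (\<Sum>x\<in>S. w x + of_bool (x = v))"
      unfolding handshake[OF sgM', symmetric] by (intro sum.cong degM refl)
    also have "\<dots> = (\<Sum>x\<in>S. w x) + 1"
      using vS finS unfolding sum.distrib by (simp add: sum_of_bool_eq)
    also have "(\<Sum>x\<in>S. w x) = (\<Sum>x\<in>L1. w x)"
      using L1S finS by (intro sum.mono_neutral_right) (auto simp: w_def)
    also have "\<dots> = (\<Sum>x\<in>L1. 1 + of_bool (x \<in> L2))" by (intro sum.cong) (auto simp: w_def)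
    also have "\<dots> = card L1 + card L2"
    proof -
      have "L1 \<inter> L2 = L2" using finL(3) by blast
      then show ?thesis using finL unfolding sum.distrib by (simp add: sum_of_bool_eq)
    qed
    finally show ?thesis by simp
  qed
  have finish: ?thesis
    if sg: "simple_graph S M'" and z: "z \<in> L1" and deg: "\<And>x. degree M' x = w x + of_bool (x = z)"
      and dist: "distinct [a1, a2, a3, a4, a5, a6, a7]" and sub: "M' \<subseteq> tri_path a1 a2 a3 a4 a5 a6 a7"
    for M' z a1 a2 a3 a4 a5 a6 a7
  proof -
    obtain E' where E': "realizes V d E'" "co_graph S E' = M'"
      using rewire[OF vS y inn z sg] degM deg by auto
    have "fits S E'" by (rule fitsI[OF dist]) (use E' sub in blast)
    then show ?thesis using E' by blast
  qed
  have fresh: "\<exists>p q s. distinct [p, q, s] \<and> {p, q, s} \<inter> F = {}" if F: "finite F" for F :: "nat set"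
  proof -
    have "infinite (UNIV - F)" using F by (simp add: infinite_UNIV_nat)
    then obtain X where "finite X" "card X = 3" "X \<subseteq> UNIV - F" using infinite_arbitrarily_large by blast
    then show ?thesis by (auto simp: card_3_iff)
  qed
  have L12S: "x \<in> S" if "x \<in> L1" for x using that L1S by blast
  consider "card L1 = 4" "card L2 = 1" | "card L1 = 5" "card L2 = 0" | "card L1 = 5" "card L2 = 2"
  proof -
    have "card L1 = 4 \<or> card L1 = 5" "card L2 = 0 \<or> card L2 = 1 \<or> card L2 = 2" using c4 c5 by linarith+
    moreover have "even (card L1 + card L2 + 1)" unfolding par by simp
    then have "odd (card L1 + card L2)" by simp
    ultimately show ?thesis using that by fastforce
  qed
  then show ?thesis
  proof cases
    case 1
    obtain a where a: "L2 = {a}" using 1(2) card_1_singletonE by blast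
    then have "card (L1 - {a}) = 3" using 1(1) finL by simp
    then obtain b c e where bce: "L1 - {a} = {b, c, e}" "distinct [b, c, e]" by (auto simp: card_3_iff)
    have L1: "L1 = {a, b, c, e}" "distinct [a, b, c, e]" using bce a finL(3) by auto
    obtain p q s where pqs: "distinct [p, q, s]" "{p, q, s} \<inter> {a, b, c, e} = {}"
      using fresh[of "{a, b, c, e}"] by auto
    \<comment> \<open>Deficits 2, 1, 1, 1: with the extra unit at \<open>b\<close> they are the
      degrees of the path \<open>c a b e\<close>.\<close>
    show ?thesis
    proof (rule finish[of "{{c, a}, {a, b}, {b, e}}" b p q s c a b e])
      show "simple_graph S {{c, a}, {a, b}, {b, e}}"
        unfolding simple_graph_iff using finS L12S L1 by auto
      show "b \<in> L1" using L1 by simp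
      fix x
      have "nb {{c, a}, {a, b}, {b, e}} x = (if x = a then {c, b} else if x = b then {a, e}
          else if x = c then {a} else if x = e then {b} else {})"
        using L1(2) unfolding set_eq_iff nb_iff by (simp add: doubleton_eq_iff)
      then show "degree {{c, a}, {a, b}, {b, e}} x = w x + of_bool (x = b)"
        unfolding degree_nb w_def L1(1) a using L1(2) by simp
    qed (use pqs L1(2) in \<open>auto simp: tri_path_def\<close>)
  next
    case 2
    have L2: "L2 = {}" using 2(2) finL by simp
    obtain a where a: "a \<in> L1" using 2(1) by fastforce
    have "card (L1 - {a}) = 4" using 2(1) finL a by simp
    then obtain b where b: "b \<in> L1 - {a}" by (metis card.empty equals0I zero_neq_numeral)
    have "card (L1 - {a} - {b}) = 3" using \<open>card (L1 - {a}) = 4\<close> finL b by simp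
    then obtain c p q where cpq: "L1 - {a} - {b} = {c, p, q}" "distinct [c, p, q]" by (auto simp: card_3_iff)
    have L1: "L1 = {a, b, c, p, q}" "distinct [a, b, c, p, q]" using cpq a b by auto
    obtain s t t' where st: "distinct [s, t, t']" "{s, t, t'} \<inter> {a, b, c, p, q} = {}"
      using fresh[of "{a, b, c, p, q}"] by auto
    \<comment> \<open>Deficits 1, 1, 1, 1, 1: the extra unit makes \<open>a\<close> the centre of
      the path \<open>b a c\<close>, beside the edge \<open>pq\<close>.\<close>
    show ?thesis
    proof (rule finish[of "{{a, b}, {a, c}, {p, q}}" a a b c p q s t])
      show "simple_graph S {{a, b}, {a, c}, {p, q}}"
        unfolding simple_graph_iff using finS L12S L1 by auto
      show "a \<in> L1" using L1 by simp
      fix x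
      have "nb {{a, b}, {a, c}, {p, q}} x = (if x = a then {b, c} else if x = b then {a}
          else if x = c then {a} else if x = p then {q} else if x = q then {p} else {})"
        using L1(2) unfolding set_eq_iff nb_iff by (simp add: doubleton_eq_iff)
      moreover have "w x = (if x \<in> {a, b, c, p, q} then 1 + of_bool (x \<in> {}) else 0)"
        unfolding w_def L1(1) L2 ..
      ultimately show "degree {{a, b}, {a, c}, {p, q}} x = w x + of_bool (x = a)"
        unfolding degree_nb using L1(2) by auto
    qed (use st L1(2) in \<open>auto simp: tri_path_def\<close>)
  next
    case 3
    obtain a b where ab: "L2 = {a, b}" "a \<noteq> b" using 3(2) by (auto simp: card_2_iff)
    then have "card (L1 - {a, b}) = 3" using 3 finL by (simp add: card_Diff_subset)
    then obtain c p q where cpq: "L1 - {a, b} = {c, p, q}" "distinct [c, p, q]" by (auto simp: card_3_iff)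
    have L1: "L1 = {a, b, c, p, q}" "distinct [a, b, c, p, q]" using cpq ab finL(3) by auto
    obtain s t t' where st: "distinct [s, t, t']" "{s, t, t'} \<inter> {a, b, c, p, q} = {}"
      using fresh[of "{a, b, c, p, q}"] by auto
    \<comment> \<open>Deficits 2, 2, 1, 1, 1: the extra unit at \<open>c\<close> completes a
      triangle, beside the edge \<open>pq\<close>.\<close>
    show ?thesis
    proof (rule finish[of "{{a, b}, {b, c}, {a, c}, {p, q}}" c a b c p q s t])
      show "simple_graph S {{a, b}, {b, c}, {a, c}, {p, q}}"
        unfolding simple_graph_iff using finS L12S L1 by auto
      show "c \<in> L1" using L1 by simp
      fix x
      have "nb {{a, b}, {b, c}, {a, c}, {p, q}} x = (if x = a then {b, c} else if x = b then {a, c}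
          else if x = c then {b, a} else if x = p then {q} else if x = q then {p} else {})"
        using L1(2) unfolding set_eq_iff nb_iff by (simp add: doubleton_eq_iff)
      moreover have "w x = (if x \<in> {a, b, c, p, q} then 1 + of_bool (x \<in> {a, b}) else 0)"
        unfolding w_def L1(1) ab(1) ..
      ultimately show "degree {{a, b}, {b, c}, {a, c}, {p, q}} x = w x + of_bool (x = c)"
        unfolding degree_nb using L1(2) by auto
    qed (use st L1(2) in \<open>auto simp: tri_path_def\<close>)
  qed
qed

text \<open>Three cases: two partners of \<open>v\<close> form a missing pair, which yields a
  triangle; \<open>v\<close> has a single partner; or \<open>v\<close> has several partners,
  pairwise adjacent, and then \<open>star\<close> leaves it one outer neighbour.\<close>

lemma fits_Nn_one:
  assumes v: "Nn = {v}"
  shows "\<exists>E'. realizes V d E' \<and> fits S E'"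
proof -
  have vN: "v \<in> Nn" and vS: "v \<in> S" using v I_S by blast+
  have J: "nb M v \<subseteq> I" "nb M v \<noteq> {}" using nb_Nn[OF vN] vN unfolding Nn_def supp_def by blast+
  have cI: "card I \<le> card L1" using I_L1 finL by (intro card_mono) auto
  have vI: "v \<notin> I" using vN supp_eq(2) by blast
  have csupp: "card (supp M) \<le> card I + 1" unfolding supp_eq(1) v using card_insert_le_m1[of "card I + 1" I v] by simp
  show ?thesis
  proof (cases "\<exists>u1\<in>nb M v. \<exists>u2\<in>nb M v. u2 \<in> nb M u1")
    case True
    then obtain u1 u2 where u: "u1 \<in> nb M v" "u2 \<in> nb M v" "u2 \<in> nb M u1" by blast
    have ne: "u1 \<noteq> u2" using u(3) nbM_S[of u1] by blast
    have uI: "u1 \<in> I" "u2 \<in> I" using u J by blast+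
    have uv: "u1 \<noteq> v" "u2 \<noteq> v" using uI vI by blast+
    have nu1: "nb M u1 = {v, u2}" using two_elements[OF M_sym[OF u(1)] u(3) uv(2)[symmetric] uI(1)] .
    have nu2: "nb M u2 = {v, u1}" using two_elements[OF M_sym[OF u(2)] M_sym[OF u(3)] uv(1)[symmetric] uI(2)] .
    have uL2: "u1 \<in> L2" "u2 \<in> L2" using I_L2 uI nu1 nu2 uv by simp_all
    \<comment> \<open>A third partner would by \<open>star\<close> leave \<open>v\<close> one outer
      neighbour and put it into \<open>L2\<close>; then \<open>L2\<close> has three and
      \<open>L1\<close> four elements, against \<open>L12\<close>.\<close>
    have nv: "nb M v = {u1, u2}"
    proof (rule ccontr)
      assume "nb M v \<noteq> {u1, u2}"
      then obtain u3 where u3: "u3 \<in> nb M v" "u3 \<noteq> u1" "u3 \<noteq> u2" using u by blast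
      have u3I: "u3 \<in> I" "u3 \<noteq> v" using u3 J vI by blast+
      have "u3 \<notin> nb M u1" unfolding nu1 using u3 u3I by simp
      then have "card (nb E v - S) = 1"
        using star(2)[OF uI(1) u3I(1) u3(2)[symmetric] _ vN M_sym[OF u(1)] vN M_sym[OF u3(1)]] by blast
      then have dv: "card (nb M v) + d v = r + 1" using card_nbM[OF vS] by simp
      have "card {u1, u2, u3} \<le> card (nb M v)" using u u3 fin_nbM by (intro card_mono) auto
      then have "d v + 2 \<le> r" using dv ne u3 by simp
      then have vL: "v \<in> L2" using vS unfolding L2_def by blast
      have "card {v, u1, u2} \<le> card L2" using vL uL2 finL by (intro card_mono) auto
      moreover have "card {v, u1, u2, u3} \<le> card L1" using vL uL2 finL u3I I_L1 by (intro card_mono) auto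
      ultimately show False using L12 ne u3 uv u3I by simp
    qed
    have "fits S E"
    proof (rule fits_triangle_matching[OF finS M_def, of v u1 u2])
      show "distinct [v, u1, u2]" using uv ne by auto
      show "nb M x \<subseteq> {v, u1, u2}" if "x \<in> {v, u1, u2}" for x
        using that nu1 nu2 nv by (auto simp del: nb_iff)
      show "card (supp M - {v, u1, u2}) \<le> 5"
      proof -
        have "supp M - {v, u1, u2} \<subseteq> I" using supp_eq v by blast
        then have "card (supp M - {v, u1, u2}) \<le> card I" using I_S by (intro card_mono) auto
        then show ?thesis using cI L12 by linarith
      qed
      show "card (nb M x) \<le> 1" if x: "x \<notin> {v, u1, u2}" for x
      proof (cases "x \<in> supp M")
        case True
        then have xI: "x \<in> I" using x v supp_eq by blast
        have sub: "nb M x \<subseteq> I - {u1, u2, x}"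
        proof
          fix y assume y: "y \<in> nb M x"
          then have "y \<in> supp M" "y \<noteq> x" using nbM_supp[of x] by blast+
          moreover have "x \<in> nb M y" using M_sym[OF y] .
          then have "y \<noteq> v" "y \<noteq> u1" "y \<noteq> u2" using nv nu1 nu2 x by (auto simp del: nb_iff)
          ultimately show "y \<in> I - {u1, u2, x}" using supp_eq v by blast
        qed
        show ?thesis
        proof (cases "card L1 \<le> 3")
          case True
          have "card (nb M x) \<le> card (I - {u1, u2, x})" using sub I_S by (intro card_mono) auto
          also have "\<dots> = card I - 3" using I_S uI xI ne x by (simp add: card_Diff_subset)
          finally show ?thesis using cI True by linarith
        next
          case False
          then have l2: "card L2 \<le> 2" using L12 by blast
          show ?thesis
          proof (rule ccontr)
            assume "\<not> ?thesis"
            then have "x \<in> L2" using I_L2[OF xI] I_card[OF xI] by linarith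
            then have "card {x, u1, u2} \<le> card L2" using uL2 finL by (intro card_mono) auto
            then show False using l2 x ne by simp
          qed
        qed
      qed (simp add: nb_not_supp)
    qed
    then show ?thesis using re by blast
  next
    case noM: False
    show ?thesis
    proof (cases "card (nb M v) \<le> 1")
      case True
      have "fits S E"
      proof (rule fits_if_Nn_single)
        show "card Nn \<le> 2" using v by simp
        show N1: "card (nb M v') \<le> 1" if "v' \<in> Nn" for v' using that v True by simp
        assume L3: "card L1 \<le> 3"
        obtain u where u: "nb M v = {u}"
          using True J(2) fin_nbM[of v] by (metis card_0_eq card_1_singletonE le_neq_implies_less less_one)
        have uI: "u \<in> I" using u J by blast
        have vu: "v \<in> nb M u" by (rule M_sym) (simp only: u singletonI)
        \<comment> \<open>Three such vertices would be all of \<open>I\<close>. Following missing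
          pairs from \<open>v\<close> through \<open>u\<close> and \<open>w\<close>, the last vertex
          has only \<open>w\<close> as a possible partner.\<close>
        show "card {x. card (nb M x) = 2} \<le> 2"
        proof (rule ccontr)
          let ?T = "{x. card (nb M x) = 2}"
          assume c: "\<not> card ?T \<le> 2"
          have TI: "?T \<subseteq> I" using deg2_L2[OF N1] by blast
          have "card I \<le> card ?T" using c cI L3 by linarith
          then have TI: "?T = I" using TI I_S(3) card_seteq by blast
          have c3: "card I = 3" using c cI L3 unfolding TI by linarith
          have two: "card (nb M x) = 2" if "x \<in> I" for x using that TI by blast
          obtain w where w: "nb M u = {v, w}" "w \<noteq> v" using card_2_other[OF two[OF uI] vu] by blast
          have wu: "u \<in> nb M w" by (rule M_sym) (simp add: w del: nb_iff)
          have wI: "w \<in> I" "w \<noteq> u"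
          proof -
            have "w \<in> supp M - {u}" using nbM_supp[of u] w by blast
            then show "w \<in> I" "w \<noteq> u" using supp_eq v w by blast+
          qed
          have "card (I - {u, w}) = 1" using c3 uI wI I_S by (simp add: card_Diff_subset)
          then obtain w' where w': "I - {u, w} = {w'}" using card_1_singletonE by blast
          have w'I: "w' \<in> I" "w' \<noteq> u" "w' \<noteq> w" "w' \<noteq> v" using w' vI by blast+
          have "nb M w' \<subseteq> {w}"
          proof
            fix y assume y: "y \<in> nb M w'"
            then have "y \<in> supp M" "y \<noteq> w'" using nbM_supp[of w'] by blast+
            moreover have "w' \<in> nb M y" using M_sym[OF y] .
            then have "y \<noteq> v" "y \<noteq> u" using u w(1) w'I by (auto simp del: nb_iff)
            ultimately show "y \<in> {w}" using supp_eq(1) v w' by blast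
          qed
          then have "card (nb M w') \<le> 1" using card_mono[of "{w}" "nb M w'"] by simp
          then show False using two[OF w'I(1)] by simp
        qed
      qed
      then show ?thesis using re by blast
    next
      case False
      then have "2 \<le> card (nb M v)" by simp
      then obtain X where X: "X \<subseteq> nb M v" "card X = 2" using obtain_subset_with_card_n by metis
      then obtain u1 u2 where u: "u1 \<in> nb M v" "u2 \<in> nb M v" "u1 \<noteq> u2" by (auto simp: card_2_iff simp del: nb_iff)
      have "u2 \<notin> nb M u1" using noM u by blast
      moreover have "u1 \<in> I" "u2 \<in> I" using u J by blast+
      ultimately have o1: "card (nb E v - S) = 1"
        using star(2)[OF _ _ u(3) _ vN M_sym[OF u(1)] vN M_sym[OF u(2)]] by blast
      \<comment> \<open>One outer neighbour against two missing partners puts \<open>v\<close> below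
        degree \<open>r\<close>, so that \<open>supp M\<close> consists of low vertices
        only.\<close>
      have "d v < r" using card_nbM[OF vS] \<open>2 \<le> card (nb M v)\<close> unfolding o1 by linarith
      then have vL: "v \<in> L1" using vS unfolding L1_def by simp
      have "supp M \<subseteq> L1" unfolding supp_eq(1) v using vL I_L1 by simp
      then have sL: "card (supp M) \<le> card L1" using finL by (intro card_mono) auto
      show ?thesis
      proof (cases "card L1 \<le> 3")
        case True
        then have "fits S E" using sL by (intro fits_three[OF finS M_def]) simp
        then show ?thesis using re by blast
      next
        case F: False
        then have "card L1 \<le> 5" "card L2 \<le> 2" "4 \<le> card L1" using L12 by auto
        then show ?thesis using rewire_fits[OF v o1 \<open>2 \<le> card (nb M v)\<close>] by blast
      qed
    qed
  qed
qed

lemma fits_from_maximal: "\<exists>E'. realizes V d E' \<and> fits S E'"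
proof -
  consider "Nn = {}" | v where "Nn = {v}" | v1 v2 where "v1 \<in> Nn" "v2 \<in> Nn" "v1 \<noteq> v2" by blast
  then show ?thesis
  proof cases
    case 1
    then show ?thesis using fits_Nn_empty re by blast
  next
    case 2
    then show ?thesis by (rule fits_Nn_one)
  next
    case 3
    then show ?thesis using fits_Nn_two re by blast
  qed
qed

end

end

subsection \<open>The degree sum condition\<close>

text \<open>The claimed value for even \<open>n - r\<close>. The odd value is one less, so the
  threshold \<open>bound n r - 1\<close> serves both parities.\<close>

definition bound :: "int \<Rightarrow> int \<Rightarrow> int" where
  "bound n r = (r - 1) * (2 * n - r) - 3 * (n - r)"

lemma bound_eq: "bound n r = 2 * n * r - 5 * n - r * r + 4 * r"
  unfolding bound_def by (simp add: algebra_simps)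

locale top_set =
  fixes V S :: "nat set" and d :: "nat \<Rightarrow> nat" and E :: "nat set set" and r :: nat
  assumes re: "realizes V d E" and SV: "S \<subseteq> V" and cS: "card S = r + 1"
    and top: "\<And>s w. s \<in> S \<Longrightarrow> w \<in> V - S \<Longrightarrow> d w \<le> d s"
    and r4: "4 \<le> r" and n: "5 * r + 18 \<le> card V"
    and sum: "bound (int (card V)) (int r) - 1 \<le> (\<Sum>z\<in>V. int (d z))"
begin

lemmas rD = realizesD[OF re]

lemma finS: "finite S"
  using SV rD(2) finite_subset by blast

lemma sum3:
  assumes "V = H \<union> X \<union> Y" "H \<inter> X = {}" "(H \<union> X) \<inter> Y = {}"
    and "\<And>z. z \<in> H \<Longrightarrow> int (d z) \<le> a" "\<And>z. z \<in> X \<Longrightarrow> int (d z) \<le> b" "\<And>z. z \<in> Y \<Longrightarrow> int (d z) \<le> c"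
  shows "(\<Sum>z\<in>V. int (d z)) \<le> a * int (card H) + b * int (card X) + c * int (card Y)"
proof -
  have fin: "finite H" "finite X" "finite Y" using rD(2) assms(1) by auto
  have "(\<Sum>z\<in>V. int (d z)) = (\<Sum>z\<in>H. int (d z)) + (\<Sum>z\<in>X. int (d z)) + (\<Sum>z\<in>Y. int (d z))"
    unfolding assms(1) using fin assms(2,3) by (simp add: sum.union_disjoint)
  moreover have "(\<Sum>z\<in>H. int (d z)) \<le> (\<Sum>z\<in>H. a)" "(\<Sum>z\<in>X. int (d z)) \<le> (\<Sum>z\<in>X. b)"
    "(\<Sum>z\<in>Y. int (d z)) \<le> (\<Sum>z\<in>Y. c)"
    by (rule sum_mono, erule assms(4), rule sum_mono, erule assms(5), rule sum_mono, erule assms(6))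
  ultimately show ?thesis by (simp add: mult.commute)
qed

lemma d_le: "z \<in> V \<Longrightarrow> int (d z) \<le> int (card V) - 1"
proof -
  assume z: "z \<in> V"
  have "card (nb E z) \<le> card (V - {z})" using rD(5)[of z] rD(2) by (intro card_mono) auto
  then show ?thesis using rD(3)[OF z] z rD(2) n by simp
qed

text \<open>An Erdos-Gallai estimate for the \<open>r\<close> vertices of \<open>S\<close> other
  than \<open>s\<close>: they have at most \<open>r * (r - 1)\<close> edge ends among themselves,
  and each edge leaving them is paid for by a degree of at most \<open>r - 3\<close>
  outside.\<close>

lemma low: "s \<in> S \<Longrightarrow> r \<le> d s + 2"
proof (rule ccontr)
  assume s: "s \<in> S" and "\<not> r \<le> d s + 2"
  then have ds: "int (d s) \<le> int r - 3" by linarith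
  define H where "H = S - {s}"
  have H: "H \<subseteq> V" "finite H" "card H = r" using SV finS s cS unfolding H_def by auto
  have out: "int (d w) \<le> int r - 3" if "w \<in> V - H" for w
    using top[OF s, of w] ds that unfolding H_def by (cases "w = s") force+
  have "(\<Sum>z\<in>H. d z) \<le> (\<Sum>z\<in>H. (r - 1) + card (nb E z \<inter> (V - H)))"
  proof (rule sum_mono)
    fix z assume z: "z \<in> H"
    have "card (nb E z \<inter> H) \<le> card (H - {z})" using rD(5)[of z] H by (intro card_mono) auto
    moreover have "card (H - {z}) = r - 1" using H z by simp
    moreover have "card (nb E z) = card (nb E z \<inter> H) + card (nb E z - H)"
      using rD(4)[of z] by (rule card_Int_Diff)
    moreover have "nb E z - H = nb E z \<inter> (V - H)" using rD(5)[of z] by blast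
    moreover have "card (nb E z) = d z" using rD(3)[of z] z H by blast
    ultimately show "d z \<le> (r - 1) + card (nb E z \<inter> (V - H))" by simp
  qed
  also have "\<dots> = r * (r - 1) + (\<Sum>z\<in>V - H. card (nb E z \<inter> H))"
    unfolding sum.distrib using H rD(2) by (simp add: sum_card_nb_swap[of H "V - H"])
  also have "(\<Sum>z\<in>V - H. card (nb E z \<inter> H)) \<le> (\<Sum>z\<in>V - H. d z)"
  proof (rule sum_mono)
    fix z assume z: "z \<in> V - H"
    have "card (nb E z \<inter> H) \<le> card (nb E z)" using rD(4)[of z] by (intro card_mono) auto
    then show "card (nb E z \<inter> H) \<le> d z" using rD(3)[of z] z by simp
  qed
  finally have 1: "int (\<Sum>z\<in>H. d z) \<le> int (r * (r - 1)) + int (\<Sum>z\<in>V - H. d z)" by linarith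
  have "(\<Sum>z\<in>V - H. int (d z)) \<le> (\<Sum>z\<in>V - H. int r - 3)" using out by (rule sum_mono)
  also have "\<dots> = (int (card V) - int r) * (int r - 3)"
    using H rD(2) n by (simp add: card_Diff_subset of_nat_diff)
  finally have 2: "(\<Sum>z\<in>V - H. int (d z)) \<le> (int (card V) - int r) * (int r - 3)" .
  have "(\<Sum>z\<in>V. int (d z)) = (\<Sum>z\<in>V - H. int (d z)) + (\<Sum>z\<in>H. int (d z))"
    using H rD(2) by (intro sum.subset_diff) auto
  then have "(\<Sum>z\<in>V. int (d z)) \<le> int r * (int r - 1) + 2 * ((int (card V) - int r) * (int r - 3))"
    using 1 2 r4 by (simp add: of_nat_diff algebra_simps)
  then have "bound (int (card V)) (int r) - 1 \<le> int r * (int r - 1) + 2 * ((int (card V) - int r) * (int r - 3))"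
    using sum by linarith
  then have "int (card V) \<le> int r + 1" unfolding bound_eq by (simp add: algebra_simps)
  then show False using n by linarith
qed

text \<open>High vertices of \<open>S\<close> contribute at most \<open>n - 1\<close> each, and a
  low vertex of \<open>S\<close> also bounds every degree outside \<open>S\<close>. Six degrees
  below \<open>r\<close>, or three of at most \<open>r - 2\<close> and a fourth below
  \<open>r\<close>, make the sum too small.\<close>

lemma few_low:
  "card {s \<in> S. d s < r} \<le> 3 \<or> card {s \<in> S. d s < r} \<le> 5 \<and> card {s \<in> S. d s + 2 \<le> r} \<le> 2"
proof (rule ccontr)
  define L1 where "L1 = {s \<in> S. d s < r}"
  define L2 where "L2 = {s \<in> S. d s + 2 \<le> r}"
  have fin: "finite L1" "finite L2" using finS unfolding L1_def L2_def by auto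
  assume "\<not> ?thesis"
  then have "4 \<le> card L1" and c: "6 \<le> card L1 \<or> 3 \<le> card L2" unfolding L1_def L2_def by linarith+
  from c show False
  proof
    assume c6: "6 \<le> card L1"
    then obtain l where l: "l \<in> L1" by fastforce
    define H where "H = S - L1"
    have "H \<subseteq> V" using SV unfolding H_def by blast
    have cH: "card H = r + 1 - card L1" "card L1 \<le> r + 1"
      using finS cS card_mono[of S L1] unfolding H_def L1_def by (auto simp: card_Diff_subset)
    have "(\<Sum>z\<in>V. int (d z)) \<le> (int (card V) - 1) * int (card H) + 0 * int (card ({} :: nat set)) + (int r - 1) * int (card (V - H))"
    proof (rule sum3)
      show "int (d z) \<le> int r - 1" if "z \<in> V - H" for z
      proof (cases "z \<in> S")
        case True
        then show ?thesis using that unfolding H_def L1_def by auto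
      next
        case False
        then show ?thesis using top[of l z] l that unfolding L1_def by force
      qed
    qed (use \<open>H \<subseteq> V\<close> d_le in auto)
    also have "int (card (V - H)) = int (card V) - int (card H)"
      using \<open>H \<subseteq> V\<close> rD(2) by (simp add: card_Diff_subset card_mono finite_subset of_nat_diff)
    finally have 1: "(\<Sum>z\<in>V. int (d z)) \<le> int (card H) * (int (card V) - int r) + int (card V) * (int r - 1)"
      by (simp add: algebra_simps)
    have "int (card H) * (int (card V) - int r) \<le> (int r - 5) * (int (card V) - int r)"
      using cH c6 n by (intro mult_right_mono) auto
    then have "bound (int (card V)) (int r) - 1 \<le> (int r - 5) * (int (card V) - int r) + int (card V) * (int r - 1)"
      using 1 sum by linarith
    then have "int (card V) \<le> int r + 1" unfolding bound_eq by (simp add: algebra_simps)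
    then show False using n by linarith
  next
    assume "3 \<le> card L2"
    then obtain X where X: "X \<subseteq> L2" "card X = 3" using obtain_subset_with_card_n by metis
    have fX: "finite X" using X fin finite_subset by blast
    have "card (L1 - X) \<noteq> 0" using \<open>4 \<le> card L1\<close> X fX diff_card_le_card_Diff[OF fX, of L1] by linarith
    then have "L1 - X \<noteq> {}" by (metis card.empty)
    then obtain b where b: "b \<in> L1" "b \<notin> X" by blast
    obtain l where l: "l \<in> X" using X by fastforce
    have XS: "X \<subseteq> S" "b \<in> S" "l \<in> S" using X b l unfolding L1_def L2_def by blast+
    define H where "H = S - insert b X"
    have HV: "H \<subseteq> V" "b \<in> V" "b \<notin> H" using SV XS unfolding H_def by blast+
    have ciX: "card (insert b X) = 4" using b X fX by simp
    have cH: "card H = r - 3" unfolding H_def using XS fX ciX cS by (simp add: card_Diff_subset)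
    have "(\<Sum>z\<in>V. int (d z)) \<le> (int (card V) - 1) * int (card H) + (int r - 1) * int (card {b}) + (int r - 2) * int (card (V - insert b H))"
    proof (rule sum3)
      show "int (d z) \<le> int r - 2" if "z \<in> V - insert b H" for z
      proof (cases "z \<in> S")
        case True
        then have "z \<in> X" using that unfolding H_def by blast
        then show ?thesis using X unfolding L2_def by force
      next
        case False
        then show ?thesis using top[of l z] l XS X that unfolding L2_def by force
      qed
      show "int (d z) \<le> int r - 1" if "z \<in> {b}" for z using that b unfolding L1_def by auto
    qed (use HV d_le in auto)
    also have "int (card (V - insert b H)) = int (card V) - int r + 2"
    proof -
      have fH: "finite H" using HV rD(2) finite_subset by blast
      have "card (insert b H) = r - 2" using cH HV fH r4 by simp
      moreover have "insert b H \<subseteq> V" using HV by blast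
      ultimately have "card (V - insert b H) = card V - (r - 2)" using fH by (simp add: card_Diff_subset)
      then show ?thesis using n r4 by (simp add: of_nat_diff)
    qed
    finally have "(\<Sum>z\<in>V. int (d z)) \<le> (int (card V) - 1) * (int r - 3) + (int r - 1) + (int r - 2) * (int (card V) - int r + 2)"
      using cH r4 by (simp add: of_nat_diff)
    then have "bound (int (card V)) (int r) - 1 \<le> (int (card V) - 1) * (int r - 3) + (int r - 1) + (int r - 2) * (int (card V) - int r + 2)"
      using sum by linarith
    \<comment> \<open>The right-hand side is exactly \<open>bound - 2\<close>, one less than
      required.\<close>
    then show False unfolding bound_eq by (simp add: algebra_simps)
  qed
qed

lemma maximal_exists:
  "\<exists>E. realizes V d E \<and> (\<forall>E'. realizes V d E' \<longrightarrow> inner_edges S E' \<le> inner_edges S E)"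
proof (rule ex_has_greatest_nat[of "realizes V d" E "inner_edges S" "Suc (card (Pow V))"])
  show "\<forall>E'. realizes V d E' \<longrightarrow> inner_edges S E' < Suc (card (Pow V))"
  proof (intro allI impI)
    fix E' assume "realizes V d E'"
    have "{e \<in> E'. e \<subseteq> S} \<subseteq> Pow V" using SV by blast
    then have "card {e \<in> E'. e \<subseteq> S} \<le> card (Pow V)" using rD(2) by (intro card_mono) auto
    then show "inner_edges S E' < Suc (card (Pow V))" unfolding inner_edges_def by simp
  qed
qed (rule re)

lemma flat_placeable:
  assumes s0: "s0 \<in> S" "\<And>s. s \<in> S \<Longrightarrow> d s0 \<le> d s" and D: "\<And>z. z \<in> V \<Longrightarrow> d z \<le> D"
    and flat: "D + 2 \<le> card {z \<in> V. d s0 \<le> d z}"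
  shows "placeable V d (r + 1)"
proof (rule ccontr)
  assume np: "\<not> placeable V d (r + 1)"
  \<comment> \<open>Of at least \<open>D + 2\<close> vertices with degree \<open>d s0\<close> or
    more, \<open>r + 1\<close> lie in \<open>S\<close>; the others have degree exactly
    \<open>d s0\<close>, since \<open>S\<close> is on top.\<close>
  have W: "int (d s0) + (int D - int (d s0)) + 1 - int r \<le> int (card {w \<in> V - S. int (d w) = int (d s0)})"
  proof -
    have "{z \<in> V. d s0 \<le> d z} \<subseteq> S \<union> {w \<in> V - S. int (d w) = int (d s0)}"
      using top[OF s0(1)] by force
    then have "card {z \<in> V. d s0 \<le> d z} \<le> card (S \<union> {w \<in> V - S. int (d w) = int (d s0)})"
      using finS rD(2) by (intro card_mono) auto
    also have "\<dots> \<le> card S + card {w \<in> V - S. int (d w) = int (d s0)}" by (rule card_Un_le)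
    finally show ?thesis using flat cS by linarith
  qed
  have K: "nb E u \<subseteq> S \<or> nb E v \<subseteq> S"
    if E: "realizes V d E" "\<And>E'. realizes V d E' \<Longrightarrow> inner_edges S E' \<le> inner_edges S E"
      and uv: "u \<in> S" "v \<in> S" "u \<noteq> v" "{u, v} \<notin> E" for E u v
  proof (rule ccontr)
    assume nn: "\<not> ?thesis"
    interpret mp: missing_pair V S d E u v by unfold_locales (use E uv SV in auto)
    interpret sw: missing_pair V S d E v u by (rule mp.swapped)
    have r1: "1 \<le> r" using r4 by simp
    \<comment> \<open>One of the two outer neighbourhoods is a clique; on that side a degree of
      \<open>2 * r - 1\<close> would already give a complete graph on \<open>r + 1\<close>
      vertices.\<close>
    have "\<not> 2 * r - 1 \<le> d u \<or> \<not> 2 * r - 1 \<le> d v"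
      using mp.outer_clique mp.placeable_if_clique[OF _ cS _ r1] sw.placeable_if_clique[OF _ cS _ r1] np by blast
    then have dm: "int (d s0) \<le> 2 * int r - 2" using s0(2)[OF uv(1)] s0(2)[OF uv(2)] by linarith
    have lo0: "int r - 2 \<le> int (d s0)" using low[OF s0(1)] by linarith
    have "\<exists>co cs. 0 \<le> co \<and> 0 \<le> cs \<and> int (d s0) + (int D - int (d s0)) + 1 - int r \<le> co \<and>
      co + cs \<le> int (d s0) + 1 \<and> int (d s0) + (int D - int (d s0)) + 1 - int r \<le> int (d s0) \<and>
      (\<Sum>z\<in>V. int (d z)) \<le> (int r + 1) * (int (d s0) + (int D - int (d s0))) + (int (d s0) + int r - 1) * co
        + ((int D - int (d s0)) + int r - 1) * cs + 2 * (int (d s0) - 1) * (int (d s0) + 1 - co - cs)"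
    proof (rule mp.degree_sum_bound)
      show "int (card S) = int r + 1" using cS by simp
      show "nb E u - S \<noteq> {}" "nb E v - S \<noteq> {}" using nn by blast+
      show "int (d s0) \<le> int (d s)" if "s \<in> S" for s using s0(2)[OF that] by simp
      show "int (d w) \<le> int (d s0)" if "w \<in> V - S" for w using top[OF s0(1) that] by simp
      show "int (d z) \<le> int (d s0) + (int D - int (d s0))" if "z \<in> V" for z using D[OF that] by simp
    qed (use W r4 lo0 in auto)
    then obtain co cs where c: "0 \<le> co" "0 \<le> cs" "int (d s0) + (int D - int (d s0)) + 1 - int r \<le> co"
      "co + cs \<le> int (d s0) + 1" "int (d s0) + (int D - int (d s0)) + 1 - int r \<le> int (d s0)"
      "(\<Sum>z\<in>V. int (d z)) \<le> (int r + 1) * (int (d s0) + (int D - int (d s0))) + (int (d s0) + int r - 1) * co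
        + ((int D - int (d s0)) + int r - 1) * cs + 2 * (int (d s0) - 1) * (int (d s0) + 1 - co - cs)"
      by blast
    have "0 \<le> int D - int (d s0)" using D[of s0] s0 SV by auto
    moreover have "5 * int r + 18 \<le> int (card V)" using n by linarith
    ultimately show False
      using flat_count_absurd[OF _ _ lo0 dm _ sum[unfolded bound_eq] c] r4 by simp
  qed
  interpret cleared_top V S d r
    by unfold_locales (use SV rD(2) cS K low few_low in auto)
  obtain E1 where E1: "realizes V d E1" "\<And>E'. realizes V d E' \<Longrightarrow> inner_edges S E' \<le> inner_edges S E1"
    using maximal_exists by blast
  obtain E2 where "realizes V d E2" "fits S E2" using fits_from_maximal[OF E1 refl] by blast
  then show False using np SV cS unfolding placeable_def by blast
qed

lemma step_placeable:
  assumes IH: "\<And>V' d' E'. realizes V' d' E' \<Longrightarrow> 5 * (r - 1) + 18 \<le> card V' \<Longrightarrow>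
      bound (int (card V')) (int r - 1) - 1 \<le> (\<Sum>z\<in>V'. int (d' z)) \<Longrightarrow> placeable V' d' r"
  shows "placeable V d (r + 1)"
proof -
  have Sne: "S \<noteq> {}" using cS by auto
  have "Min (d ` S) \<in> d ` S" using finS Sne by (intro Min_in) auto
  then obtain s0 where s0: "s0 \<in> S" "d s0 = Min (d ` S)" by auto
  then have s0min: "\<And>s. s \<in> S \<Longrightarrow> d s0 \<le> d s" using finS by simp
  have "Max (d ` S) \<in> d ` S" using finS Sne by (intro Max_in) auto
  then obtain v where v: "v \<in> S" "d v = Max (d ` S)" by auto
  then have vmax: "d s \<le> d v" if "s \<in> S" for s using finS that by simp
  have vmaxV: "d z \<le> d v" if "z \<in> V" for z
    using vmax[of z] top[OF v(1), of z] that by (cases "z \<in> S") auto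
  have vV: "v \<in> V" using v SV by blast
  show ?thesis
  proof (cases "d v + 2 \<le> card {z \<in> V. d s0 \<le> d z}")
    case True
    then show ?thesis using flat_placeable[OF s0(1) s0min vmaxV] by blast
  next
    case False
    \<comment> \<open>Besides \<open>v\<close> at most \<open>d v\<close> vertices have degree
      \<open>d s0\<close> or more, so all of them can become neighbours of \<open>v\<close>, ties
      included.\<close>
    define Q where "Q = {z \<in> V. d s0 \<le> d z} - {v}"
    have vQ: "v \<in> {z \<in> V. d s0 \<le> d z}" using vV s0min[OF v(1)] by simp
    have cQ: "card Q \<le> d v" using False vQ rD(2) unfolding Q_def by simp
    have "\<exists>E'. realizes V d E' \<and> Q \<subseteq> nb E' v"
      by (rule havel_hakimi[OF re vV _ cQ]) (auto simp: Q_def)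
    then obtain E1 where E1: "realizes V d E1" "Q \<subseteq> nb E1 v" by blast
    define N where "N = nb E1 v"
    define d' where "d' z = d z - of_bool (z \<in> N)" for z
    note r1D = realizesD[OF E1(1)]
    have del: "realizes (V - {v}) d' {e \<in> E1. v \<notin> e}"
      using realizes_delete[OF E1(1) vV] unfolding d'_def N_def .
    have cV': "int (card (V - {v})) = int (card V) - 1" using vV rD(2) n by simp
    have sum': "(\<Sum>z\<in>V - {v}. int (d' z)) = (\<Sum>z\<in>V. int (d z)) - 2 * int (d v)"
      unfolding d'_def N_def by (rule sum_delete[OF E1(1) vV])
    have "placeable (V - {v}) d' r"
    proof (rule IH[OF del])
      show "5 * (r - 1) + 18 \<le> card (V - {v})" using cV' n r4 by linarith
      have "bound (int (card V)) (int r) = bound (int (card V) - 1) (int r - 1) + 2 * int (card V) - 2"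
        unfolding bound_eq by (simp add: algebra_simps)
      then show "bound (int (card (V - {v}))) (int r - 1) - 1 \<le> (\<Sum>z\<in>V - {v}. int (d' z))"
        unfolding sum' cV' using sum d_le[OF vV] by linarith
    qed
    then obtain E2 T where E2: "realizes (V - {v}) d' E2" "T \<subseteq> V - {v}" "card T = r" "fits T E2"
      unfolding placeable_def by blast
    have SQ: "S - {v} \<subseteq> Q" using s0min SV unfolding Q_def by blast
    have cS': "card (S - {v}) = r" using v cS finS by simp
    have "\<exists>E'. realizes (V - {v}) d' E' \<and> fits (S - {v}) E'"
    proof (rule fits_move_to_top[OF E2(1,2,4)])
      show "S - {v} \<subseteq> V - {v}" using SV by blast
      show "card T = card (S - {v})" using E2 cS' by simp
      fix s w assume s: "s \<in> S - {v}" and w: "w \<in> V - {v} - (S - {v})"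
      have sN: "s \<in> N" using s SQ E1 unfolding N_def by blast
      have wS: "w \<in> V - S" using w v by blast
      \<comment> \<open>Every vertex of degree at least \<open>d s0\<close> has lost one, so a
        vertex of smaller degree can at most draw level with \<open>s\<close>.\<close>
      show "d' w \<le> d' s"
      proof (cases "d s0 \<le> d w")
        case True
        then have "w \<in> Q" using w unfolding Q_def by blast
        then have "w \<in> N" using E1 unfolding N_def by blast
        then show ?thesis using sN top[of s w] s wS unfolding d'_def by simp
      next
        case False
        then show ?thesis using sN s0min[of s] s unfolding d'_def by simp
      qed
    qed
    then obtain E3 where E3: "realizes (V - {v}) d' E3" "fits (S - {v}) E3" by blast
    define E4 where "E4 = E3 \<union> (\<lambda>z. {v, z}) ` N"
    have re4: "realizes V d E4" unfolding E4_def
    proof (rule realizes_add_vertex[OF _ vV])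
      show "realizes (V - {v}) (\<lambda>z. d z - of_bool (z \<in> N)) E3" using E3(1) unfolding d'_def .
      show "N \<subseteq> V - {v}" "card N = d v" using r1D(5)[of v] r1D(3)[OF vV] unfolding N_def by blast+
      show "0 < d z" if "z \<in> N" for z
      proof -
        have "{z, v} \<in> E1" using that unfolding N_def by (simp add: insert_commute)
        then show ?thesis using realizes_pos[OF E1(1)] by blast
      qed
    qed
    obtain f where f: "inj_on f (S - {v})"
      "\<And>x y. x \<in> S - {v} \<Longrightarrow> y \<in> S - {v} \<Longrightarrow> x \<noteq> y \<Longrightarrow> {x, y} \<notin> E3 \<Longrightarrow> {f x, f y} \<in> snd K3_union_P3"
      using E3(2) unfolding fits_def by blast
    obtain m where m: "m \<notin> f ` (S - {v})"
      using ex_new_if_finite[OF infinite_UNIV_nat, of "f ` (S - {v})"] finS by blast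
    define g where "g = f(v := m)"
    have "fits S E4" unfolding fits_def
    proof (intro exI[of _ g] conjI ballI impI)
      show "inj_on g S" using f(1) m unfolding g_def inj_on_def by (auto simp: image_iff)
      fix x y assume xy: "x \<in> S" "y \<in> S" "x \<noteq> y" "{x, y} \<notin> E4"
      have vN: "{v, z} \<in> E4" if "z \<in> S - {v}" for z
      proof -
        have "z \<in> N" using that SQ E1 unfolding N_def by blast
        then show ?thesis unfolding E4_def by simp
      qed
      have "x \<noteq> v" using vN[of y] xy by auto
      moreover have "y \<noteq> v" using vN[of x] xy by (auto simp: insert_commute)
      moreover have "{x, y} \<notin> E3" using xy unfolding E4_def by blast
      ultimately show "{g x, g y} \<in> snd K3_union_P3" using f(2)[of x y] xy unfolding g_def by simp
    qed
    then show ?thesis unfolding placeable_def using re4 SV cS by blast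
  qed
qed

end

section \<open>The induction on \<open>r\<close>\<close>

theorem degree_sum_placeable:
  assumes "3 \<le> r" "realizes V d E" "5 * r + 18 \<le> card V" "bound (int (card V)) (int r) - 1 \<le> (\<Sum>z\<in>V. int (d z))"
  shows "placeable V d (r + 1)"
  using assms
proof (induction r arbitrary: V d E rule: dec_induct)
  case base
  have "card V + 2 \<le> (\<Sum>z\<in>V. d z)"
  proof -
    have "int (card V) + 2 \<le> int (\<Sum>z\<in>V. d z)" using base unfolding bound_eq by simp
    then show ?thesis by linarith
  qed
  then show ?case using placeable_base[OF base(1)] base(2) by (simp add: numeral_eq_Suc)
next
  case (step r)
  have fV: "finite V" using realizesD(2)[OF step.prems(1)] .
  obtain S where S: "S \<subseteq> V" "card S = Suc r + 1" "\<And>s w. s \<in> S \<Longrightarrow> w \<in> V - S \<Longrightarrow> d w \<le> d s"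
    using top_set_exists[OF fV, of "Suc r + 1" d] step.prems by auto
  interpret top_set V S d E "Suc r"
    by unfold_locales (use step S in auto)
  show ?case
  proof (rule step_placeable)
    fix V' d' E'
    assume "realizes V' d' E'" "5 * (Suc r - 1) + 18 \<le> card V'"
      "bound (int (card V')) (int (Suc r) - 1) - 1 \<le> (\<Sum>z\<in>V'. int (d' z))"
    then show "placeable V' d' (Suc r)" using step.IH[of V' d' E'] by simp
  qed
qed

subsection \<open>From placed configurations to subgraphs\<close>

lemma K3_union_P3_less: "{a, b} \<in> snd K3_union_P3 \<Longrightarrow> a < 7 \<and> b < 7"
  unfolding K3_union_P3_def by (auto simp: doubleton_eq_iff)

lemma fst_K3_union_P3: "fst K3_union_P3 = {0..<7}"
  by (simp add: K3_union_P3_def)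

lemma fst_complete_minus: "fst (complete_minus m EU) = {0..<m}"
  by (simp add: complete_minus_def)

lemma complete_minus_edge:
  "{i, j} \<in> snd (complete_minus m EU) \<longleftrightarrow> i < m \<and> j < m \<and> i \<noteq> j \<and> {i, j} \<notin> EU"
  unfolding complete_minus_def by (auto simp: doubleton_eq_iff)

text \<open>\<open>f\<close> sends missing pairs of \<open>T\<close> into
  \<open>K3_union_P3\<close>, and \<open>h\<close> sends them on into \<open>U\<close>. The inverse
  of a bijection from \<open>T\<close> onto \<open>{0..<m}\<close> extending this composition maps
  every pair outside \<open>U\<close> to an edge.\<close>

lemma contains_complete_minus:
  assumes fit: "fits T E" and T: "T \<subseteq> V" "card T = m" "finite T" and km: "k \<le> m"
    and U: "contains_subgraph ({0..<k}, EU) K3_union_P3"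
  shows "contains_subgraph (V, E) (complete_minus m EU)"
proof -
  obtain f where f: "inj_on f T"
    "\<And>x y. x \<in> T \<Longrightarrow> y \<in> T \<Longrightarrow> x \<noteq> y \<Longrightarrow> {x, y} \<notin> E \<Longrightarrow> {f x, f y} \<in> snd K3_union_P3"
    using fit unfolding fits_def by blast
  obtain h where h: "inj_on h {0..<7}" "h ` {0..<7} \<subseteq> {0..<k}"
    "\<And>u v. {u, v} \<in> snd K3_union_P3 \<Longrightarrow> {h u, h v} \<in> EU"
    using U unfolding contains_subgraph_def fst_conv snd_conv fst_K3_union_P3 by blast
  \<comment> \<open>Only vertices with \<open>f t < 7\<close> can lie in missing pairs; the others
    are distributed arbitrarily by \<open>psi\<close>.\<close>
  define T' where "T' = {t \<in> T. f t < 7}"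
  have T': "T' \<subseteq> T" "finite T'" using T unfolding T'_def by auto
  have inj0: "inj_on (h \<circ> f) T'"
    using f(1) h(1) unfolding inj_on_def T'_def by auto
  have im0: "(h \<circ> f) ` T' \<subseteq> {0..<m}" using h(2) km unfolding T'_def by fastforce
  have "card (T - T') = card ({0..<m} - (h \<circ> f) ` T')"
    using T T' im0 card_image[OF inj0] by (simp add: card_Diff_subset)
  then obtain psi where psi: "bij_betw psi (T - T') ({0..<m} - (h \<circ> f) ` T')"
    using finite_same_card_bij[of "T - T'" "{0..<m} - (h \<circ> f) ` T'"] T by auto
  define phi where "phi x = (if x \<in> T' then (h \<circ> f) x else psi x)" for x
  have "bij_betw phi (T' \<union> (T - T')) ((h \<circ> f) ` T' \<union> ({0..<m} - (h \<circ> f) ` T'))"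
  proof (rule bij_betw_combine)
    show "bij_betw phi T' ((h \<circ> f) ` T')"
      using inj0 by (auto simp: bij_betw_def phi_def inj_on_def)
    show "bij_betw phi (T - T') ({0..<m} - (h \<circ> f) ` T')"
      using psi by (subst bij_betw_cong[of _ _ psi]) (auto simp: phi_def)
  qed auto
  moreover have "T' \<union> (T - T') = T" "(h \<circ> f) ` T' \<union> ({0..<m} - (h \<circ> f) ` T') = {0..<m}"
    using T' im0 by blast+
  ultimately have phi: "bij_betw phi T {0..<m}" by simp
  define g where "g = inv_into T phi"
  have g: "bij_betw g {0..<m} T" unfolding g_def using phi by (rule bij_betw_inv_into)
  have pg: "phi (g i) = i" if "i < m" for i
    unfolding g_def using phi that by (intro bij_betw_inv_into_right) auto
  have gT: "g i \<in> T" if "i < m" for i using g that by (auto simp: bij_betw_def)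
  have "{g i, g j} \<in> E" if ij: "{i, j} \<in> snd (complete_minus m EU)" for i j
  proof (rule ccontr)
    assume nE: "{g i, g j} \<notin> E"
    have lt: "i < m" "j < m" "i \<noteq> j" "{i, j} \<notin> EU" using ij by (simp_all add: complete_minus_edge)
    have "g i \<noteq> g j" using pg lt by metis
    then have e: "{f (g i), f (g j)} \<in> snd K3_union_P3" using f(2) gT lt nE by blast
    then have "f (g i) < 7" "f (g j) < 7" using K3_union_P3_less by blast+
    then have "phi (g i) = h (f (g i))" "phi (g j) = h (f (g j))"
      using gT lt unfolding phi_def T'_def by simp_all
    then have "{i, j} \<in> EU" using h(3)[OF e] pg lt by simp
    then show False using lt by simp
  qed
  moreover have "inj_on g {0..<m}" "g ` {0..<m} \<subseteq> V" using g T unfolding bij_betw_def by auto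
  ultimately show ?thesis
    unfolding contains_subgraph_def fst_conv snd_conv fst_complete_minus by blast
qed

text \<open>The cycle is \<open>a c b e\<close>: the arguments are arranged so that
  \<open>{a, b}\<close> and \<open>{c, e}\<close> are its diagonals, the pairs that need not be
  edges of \<open>U\<close>.\<close>

lemma contains_C4I:
  assumes sg: "simple_graph {0..<k} EU"
    and e: "{a, c} \<in> EU" "{c, b} \<in> EU" "{b, e} \<in> EU" "{e, a} \<in> EU" and dist: "distinct [a, b, c, e]"
  shows "contains_subgraph ({0..<k}, EU) C4"
proof -
  define f where "f i = [a, c, b, e] ! i" for i
  have v: "f 0 = a" "f 1 = c" "f (Suc 0) = c" "f 2 = b" "f 3 = e" by (simp_all add: f_def)
  have 4: "{0..<4} = {0, 1, 2, 3::nat}" by auto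
  have "inj_on f {0, 1, 2, 3}" using dist by (simp add: v)
  moreover have "f ` {0, 1, 2, 3} \<subseteq> {0..<k}"
    using simple_graph_edgeD[OF sg e(1)] simple_graph_edgeD[OF sg e(3)] by (simp add: v)
  moreover have "{f x, f y} \<in> EU" if "{x, y} \<in> snd C4" for x y
  proof -
    have "{x, y} = {0, 1} \<or> {x, y} = {1, 2} \<or> {x, y} = {2, 3} \<or> {x, y} = {3, 0}"
      using that by (simp add: C4_def)
    then have "f ` {x, y} \<in> {f ` {0, 1}, f ` {1, 2}, f ` {2, 3}, f ` {3, 0}}" by (elim disjE) simp_all
    then have "{f x, f y} = {a, c} \<or> {f x, f y} = {c, b} \<or> {f x, f y} = {b, e} \<or> {f x, f y} = {e, a}"
      by (simp add: v)
    then show ?thesis using e by (elim disjE) simp_all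
  qed
  moreover have "fst C4 = {0, 1, 2, 3}" unfolding C4_def 4 by simp
  ultimately show ?thesis unfolding contains_subgraph_def by (intro exI[of _ f]) simp
qed

lemma contains_Z4I:
  assumes sg: "simple_graph {0..<k} EU"
    and e: "{a, b} \<in> EU" "{b, c} \<in> EU" "{a, c} \<in> EU" "{c, e} \<in> EU" and dist: "distinct [a, b, c, e]"
  shows "contains_subgraph ({0..<k}, EU) Z4"
proof -
  define f where "f i = [a, b, c, e] ! i" for i
  have v: "f 0 = a" "f 1 = b" "f (Suc 0) = b" "f 2 = c" "f 3 = e" by (simp_all add: f_def)
  have 4: "{0..<4} = {0, 1, 2, 3::nat}" by auto
  have "inj_on f {0, 1, 2, 3}" using dist by (simp add: v)
  moreover have "f ` {0, 1, 2, 3} \<subseteq> {0..<k}"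
    using simple_graph_edgeD[OF sg e(1)] simple_graph_edgeD[OF sg e(4)] by (simp add: v)
  moreover have "{f x, f y} \<in> EU" if "{x, y} \<in> snd Z4" for x y
  proof -
    have "{x, y} = {0, 1} \<or> {x, y} = {1, 2} \<or> {x, y} = {0, 2} \<or> {x, y} = {2, 3}"
      using that by (simp add: Z4_def)
    then have "f ` {x, y} \<in> {f ` {0, 1}, f ` {1, 2}, f ` {0, 2}, f ` {2, 3}}" by (elim disjE) simp_all
    then have "{f x, f y} = {a, b} \<or> {f x, f y} = {b, c} \<or> {f x, f y} = {a, c} \<or> {f x, f y} = {c, e}"
      by (simp add: v)
    then show ?thesis using e by (elim disjE) simp_all
  qed
  moreover have "fst Z4 = {0, 1, 2, 3}" unfolding Z4_def 4 by simp
  ultimately show ?thesis unfolding contains_subgraph_def by (intro exI[of _ f]) simp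
qed

subsection \<open>The extremal sequence\<close>

text \<open>\<open>q\<close> is the size \<open>r - 3\<close> of the hub. If an odd number of
  vertices remains, vertex \<open>q\<close> is the middle of the path with two edges.\<close>

definition extremal_degree :: "nat \<Rightarrow> nat \<Rightarrow> nat \<Rightarrow> nat" where
  "extremal_degree n q i = (if i < q then n - 1 else q + 1 + of_bool (i = q \<and> odd (n - q)))"

text \<open>Edges outside the hub, listed in one orientation. In the odd case the path
  \<open>q + 1\<close>, \<open>q\<close>, \<open>q + 2\<close> takes three vertices, so the matching
  starts at \<open>q + 3\<close>, at odd distance from \<open>q\<close>.\<close>

definition rest_pair :: "nat \<Rightarrow> nat \<Rightarrow> nat \<Rightarrow> nat \<Rightarrow> bool" where
  "rest_pair n q i j \<longleftrightarrow> j < n \<and>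
     (if even (n - q) then q \<le> i \<and> j = i + 1 \<and> even (i - q)
      else i = q \<and> (j = q + 1 \<or> j = q + 2) \<or> q + 3 \<le> i \<and> j = i + 1 \<and> odd (i - q))"

definition extremal_graph :: "nat \<Rightarrow> nat \<Rightarrow> nat set set" where
  "extremal_graph n q = {e. e \<subseteq> {0..<n} \<and> card e = 2 \<and>
     (\<exists>i\<in>e. i < q \<or> (\<exists>j\<in>e. rest_pair n q i j))}"

lemma extremal_graph_iff:
  "{x, y} \<in> extremal_graph n q \<longleftrightarrow> x < n \<and> y < n \<and> x \<noteq> y \<and>
     (x < q \<or> y < q \<or> rest_pair n q x y \<or> rest_pair n q y x)"
proof -
  have "\<not> rest_pair n q x x" for x unfolding rest_pair_def by auto
  then show ?thesis unfolding extremal_graph_def by (cases "x = y") auto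
qed

lemma realizes_extremal:
  assumes "q + 3 \<le> n"
  shows "realizes {0..<n} (extremal_degree n q) (extremal_graph n q)"
proof -
  have sg: "simple_graph {0..<n} (extremal_graph n q)"
    unfolding simple_graph_iff extremal_graph_def by simp
  have "degree (extremal_graph n q) x = extremal_degree n q x" if x: "x < n" for x
  proof (cases "x < q")
    case True
    then have "nb (extremal_graph n q) x = {0..<n} - {x}"
      using x unfolding set_eq_iff nb_iff extremal_graph_iff by auto
    then show ?thesis using True x by (simp add: degree_nb extremal_degree_def)
  next
    case False
    have eq: "nb (extremal_graph n q) x = {0..<q} \<union> {y. y < n \<and> q \<le> y \<and> y \<noteq> x \<and> (rest_pair n q x y \<or> rest_pair n q y x)}"
      using x False assms unfolding set_eq_iff nb_iff extremal_graph_iff by auto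
    define Y where "Y = {y. y < n \<and> q \<le> y \<and> y \<noteq> x \<and> (rest_pair n q x y \<or> rest_pair n q y x)}"
    have "card Y = 1 + of_bool (x = q \<and> odd (n - q))"
    proof (cases "even (n - q)")
      case True
      have "Y = {if even (x - q) then x + 1 else x - 1}"
        unfolding Y_def rest_pair_def using True x False assms by (auto; presburger)
      then show ?thesis using True by simp
    next
      case odd: False
      consider "x = q" | "x = q + 1" | "x = q + 2" | "q + 3 \<le> x" using False by linarith
      then show ?thesis
      proof cases
        case 1
        then have "Y = {q + 1, q + 2}" unfolding Y_def rest_pair_def using odd assms by auto
        then show ?thesis using 1 odd by simp
      next
        case 2
        then have "Y = {q}" unfolding Y_def rest_pair_def using odd x by auto
        then show ?thesis using 2 by simp
      next
        case 3
        then have "Y = {q}" unfolding Y_def rest_pair_def using odd x by auto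
        then show ?thesis using 3 by simp
      next
        case 4
        then have "Y = {if odd (x - q) then x + 1 else x - 1}"
          unfolding Y_def rest_pair_def using odd x assms by (auto; presburger)
        then show ?thesis using 4 by simp
      qed
    qed
    moreover have "finite Y" unfolding Y_def by simp
    moreover have "{0..<q} \<inter> Y = {}" unfolding Y_def by auto
    ultimately show ?thesis
      unfolding degree_nb eq Y_def[symmetric] using False by (simp add: card_Un_disjoint extremal_degree_def)
  qed
  then show ?thesis using sg unfolding realizes_def by simp
qed

text \<open>Among four vertices outside the hub, adjacency is a matching or a path with two edges
  centred at \<open>q\<close>, and all non-adjacent pairs must belong to \<open>U\<close>. The
  complement of a matching on four vertices contains a cycle; that of the path with an isolated
  vertex is \<open>Z4\<close>.\<close>

lemma extremal_not_contains:
  assumes E: "realizes {0..<n} (extremal_degree n q) E" and n: "q + 3 \<le> n"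
    and sg: "simple_graph {0..<k} EU"
    and con: "contains_subgraph ({0..<n}, E) (complete_minus (q + 4) EU)"
  shows "contains_subgraph ({0..<k}, EU) C4 \<or> contains_subgraph ({0..<k}, EU) Z4"
proof -
  note rD = realizesD[OF E]
  obtain f where f: "inj_on f {0..<q+4}" "f ` {0..<q+4} \<subseteq> {0..<n}"
    "\<And>i j. {i, j} \<in> snd (complete_minus (q + 4) EU) \<Longrightarrow> {f i, f j} \<in> E"
    using con unfolding contains_subgraph_def fst_conv snd_conv fst_complete_minus by blast
  define P where "P = {p \<in> {0..<q+4}. q \<le> f p}"
  have "4 \<le> card P"
  proof -
    have "card ({0..<q+4} - P) \<le> card {0..<q}"
    proof (rule card_inj_on_le[of f])
      show "inj_on f ({0..<q+4} - P)" using f(1) by (rule inj_on_subset) blast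
    qed (auto simp: P_def)
    moreover have "card ({0..<q+4} - P) = q + 4 - card P"
      unfolding P_def by (subst card_Diff_subset) auto
    ultimately show ?thesis by simp
  qed
  then obtain X where X: "X \<subseteq> P" "card X = 4" using obtain_subset_with_card_n by metis
  have hub: "nb E i = {0..<n} - {i}" if "i < q" for i
  proof -
    have "card (nb E i) = n - 1" using rD(3)[of i] that n by (simp add: extremal_degree_def)
    then show ?thesis using rD(5)[of i] that n by (intro card_subset_eq) auto
  qed
  define adj where "adj a b \<longleftrightarrow> {f a, f b} \<in> E" for a b
  have fX: "f a < n" "q \<le> f a" "a < q + 4" if "a \<in> X" for a
  proof -
    have "a \<in> P" using that X by blast
    then show "q \<le> f a" "a < q + 4" unfolding P_def by simp_all
    then have "f a \<in> f ` {0..<q+4}" by simp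
    then show "f a < n" using f(2) by auto
  qed
  have injX: "f a = f b \<longleftrightarrow> a = b" if "a \<in> X" "b \<in> X" for a b
    using inj_on_eq_iff[OF f(1)] fX(3)[OF that(1)] fX(3)[OF that(2)] by simp
  have adj_sym: "adj a b \<longleftrightarrow> adj b a" for a b unfolding adj_def by (simp add: insert_commute)
  \<comment> \<open>A vertex outside the hub is joined to all \<open>q\<close> hub vertices, which
    leaves it one further neighbour, or two if it is vertex \<open>q\<close>.\<close>
  have res: "card {b \<in> X. adj a b} \<le> 1 + of_bool (f a = q)" if a: "a \<in> X" for a
  proof -
    have "{0..<q} \<subseteq> nb E (f a)"
    proof
      fix i assume "i \<in> {0..<q}"
      then have "f a \<in> nb E i" using hub[of i] fX[OF a] by simp
      then show "i \<in> nb E (f a)" by (simp add: insert_commute)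
    qed
    moreover have "f ` {b \<in> X. adj a b} \<subseteq> nb E (f a)" unfolding adj_def by auto
    ultimately have "card ({0..<q} \<union> f ` {b \<in> X. adj a b}) \<le> card (nb E (f a))"
      using rD(4) by (intro card_mono) auto
    also have "\<dots> = extremal_degree n q (f a)" using rD(3)[of "f a"] fX[OF a] by simp
    also have "\<dots> \<le> q + 1 + of_bool (f a = q)" using fX[OF a] unfolding extremal_degree_def by simp
    also have "card ({0..<q} \<union> f ` {b \<in> X. adj a b}) = q + card {b \<in> X. adj a b}"
    proof -
      have "finite X" using X by (metis card.infinite zero_neq_numeral)
      moreover have "inj_on f {b \<in> X. adj a b}" using injX unfolding inj_on_def by blast
      moreover have "{0..<q} \<inter> f ` {b \<in> X. adj a b} = {}" using fX by force
      ultimately show ?thesis by (simp add: card_Un_disjoint card_image)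
    qed
    finally show ?thesis by simp
  qed
  have fin: "finite X" using X by (metis card.infinite zero_neq_numeral)
  have one: "b = b'" if "a \<in> X" "b \<in> X" "b' \<in> X" "adj a b" "adj a b'" "f a \<noteq> q" for a b b'
  proof -
    have "card {b \<in> X. adj a b} \<le> Suc 0" using res[OF that(1)] that(6) by simp
    then show ?thesis using that fin by (auto simp: card_le_Suc0_iff_eq)
  qed
  have U: "{a, b} \<in> EU" if "a \<in> X" "b \<in> X" "a \<noteq> b" "\<not> adj a b" for a b
    using f(3)[of a b] that fX(3) unfolding adj_def complete_minus_edge by blast
  show ?thesis
  proof (cases "\<exists>c\<in>X. \<exists>a\<in>X. \<exists>b\<in>X. a \<noteq> b \<and> adj c a \<and> adj c b")
    case True
    then obtain c a b where c: "c \<in> X" "a \<in> X" "b \<in> X" "a \<noteq> b" "adj c a" "adj c b" by blast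
    have nadj: "\<not> adj x x" for x
      using simple_graph_no_loop[OF rD(1)] unfolding adj_def by simp
    have ca: "c \<noteq> a" "c \<noteq> b" using nadj c by blast+
    have fc: "f c = q" using one[OF c(1,2,3,5,6)] c(4) by blast
    have "card (X - {a, b, c}) = 1" using X c ca by (simp add: card_Diff_subset)
    then obtain e where "X - {a, b, c} = {e}" by (rule card_1_singletonE)
    then have e: "e \<in> X" "e \<noteq> a" "e \<noteq> b" "e \<noteq> c" by blast+
    have fab: "f a \<noteq> q" "f b \<noteq> q" using fc injX c ca by metis+
    have ac: "adj a c" "adj b c" using c adj_sym by blast+
    have nab: "\<not> adj a b" "\<not> adj a e" "\<not> adj b e"
      using one[OF c(2) c(1) c(3) ac(1) _ fab(1)] one[OF c(2) c(1) e(1) ac(1) _ fab(1)]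
        one[OF c(3) c(1) e(1) ac(2) _ fab(2)] ca e by blast+
    have nce: "\<not> adj e c"
    proof
      assume "adj e c"
      then have "{a, b, e} \<subseteq> {b \<in> X. adj c b}" using c e adj_sym by blast
      then have "card {a, b, e} \<le> card {b \<in> X. adj c b}" using fin by (intro card_mono) auto
      then show False using res[OF c(1)] fc c e by simp
    qed
    have "contains_subgraph ({0..<k}, EU) Z4"
      by (rule contains_Z4I[OF sg, of a b e c]) (use U c e nab nce ca in auto)
    then show ?thesis ..
  next
    case False
    then have single: "a = b" if "c \<in> X" "a \<in> X" "b \<in> X" "adj c a" "adj c b" for a b c using that by blast
    obtain p1 where p1: "p1 \<in> X" using X by fastforce
    have c1: "card (X - {p1}) = 3" using X p1 by simp
    then obtain p2 p3 p4 where p: "X - {p1} = {p2, p3, p4}" "distinct [p2, p3, p4]" by (auto simp: card_3_iff)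
    have pX: "p2 \<in> X" "p3 \<in> X" "p4 \<in> X" and d4: "distinct [p1, p2, p3, p4]" using p by auto
    have C4: ?thesis if "a \<in> X" "b \<in> X" "c \<in> X" "e \<in> X" "distinct [a, b, c, e]"
        "\<not> adj a c" "\<not> adj c b" "\<not> adj b e" "\<not> adj e a" for a b c e
    proof -
      have "contains_subgraph ({0..<k}, EU) C4"
        by (rule contains_C4I[OF sg, of a c b e]) (use U that in auto)
      then show ?thesis ..
    qed
    have opp: ?thesis if "a \<in> X" "b \<in> X" "c \<in> X" "e \<in> X" "distinct [a, b, c, e]" "adj a b" for a b c e
    proof (rule C4[OF that(1-5)])
      show "\<not> adj a c" using single[of a b c] that by auto
      show "\<not> adj c b" using single[of b a c] that adj_sym by auto
      show "\<not> adj b e" using single[of b a e] that adj_sym by auto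
      show "\<not> adj e a" using single[of a b e] that adj_sym by auto
    qed
    \<comment> \<open>An adjacent pair among the five becomes a diagonal by \<open>opp\<close>.
      Otherwise the cycle \<open>p1 p3 p2 p4\<close> works whether or not \<open>p3\<close> and
      \<open>p4\<close> are adjacent.\<close>
    consider "adj p1 p2" | "adj p1 p3" | "adj p1 p4" | "adj p2 p3" | "adj p2 p4"
      | "\<not> adj p1 p3" "\<not> adj p1 p4" "\<not> adj p2 p3" "\<not> adj p2 p4" by blast
    then show ?thesis
    proof cases
      case 1 then show ?thesis using opp[of p1 p2 p3 p4] p1 pX d4 by auto
    next
      case 2 then show ?thesis using opp[of p1 p3 p2 p4] p1 pX d4 by auto
    next
      case 3 then show ?thesis using opp[of p1 p4 p2 p3] p1 pX d4 by auto
    next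
      case 4 then show ?thesis using opp[of p2 p3 p1 p4] p1 pX d4 by auto
    next
      case 5 then show ?thesis using opp[of p2 p4 p1 p3] p1 pX d4 by auto
    next
      case 6
      then show ?thesis using C4[of p1 p2 p3 p4] p1 pX d4 adj_sym by auto
    qed
  qed
qed

section \<open>From degree lists to degree functions, and the value of \<open>sigma\<close>\<close>

lemma realization_realizes: "realization n pi E \<Longrightarrow> realizes {0..<n} (nth pi) E"
  unfolding realization_def realizes_def by auto

lemma realizes_realization:
  "length pi = n \<Longrightarrow> realizes {0..<n} (nth pi) E \<Longrightarrow> realization n pi E"
  unfolding realization_def realizes_def by auto

lemma sum_extremal:
  assumes "q + 3 \<le> n"
  shows "int (\<Sum>i\<in>{0..<n}. extremal_degree n q i) =
    int q * (int n - 1) + (int n - int q) * (int q + 1) + of_bool (odd (n - q))"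
proof -
  have sp: "{0..<n} = {0..<q} \<union> {q..<n}" "{0..<q} \<inter> {q..<n} = {}" using assms by auto
  have "(\<Sum>i\<in>{0..<n}. extremal_degree n q i) = (\<Sum>i\<in>{0..<q}. extremal_degree n q i) + (\<Sum>i\<in>{q..<n}. extremal_degree n q i)"
    unfolding sp(1) using sp(2) by (intro sum.union_disjoint) auto
  also have "(\<Sum>i\<in>{0..<q}. extremal_degree n q i) = (\<Sum>i\<in>{0..<q}. n - 1)"
    by (intro sum.cong) (auto simp: extremal_degree_def)
  also have "(\<Sum>i\<in>{q..<n}. extremal_degree n q i) = (\<Sum>i\<in>{q..<n}. (q + 1) + of_bool (i = q \<and> odd (n - q)))"
    by (intro sum.cong) (auto simp: extremal_degree_def)
  also have "\<dots> = (n - q) * (q + 1) + of_bool (odd (n - q))"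
  proof -
    have "(\<Sum>i\<in>{q..<n}. of_bool (i = q \<and> odd (n - q)) :: nat)
        = (\<Sum>i\<in>{q..<n}. if i = q then of_bool (odd (n - q)) else 0)"
      by (intro sum.cong) auto
    also have "\<dots> = of_bool (odd (n - q))" using assms by (subst sum.delta) auto
    finally have "(\<Sum>i\<in>{q..<n}. of_bool (i = q \<and> odd (n - q)) :: nat) = of_bool (odd (n - q))" .
    then show ?thesis unfolding sum.distrib by simp
  qed
  finally have eq: "(\<Sum>i\<in>{0..<n}. extremal_degree n q i) = q * (n - 1) + ((n - q) * (q + 1) + of_bool (odd (n - q)))"
    by simp
  have i: "int (n - 1) = int n - 1" "int (n - q) = int n - int q" using assms by auto
  show ?thesis unfolding eq by (simp only: of_nat_add of_nat_mult i of_nat_of_bool of_nat_1 add.assoc)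
qed

theorem theorem1p2:
  fixes n r k j :: nat and EU :: "nat set set"
  assumes "n \<ge> 5 * r + 18" and "r + 1 \<ge> k" and "k \<ge> 7" and "j \<ge> 6"
    and "simple_graph {0..<k} EU" and "card EU = j"
    and "contains_subgraph ({0..<k}, EU) K3_union_P3"
    and "\<not> contains_subgraph ({0..<k}, EU) C4"
    and "\<not> contains_subgraph ({0..<k}, EU) Z4"
  shows "int (sigma (complete_minus (r + 1) EU) n) =
    (if odd (int n - int r)
     then (int r - 1) * (2 * int n - int r) - 3 * (int n - int r) - 1
     else (int r - 1) * (2 * int n - int r) - 3 * (int n - int r))"
proof -
  \<comment> \<open>Since \<open>7 <= k <= r + 1\<close>, the subtraction is not truncated.\<close>
  define q where "q = r - 3"
  have r: "r = q + 3" "q + 3 \<le> n" "3 \<le> r" using assms(1-3) unfolding q_def by auto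
  have r4: "r + 1 = q + 4" using r by simp
  define pi0 where "pi0 = map (extremal_degree n q) [0..<n]"
  have len: "length pi0 = n" and nth0: "\<And>i. i < n \<Longrightarrow> pi0 ! i = extremal_degree n q i"
    unfolding pi0_def by simp_all
  have ext_iff: "realizes {0..<n} (nth pi0) E \<longleftrightarrow> realizes {0..<n} (extremal_degree n q) E" for E
    unfolding realizes_def using nth0 by auto
  have re0: "realization n pi0 (extremal_graph n q)"
    using realizes_realization[OF len] ext_iff realizes_extremal[OF r(2)] by blast
  have "sorted (rev pi0)"
    unfolding sorted_rev_iff_nth_mono using r nth0 len by (auto simp: extremal_degree_def)
  then have gr0: "graphic n pi0" using len re0 unfolding graphic_def by blast
  have not0: "\<not> potentially_graphic (complete_minus (r + 1) EU) n pi0"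
  proof
    assume "potentially_graphic (complete_minus (r + 1) EU) n pi0"
    then obtain E where E: "realization n pi0 E" "contains_subgraph ({0..<n}, E) (complete_minus (q + 4) EU)"
      unfolding potentially_graphic_def r4 by blast
    then show False
      using extremal_not_contains[OF _ r(2) assms(5) E(2)] realization_realizes[OF E(1)] ext_iff assms(8,9) by blast
  qed
  have sum0: "sum_list pi0 = (\<Sum>i\<in>{0..<n}. extremal_degree n q i)"
    unfolding pi0_def by (simp add: interv_sum_list_conv_sum_set_nat)
  define F where "F = (int r - 1) * (2 * int n - int r) - 3 * (int n - int r)"
  have iq: "int q = int r - 3" using r by simp
  have "int (sum_list pi0) = F - 3 + of_bool (odd (n - q))"
    unfolding sum0 sum_extremal[OF r(2)] iq F_def by (simp add: algebra_simps)
  moreover have "odd (n - q) \<longleftrightarrow> even (int n - int r)" using r by simp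
  ultimately have s0: "int (sum_list pi0) + 2 = (if odd (int n - int r) then F - 1 else F)" by simp
  have ev: "even (sum_list pi0)"
    using handshake[of "{0..<n}" "extremal_graph n q"] realizes_extremal[OF r(2)]
    unfolding sum0 realizes_def by simp
  have "sigma (complete_minus (r + 1) EU) n = sum_list pi0 + 2"
    unfolding sigma_def
  proof (rule Least_equality)
    show "even (sum_list pi0 + 2) \<and> (\<forall>pi. graphic n pi \<and> sum_list pi0 + 2 \<le> sum_list pi \<longrightarrow>
      potentially_graphic (complete_minus (r + 1) EU) n pi)"
    proof (intro conjI allI impI)
      show "even (sum_list pi0 + 2)" using ev by simp
      fix pi assume pi: "graphic n pi \<and> sum_list pi0 + 2 \<le> sum_list pi"
      then obtain E where E: "realization n pi E" and l: "length pi = n" unfolding graphic_def by blast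
      have re: "realizes {0..<n} (nth pi) E" by (rule realization_realizes[OF E])
      have "int (sum_list pi) = (\<Sum>i\<in>{0..<n}. int (pi ! i))"
        using l by (simp add: sum_list_sum_nth)
      \<comment> \<open>The smaller of the two values suffices for both parities.\<close>
      moreover have "F - 1 \<le> int (sum_list pi)" using pi s0 by (auto split: if_splits)
      ultimately have "bound (int (card {0..<n})) (int r) - 1 \<le> (\<Sum>i\<in>{0..<n}. int (pi ! i))"
        unfolding bound_def F_def by simp
      then have "placeable {0..<n} (nth pi) (r + 1)"
        using degree_sum_placeable[OF r(3) re] assms(1) by simp
      then obtain E' T where E': "realizes {0..<n} (nth pi) E'" "T \<subseteq> {0..<n}" "card T = r + 1" "fits T E'"
        unfolding placeable_def by blast
      have "contains_subgraph ({0..<n}, E') (complete_minus (r + 1) EU)"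
        by (rule contains_complete_minus[OF E'(4,2,3) _ assms(2,7)]) (use E' finite_subset in blast)
      then show "potentially_graphic (complete_minus (r + 1) EU) n pi"
        unfolding potentially_graphic_def using realizes_realization[OF l E'(1)] by blast
    qed
    fix l assume l: "even l \<and> (\<forall>pi. graphic n pi \<and> l \<le> sum_list pi \<longrightarrow>
      potentially_graphic (complete_minus (r + 1) EU) n pi)"
    \<comment> \<open>\<open>pi0\<close> refutes every \<open>l\<close> up to its own sum; as both
      numbers are even, the next candidate is \<open>sum_list pi0 + 2\<close>.\<close>
    then have "sum_list pi0 < l" using gr0 not0 by (meson not_le)
    moreover have "even l" using l by blast
    ultimately show "sum_list pi0 + 2 \<le> l" using ev by presburger
  qed
  then show ?thesis using s0 unfolding F_def by simp
qed

end
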